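(* Let $Q$ be the equioriented type $A_n$ quiver $1\to 2\to\cdots\to n$. Let $P$ be an arbitrary projective and $I$ an arbitrary injective finite-dimensional complex representation of $Q$, and let $M$ be a generic representation of $Q$ of dimension vector $\mathbf{dim}(P)+\mathbf{dim}(I)$. Then the group $\mathrm{Aut}_Q(M)$ acts on $\mathrm{Gr}_{\mathbf{dim}(P)}(M)$ with an open orbit.
   Context: Representations are finite-dimensional over $\mathbb{C}$. For a dimension vector $\mathbf d$, let $R_{\mathbf d}(Q)=\bigoplus_{\alpha:i\to j}\mathrm{Hom}(\mathbb{C}^{d_i},\mathbb{C}^{d_j})$ (sum over the arrows of $Q$) with the conjugation action of $G_{\mathbf d}=\prod_i GL_{d_i}(\mathbb{C})$. Since $Q$ is Dynkin there are finitely many orbits and hence a unique open dense orbit; a generic representation of dimension vector $\mathbf d$ is one in this open orbit (equivalently, $\mathrm{Ext}^1_Q(M,M)=0$). $\mathrm{Gr}_{\mathbf e}(M)$ is the projective variety of subrepresentations of $M$ of dimension vector $\mathbf e$, on which $\mathrm{Aut}_Q(M)$ acts naturally. *)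

theory Defs
  imports
    "HOL-Analysis.Function_Topology"
    "Graph_Theory.Digraph"
    "Jordan_Normal_Form.Gauss_Jordan_Elimination"
    "Jordan_Normal_Form.DL_Submatrix"
    "Jordan_Normal_Form.VS_Connect"
begin

section \<open>Quivers and their representations\<close>

definition equioriented_A :: "nat \<Rightarrow> (nat, nat) pre_digraph" where
  "equioriented_A n = \<lparr>verts = {1..n}, arcs = {1..<n}, tail = (\<lambda>i. i), head = Suc\<rparr>"

text \<open>A representation of \<open>Q\<close> is a dimension vector \<open>d\<close> together with a point of \<open>rep_space Q d\<close>;
  it puts the space of column vectors \<open>carrier_vec (d i)\<close> at the vertex \<open>i\<close>. Up to isomorphism
  every finite-dimensional complex representation has this form. Families over vertices or arcs
  are extensional; values of dimension vectors outside the vertex set are irrelevant.\<close>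

definition rep_space :: "('a, 'b) pre_digraph \<Rightarrow> ('a \<Rightarrow> nat) \<Rightarrow> ('b \<Rightarrow> complex mat) set" where
  "rep_space Q d = (\<Pi>\<^sub>E a\<in>arcs Q. carrier_mat (d (head Q a)) (d (tail Q a)))"

definition rep_hom ::
  "('a, 'b) pre_digraph \<Rightarrow> ('a \<Rightarrow> nat) \<Rightarrow> ('b \<Rightarrow> complex mat) \<Rightarrow>
   ('a \<Rightarrow> nat) \<Rightarrow> ('b \<Rightarrow> complex mat) \<Rightarrow> ('a \<Rightarrow> complex mat) set" where
  "rep_hom Q d M d' N =
     {f \<in> (\<Pi>\<^sub>E i\<in>verts Q. carrier_mat (d' i) (d i)).
        \<forall>a\<in>arcs Q. f (head Q a) * M a = N a * f (tail Q a)}"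

definition rep_aut ::
  "('a, 'b) pre_digraph \<Rightarrow> ('a \<Rightarrow> nat) \<Rightarrow> ('b \<Rightarrow> complex mat) \<Rightarrow> ('a \<Rightarrow> complex mat) set" where
  "rep_aut Q d M = {f \<in> rep_hom Q d M d M. \<forall>i\<in>verts Q. invertible_mat (f i)}"

definition rep_surj ::
  "('a, 'b) pre_digraph \<Rightarrow> ('a \<Rightarrow> nat) \<Rightarrow> ('a \<Rightarrow> nat) \<Rightarrow> ('a \<Rightarrow> complex mat) \<Rightarrow> bool" where
  "rep_surj Q d d' f \<longleftrightarrow>
     (\<forall>i\<in>verts Q. (\<lambda>x. f i *\<^sub>v x) ` carrier_vec (d i) = carrier_vec (d' i))"

definition rep_inj ::
  "('a, 'b) pre_digraph \<Rightarrow> ('a \<Rightarrow> nat) \<Rightarrow> ('a \<Rightarrow> complex mat) \<Rightarrow> bool" where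
  "rep_inj Q d f \<longleftrightarrow> (\<forall>i\<in>verts Q. inj_on (\<lambda>x. f i *\<^sub>v x) (carrier_vec (d i)))"

definition projective_rep ::
  "('a, 'b) pre_digraph \<Rightarrow> ('a \<Rightarrow> nat) \<Rightarrow> ('b \<Rightarrow> complex mat) \<Rightarrow> bool" where
  "projective_rep Q d P \<longleftrightarrow> P \<in> rep_space Q d \<and>
     (\<forall>dX X dY Y g f. X \<in> rep_space Q dX \<and> Y \<in> rep_space Q dY \<and>
        g \<in> rep_hom Q dX X dY Y \<and> rep_surj Q dX dY g \<and> f \<in> rep_hom Q d P dY Y \<longrightarrow>
        (\<exists>h \<in> rep_hom Q d P dX X. \<forall>i\<in>verts Q. g i * h i = f i))"

definition injective_rep ::
  "('a, 'b) pre_digraph \<Rightarrow> ('a \<Rightarrow> nat) \<Rightarrow> ('b \<Rightarrow> complex mat) \<Rightarrow> bool" where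
  "injective_rep Q d J \<longleftrightarrow> J \<in> rep_space Q d \<and>
     (\<forall>dX X dY Y g f. X \<in> rep_space Q dX \<and> Y \<in> rep_space Q dY \<and>
        g \<in> rep_hom Q dX X dY Y \<and> rep_inj Q dX g \<and> f \<in> rep_hom Q dX X d J \<longrightarrow>
        (\<exists>h \<in> rep_hom Q dY Y d J. \<forall>i\<in>verts Q. h i * g i = f i))"

section \<open>Polynomial functions\<close>

text \<open>The functions of \<open>x\<close> given by a complex polynomial in the variables \<open>x v\<close>, \<open>v \<in> V\<close>.\<close>

inductive_set polynomial_functions :: "'v set \<Rightarrow> (('v \<Rightarrow> complex) \<Rightarrow> complex) set"
  for V :: "'v set" where
  const: "(\<lambda>x. c) \<in> polynomial_functions V"
| coord: "v \<in> V \<Longrightarrow> (\<lambda>x. x v) \<in> polynomial_functions V"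
| add: "f \<in> polynomial_functions V \<Longrightarrow> g \<in> polynomial_functions V \<Longrightarrow>
    (\<lambda>x. f x + g x) \<in> polynomial_functions V"
| mult: "f \<in> polynomial_functions V \<Longrightarrow> g \<in> polynomial_functions V \<Longrightarrow>
    (\<lambda>x. f x * g x) \<in> polynomial_functions V"

text \<open>For variables \<open>x (i, k)\<close> grouped into blocks \<open>i \<in> B\<close>: homogeneity in each block separately.\<close>

definition multihomogeneous :: "'i set \<Rightarrow> (('i \<times> 'k \<Rightarrow> complex) \<Rightarrow> complex) \<Rightarrow> bool" where
  "multihomogeneous B F \<longleftrightarrow>
     (\<exists>m :: 'i \<Rightarrow> nat. \<forall>c x. F (\<lambda>(i, k). c i * x (i, k)) = (\<Prod>i\<in>B. c i ^ m i) * F x)"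

section \<open>Generic representations\<close>

definition rep_coords :: "('b \<Rightarrow> complex mat) \<Rightarrow> 'b \<times> nat \<times> nat \<Rightarrow> complex" where
  "rep_coords M = (\<lambda>(a, r, c). M a $$ (r, c))"

text \<open>The Zariski topology on the affine space \<open>rep_space Q d\<close>, generated by the
  distinguished open sets \<open>{M. f M \<noteq> 0}\<close>.\<close>

definition rep_space_topology ::
  "('a, 'b) pre_digraph \<Rightarrow> ('a \<Rightarrow> nat) \<Rightarrow> ('b \<Rightarrow> complex mat) topology" where
  "rep_space_topology Q d = topology_generated_by
     {{M \<in> rep_space Q d. f (rep_coords M) \<noteq> 0} | f.
        f \<in> polynomial_functions
          {(a, r, c). a \<in> arcs Q \<and> r < d (head Q a) \<and> c < d (tail Q a)}}"

definition GL_rep :: "('a, 'b) pre_digraph \<Rightarrow> ('a \<Rightarrow> nat) \<Rightarrow> ('a \<Rightarrow> complex mat) set" where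
  "GL_rep Q d = (\<Pi>\<^sub>E i\<in>verts Q. {g \<in> carrier_mat (d i) (d i). invertible_mat g})"

definition conj_action ::
  "('a, 'b) pre_digraph \<Rightarrow> ('a \<Rightarrow> complex mat) \<Rightarrow> ('b \<Rightarrow> complex mat) \<Rightarrow> 'b \<Rightarrow> complex mat" where
  "conj_action Q g M = (\<lambda>a\<in>arcs Q. g (head Q a) * M a * the (mat_inverse (g (tail Q a))))"

definition rep_orbit ::
  "('a, 'b) pre_digraph \<Rightarrow> ('a \<Rightarrow> nat) \<Rightarrow> ('b \<Rightarrow> complex mat) \<Rightarrow> ('b \<Rightarrow> complex mat) set" where
  "rep_orbit Q d M = (\<lambda>g. conj_action Q g M) ` GL_rep Q d"

definition generic_rep ::
  "('a, 'b) pre_digraph \<Rightarrow> ('a \<Rightarrow> nat) \<Rightarrow> ('b \<Rightarrow> complex mat) \<Rightarrow> bool" where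
  "generic_rep Q d M \<longleftrightarrow> M \<in> rep_space Q d \<and>
     openin (rep_space_topology Q d) (rep_orbit Q d M) \<and>
     rep_space_topology Q d closure_of rep_orbit Q d M = rep_space Q d"

section \<open>Quiver Grassmannians\<close>

definition Grassmannian :: "nat \<Rightarrow> nat \<Rightarrow> complex vec set set" where
  "Grassmannian k m =
     {W. VectorSpace.subspace class_ring W (module_vec TYPE(complex) m) \<and>
         vectorspace.dim class_ring ((module_vec TYPE(complex) m)\<lparr>carrier := W\<rparr>) = k}"

definition quiver_Grassmannian ::
  "('a, 'b) pre_digraph \<Rightarrow> ('a \<Rightarrow> nat) \<Rightarrow> ('a \<Rightarrow> nat) \<Rightarrow> ('b \<Rightarrow> complex mat) \<Rightarrow>
   ('a \<Rightarrow> complex vec set) set" where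
  "quiver_Grassmannian Q e d M =
     {U \<in> (\<Pi>\<^sub>E i\<in>verts Q. Grassmannian (e i) (d i)).
        \<forall>a\<in>arcs Q. (\<lambda>x. M a *\<^sub>v x) ` U (tail Q a) \<subseteq> U (head Q a)}"

text \<open>For \<open>U i\<close> of dimension \<open>e i\<close>, the columns of \<open>B i\<close> form a basis of \<open>U i\<close>.\<close>

definition basis_matrices ::
  "('a, 'b) pre_digraph \<Rightarrow> ('a \<Rightarrow> nat) \<Rightarrow> ('a \<Rightarrow> nat) \<Rightarrow> ('a \<Rightarrow> complex vec set) \<Rightarrow>
   ('a \<Rightarrow> complex mat) set" where
  "basis_matrices Q e d U =
     {B \<in> (\<Pi>\<^sub>E i\<in>verts Q. carrier_mat (d i) (e i)).
        \<forall>i\<in>verts Q. (\<lambda>x. B i *\<^sub>v x) ` carrier_vec (e i) = U i}"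

text \<open>The coordinate \<open>(i, S)\<close> is the maximal minor of \<open>B i\<close> on the set of rows \<open>S\<close>.\<close>

definition pluecker_coords :: "('a \<Rightarrow> complex mat) \<Rightarrow> 'a \<times> nat set \<Rightarrow> complex" where
  "pluecker_coords B = (\<lambda>(i, S). det (submatrix (B i) S UNIV))"

text \<open>The Zariski topology induced by the product over \<open>i\<close> of the Pluecker embeddings, each of
  the Grassmannian into the projectivised \<open>e i\<close>-th exterior power of the space at \<open>i\<close>. It is generated
  by the nonvanishing loci of multihomogeneous polynomials in the Pluecker coordinates. A change
  of bases multiplies the coordinates in each block \<open>i\<close> by a nonzero scalar, so that nonvanishing
  does not depend on the choice of \<open>B\<close>.\<close>

definition quiver_Grassmannian_topology ::
  "('a, 'b) pre_digraph \<Rightarrow> ('a \<Rightarrow> nat) \<Rightarrow> ('a \<Rightarrow> nat) \<Rightarrow> ('b \<Rightarrow> complex mat) \<Rightarrow>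
   ('a \<Rightarrow> complex vec set) topology" where
  "quiver_Grassmannian_topology Q e d M = topology_generated_by
     {{U \<in> quiver_Grassmannian Q e d M.
         \<exists>B \<in> basis_matrices Q e d U. F (pluecker_coords B) \<noteq> 0} | F.
        F \<in> polynomial_functions {(i, S). i \<in> verts Q \<and> S \<subseteq> {..<d i} \<and> card S = e i} \<and>
        multihomogeneous (verts Q) F}"

definition aut_action ::
  "('a, 'b) pre_digraph \<Rightarrow> ('a \<Rightarrow> complex mat) \<Rightarrow> ('a \<Rightarrow> complex vec set) \<Rightarrow>
   'a \<Rightarrow> complex vec set" where
  "aut_action Q g U = (\<lambda>i\<in>verts Q. (\<lambda>x. g i *\<^sub>v x) ` U i)"

definition aut_orbit ::
  "('a, 'b) pre_digraph \<Rightarrow> ('a \<Rightarrow> nat) \<Rightarrow> ('b \<Rightarrow> complex mat) \<Rightarrow> ('a \<Rightarrow> complex vec set) \<Rightarrow>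
   ('a \<Rightarrow> complex vec set) set" where
  "aut_orbit Q d M U = (\<lambda>g. aut_action Q g U) ` rep_aut Q d M"

end

theory Submission
  imports
    Defs
    "HOL-Library.Function_Algebras"
    "Jordan_Normal_Form.DL_Rank"
begin

text \<open>Put \<open>e = dP\<close> and \<open>d = dP + dI\<close>. Lifting through suitable truncated representations shows that
  \<open>dP\<close> is nondecreasing and \<open>dI\<close> is nonincreasing along the quiver. For a representation \<open>M\<close> with
  spaces \<open>V i\<close>, call a point \<open>U\<close> of the quiver Grassmannian an inj-surj point if every \<open>M i\<close> is
  injective on \<open>U i\<close> and every \<open>V (i + 1)\<close> equals \<open>M i (V i) + U (i + 1)\<close>, that is, if \<open>U\<close> is
  projective and \<open>M / U\<close> is injective. The locus of these points turns out to be the required orbit.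

  It is open (\<open>openin_inj_surj_locus\<close>): both conditions on \<open>U\<close> say that \<open>det (L * B) \<noteq> 0\<close> for some
  matrix \<open>L\<close> from a fixed set, where the columns of \<open>B\<close> are a basis of one \<open>U i\<close>, and by the
  Cauchy-Binet expansion this determinant is a linear form in the Pluecker coordinates of \<open>U i\<close>.

  It is nonempty for generic \<open>M\<close> (\<open>generic_inj_surj_locus_nonempty\<close>). Fix vectors in the spaces \<open>V i\<close>
  as candidates for generators of a subrepresentation. The representations for which they generate an
  inj-surj point contain the nonvanishing locus of a polynomial that does not vanish at the direct
  sum of a projective and an injective of the given dimensions. The dense orbit of \<open>M\<close> meets this locus, and the
  inj-surj points are transported along isomorphisms.

  It is a single orbit for every \<open>M\<close>, generic or not (\<open>inj_surj_subrep_conjugate\<close>).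
  Write \<open>M i j\<close> for the composite map from \<open>V i\<close> to \<open>V j\<close>. The space \<open>V 1\<close> carries the
  flag of the spaces \<open>S j = {v. M 1 j v \<in> U j}\<close> and the flag of the spaces
  \<open>T i = {v. M 1 n v \<in> M i n (U i)}\<close>, preceded by the kernel of \<open>M 1 n\<close>. Since \<open>M j n\<close> is injective
  on \<open>U j\<close>, the intersection of \<open>S j\<close> and \<open>T i\<close> for \<open>i \<le> j\<close> is \<open>{v. M 1 j v \<in> M i j (U i)}\<close>, and since
  \<open>M 1 i (V 1) + U i = V i\<close>, its dimension depends only on \<open>e\<close> and \<open>M\<close>.
  Two pairs of flags with the same intersection dimensions are conjugate, so for two inj-surj points
  \<open>U\<close> and \<open>U'\<close> there is an automorphism \<open>h\<close> of \<open>V 1\<close> carrying the flags of \<open>U\<close> to those of \<open>U'\<close>. It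
  induces a map on the image of \<open>S n\<close> in \<open>U n\<close>, which extends to an isomorphism \<open>q\<close> from \<open>U n\<close> to
  \<open>U' n\<close> that carries every \<open>M i n (U i)\<close> to \<open>M i n (U' i)\<close>. As \<open>V i = M 1 i (V 1) + U i\<close>, the map
  \<open>h\<close> and the maps from \<open>U i\<close> to \<open>U' i\<close> induced by \<open>q\<close> glue to an automorphism of \<open>M\<close> carrying \<open>U\<close> to
  \<open>U'\<close>.\<close>

section \<open>Finite-dimensional subspaces of a vector space\<close>

text \<open>A vector space over a field, as a locale of its own, so that the notions below are not
  imported into every interpretation of \<open>vector_space\<close>. Subspaces of varying dimension are
  subspaces of one ambient space, which need not be finite-dimensional; linear maps are defined on
  the whole ambient space and studied on subspaces.\<close>

locale field_vector_space = vector_space scale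
  for scale :: "'a::field \<Rightarrow> 'b::ab_group_add \<Rightarrow> 'b"
begin

interpretation E: vector_space_pair scale scale ..

abbreviation lin :: "('b \<Rightarrow> 'b) \<Rightarrow> bool"
  where "lin f \<equiv> Vector_Spaces.linear scale scale f"

text \<open>Finite-dimensional subspaces.\<close>

definition findim :: "'b set \<Rightarrow> bool"
  where "findim S \<longleftrightarrow> subspace S \<and> (\<exists>b. finite b \<and> S \<subseteq> span b)"

abbreviation sum_space :: "'b set \<Rightarrow> 'b set \<Rightarrow> 'b set"
  where "sum_space A B \<equiv> {x + y | x y. x \<in> A \<and> y \<in> B}"

lemma findimD: "findim S \<Longrightarrow> subspace S"
  by (simp add: findim_def)

lemma findim_subset: "findim S \<Longrightarrow> subspace T \<Longrightarrow> T \<subseteq> S \<Longrightarrow> findim T"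
  by (auto simp: findim_def)

lemma lin_compose: "lin f \<Longrightarrow> lin g \<Longrightarrow> lin (\<lambda>x. g (f x))"
  using Vector_Spaces.linear_compose[of scale scale f scale g] by (simp add: o_def)

lemma lin_id: "lin (\<lambda>x. x)"
  by (rule linear_ident)

lemma subspace_lin_image: "lin f \<Longrightarrow> subspace S \<Longrightarrow> subspace (f ` S)"
  by (rule E.linear_subspace_image)

lemma subspace_preimage:
  assumes "lin f" "subspace S" "subspace T"
  shows "subspace {x \<in> S. f x \<in> T}"
proof -
  have "{x \<in> S. f x \<in> T} = S \<inter> {x. f x \<in> T}" by auto
  then show ?thesis
    using E.linear_subspace_linear_preimage[OF assms(1,3)] assms(2) by (simp add: subspace_inter)
qed

lemma subspace_zero: "subspace {0}" by simp

lemma findim_image: "lin f \<Longrightarrow> findim S \<Longrightarrow> findim (f ` S)"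
  unfolding findim_def
  by (metis E.linear_spans_image E.linear_subspace_image finite_imageI)

lemma findim_sum_space: assumes "findim A" "findim B" shows "findim (sum_space A B)"
proof -
  obtain a b where ab: "finite a" "A \<subseteq> span a" "finite b" "B \<subseteq> span b"
    using assms by (auto simp: findim_def)
  have "sum_space A B \<subseteq> span (a \<union> b)"
    using ab by (auto simp: span_Un)
  with ab show ?thesis
    unfolding findim_def using subspace_sums[OF findimD findimD, OF assms]
    by (meson finite_UnI)
qed

lemma findim_basis_extend:
  assumes S: "findim S" and c: "c \<subseteq> S" "independent c"
  obtains b where "c \<subseteq> b" "b \<subseteq> S" "independent b" "span b = S" "finite b" "card b = dim S"
proof -
  obtain b where b: "c \<subseteq> b" "b \<subseteq> S" "independent b" "S \<subseteq> span b"
    using maximal_independent_subset_extend[OF c] by metis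
  have sp: "span b = S"
    using b S by (simp add: findimD span_subspace)
  obtain d where "finite d" "S \<subseteq> span d" using S by (auto simp: findim_def)
  then have "finite b"
    using independent_span_bound[of d b] b by auto
  with that b sp show thesis
    by (metis dim_eq_card_independent dim_span)
qed

lemma findim_basis:
  assumes S: "findim S"
  obtains b where "b \<subseteq> S" "independent b" "span b = S" "finite b" "card b = dim S"
  using findim_basis_extend[OF S, of "{}"] by (metis empty_subsetI independent_empty)

text \<open>A projection of \<open>S\<close> along \<open>T\<close> onto some complement of \<open>T\<close>.\<close>

lemma projection_exists:
  assumes T: "subspace T" "T \<subseteq> S" and S: "findim S"
  obtains p where "lin p" "\<And>x. x \<in> T \<Longrightarrow> p x = 0" "\<And>x. x \<in> S \<Longrightarrow> x - p x \<in> T"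
proof -
  have fT: "findim T" using findim_subset[OF S T] .
  obtain c where c: "c \<subseteq> T" "independent c" "span c = T"
    using findim_basis[OF fT] by metis
  obtain b where b: "c \<subseteq> b" "independent b" "span b = S"
    using findim_basis_extend[OF S, of c] c T by (metis subset_trans)
  obtain p where p: "lin p" "\<And>x. x \<in> b \<Longrightarrow> p x = (if x \<in> c then 0 else x)"
    using E.linear_independent_extend[OF b(2), of "\<lambda>x. if x \<in> c then 0 else x"] by blast
  have p0: "p x = 0" if "x \<in> T" for x
    using E.linear_eq_on[OF p(1) E.linear_zero, of x c] that c(3) p(2) b(1) by (metis subsetD)
  have p1: "p x = x" if "x \<in> span (b - c)" for x
    using E.linear_eq_on[OF p(1) lin_id that] p(2) by auto
  have "x - p x \<in> T" if "x \<in> S" for x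
  proof -
    have "x \<in> span (c \<union> (b - c))" using that b by (simp add: Un_absorb1)
    then obtain y z where yz: "x = y + z" "y \<in> T" "z \<in> span (b - c)"
      using c by (auto simp: span_Un simp del: Un_Diff_cancel)
    then have "p x = z" using p0 p1 p(1) by (simp add: E.linear_add)
    then show ?thesis using yz by simp
  qed
  then show thesis using that p(1) p0 by blast
qed

lemma dim_image_inj:
  assumes "lin f" "findim S" "inj_on f S"
  shows "dim (f ` S) = dim S"
proof -
  obtain b where b: "b \<subseteq> S" "independent b" "span b = S" "finite b" "card b = dim S"
    using findim_basis[OF assms(2)] .
  have "independent (f ` b)"
    using E.linear_independent_injective_image[OF assms(1) b(2)] b(3) assms(3) by simp
  moreover have "span (f ` b) = f ` S"
    using E.linear_span_image[OF assms(1)] b by simp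
  moreover have "card (f ` b) = card b"
    using assms(3) b(1) by (meson card_image inj_on_subset)
  ultimately show ?thesis
    using b by (metis dim_eq_card_independent dim_span)
qed

lemma rank_nullity:
  assumes f: "lin f" and S: "findim S"
  shows "dim S = dim (f ` S) + dim {x \<in> S. f x = 0}"
proof -
  let ?K = "{x \<in> S. f x = 0}"
  have K: "subspace ?K"
    using subspace_preimage[OF f findimD[OF S] subspace_zero] by simp
  have fK: "findim ?K" using findim_subset[OF S K] by auto
  obtain c where c: "c \<subseteq> ?K" "independent c" "span c = ?K" "finite c" "card c = dim ?K"
    using findim_basis[OF fK] .
  obtain b where b: "c \<subseteq> b" "b \<subseteq> S" "independent b" "span b = S" "finite b" "card b = dim S"
    using findim_basis_extend[OF S, of c] c by auto
  obtain p where p: "lin p" "\<And>x. x \<in> b \<Longrightarrow> p x = (if x \<in> c then 0 else x)"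
    using E.linear_independent_extend[OF b(3), of "\<lambda>x. if x \<in> c then 0 else x"] by blast
  have p0: "p x = 0" if "x \<in> ?K" for x
    using E.linear_eq_on[OF p(1) E.linear_zero, of x c] that c(3) p(2) b(1) by (metis subsetD)
  have p1: "p x = x" if "x \<in> span (b - c)" for x
    using E.linear_eq_on[OF p(1) lin_id that] p(2) by auto
  have sub: "span (b - c) \<subseteq> S" using b span_mono by blast
  have inj: "inj_on f (span (b - c))"
  proof (subst E.linear_inj_on_iff_eq_0[OF f], simp, safe)
    fix x assume "x \<in> span (b - c)" "f x = 0"
    then have "x \<in> ?K" using sub by auto
    then show "x = 0" using p0 p1 \<open>x \<in> span (b - c)\<close> by metis
  qed
  have "f ` S \<subseteq> f ` span (b - c)"
  proof
    fix y assume "y \<in> f ` S"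
    then obtain x where x: "x \<in> S" "y = f x" by auto
    have "x \<in> span (c \<union> (b - c))" using x b by (simp add: Un_absorb1)
    then obtain u z where uz: "x = u + z" "u \<in> ?K" "z \<in> span (b - c)"
      using c(3) by (auto simp: span_Un simp del: Un_Diff_cancel)
    then have "f x = f z" using f by (simp add: E.linear_add)
    then show "y \<in> f ` span (b - c)" using uz x by auto
  qed
  then have im: "f ` S = f ` span (b - c)" using sub by auto
  have bc: "independent (b - c)" using independent_mono[OF b(3)] by auto
  have "dim (f ` S) = dim (span (b - c))"
    unfolding im using f inj b by (intro dim_image_inj) (auto simp: findim_def)
  also have "\<dots> = card (b - c)" using bc by (simp add: dim_eq_card_independent)
  also have "\<dots> = dim S - dim ?K" using b c by (simp add: card_Diff_subset)
  finally show ?thesis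
    using b c by (metis add.commute card_mono le_add_diff_inverse)
qed

lemma dim_sum_space:
  assumes A: "findim A" and B: "findim B"
  shows "dim (sum_space A B) + dim (A \<inter> B) = dim A + dim B"
proof -
  let ?S = "sum_space A B"
  note sA = findimD[OF A] and sB = findimD[OF B]
  have S: "findim ?S" using A B by (rule findim_sum_space)
  have BS: "B \<subseteq> ?S" using subspace_0[OF sA] by force
  have AS: "A \<subseteq> ?S" using subspace_0[OF sB] by force
  obtain p where p: "lin p" "\<And>x. x \<in> B \<Longrightarrow> p x = 0" "\<And>x. x \<in> ?S \<Longrightarrow> x - p x \<in> B"
    using projection_exists[OF sB BS S] by blast
  have k: "p x = 0 \<longleftrightarrow> x \<in> B" if "x \<in> ?S" for x
    using p(2) p(3)[OF that] by fastforce
  have "{x \<in> ?S. p x = 0} = B" using k BS by blast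
  moreover have "{x \<in> A. p x = 0} = A \<inter> B" using k AS by blast
  moreover have "p ` ?S = p ` A"
  proof
    show "p ` ?S \<subseteq> p ` A" using p(1,2) by (auto simp: E.linear_add)
  qed (use AS in auto)
  ultimately show ?thesis
    using rank_nullity[OF p(1) S] rank_nullity[OF p(1) A] by simp
qed

lemma dim_eq_imp_eq:
  assumes "subspace S" "S \<subseteq> T" "findim T" "dim S = dim T"
  shows "S = T"
proof -
  have fS: "findim S" using findim_subset assms by blast
  obtain c where c: "c \<subseteq> S" "independent c" "span c = S" "finite c" "card c = dim S"
    using findim_basis[OF fS] .
  obtain b where b: "c \<subseteq> b" "b \<subseteq> T" "independent b" "span b = T" "finite b" "card b = dim T"
    using findim_basis_extend[OF assms(3), of c] c assms by (metis subset_trans)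
  have "c = b" using b c assms by (metis card_subset_eq)
  then show ?thesis using b c by simp
qed

text \<open>A linear map that vanishes on the kernel of \<open>T\<close> in \<open>X\<close> factors on \<open>X\<close> through \<open>T\<close>.\<close>

lemma linear_factor:
  assumes T: "lin T" and f: "lin f" and X: "subspace X"
    and 0: "\<And>x. x \<in> X \<Longrightarrow> T x = 0 \<Longrightarrow> f x = 0"
  obtains g where "lin g" "\<And>x. x \<in> X \<Longrightarrow> g (T x) = f x"
proof -
  obtain r where r: "range r \<subseteq> X" "lin r" "\<forall>v\<in>T ` X. T (r v) = v"
    using E.linear_exists_right_inverse_on[OF T X] by metis
  show thesis
  proof
    show "lin (\<lambda>x. f (r x))" using r f by (blast intro: lin_compose)
    fix x assume x: "x \<in> X"
    have m: "r (T x) - x \<in> X" using x X r by (meson range_subsetD subspace_diff)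
    have "T (r (T x) - x) = 0" using r x T by (simp add: E.linear_diff)
    from 0[OF m this] show "f (r (T x)) = f x" using f by (simp add: E.linear_diff)
  qed
qed

text \<open>Linear maps on two subspaces that agree on the intersection have a common extension.\<close>

lemma linear_glue:
  assumes A: "subspace A" and B: "subspace B" and f: "lin f" and g: "lin g"
    and eq: "\<And>x. x \<in> A \<Longrightarrow> x \<in> B \<Longrightarrow> f x = g x"
  obtains h where "lin h" "\<And>x. x \<in> A \<Longrightarrow> h x = f x" "\<And>x. x \<in> B \<Longrightarrow> h x = g x"
proof -
  obtain c where c: "c \<subseteq> A" "independent c" "A \<subseteq> span c"
    using maximal_independent_subset[of A] by metis
  have sc: "span c = A" using c A span_subspace by blast
  obtain b where b: "c \<subseteq> b" "b \<subseteq> c \<union> B" "independent b" "c \<union> B \<subseteq> span b"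
    using maximal_independent_subset_extend[of c "c \<union> B"] c by (metis Un_upper1)
  obtain h where h: "lin h" "\<And>x. x \<in> b \<Longrightarrow> h x = (if x \<in> c then f x else g x)"
    using E.linear_independent_extend[OF b(3), of "\<lambda>x. if x \<in> c then f x else g x"] by blast
  have hA: "h x = f x" if "x \<in> A" for x
    using E.linear_eq_on[OF h(1) f, of x c] that h(2) b(1) sc by (metis subsetD)
  have hB: "h x = g x" if x: "x \<in> B" for x
  proof -
    have "x \<in> span (c \<union> (b - c))" using x b(1,4) by (auto simp: Un_absorb1)
    then obtain y z where yz: "x = y + z" "y \<in> A" "z \<in> span (b - c)"
      using sc by (auto simp: span_Un simp del: Un_Diff_cancel)
    have "b - c \<subseteq> B" using b(2) by auto
    then have "z \<in> B" using yz(3) span_minimal[OF _ B] by blast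
    then have "y \<in> B" using yz(1) x subspace_diff[OF B] by (metis add_diff_cancel_right')
    have "h z = g z" using E.linear_eq_on[OF h(1) g yz(3)] h(2) by auto
    then show ?thesis
      using yz hA eq[OF yz(2) \<open>y \<in> B\<close>] h(1) g by (simp add: E.linear_add)
  qed
  show thesis using that h(1) hA hB by blast
qed

text \<open>An injection of \<open>C\<close> into \<open>G'\<close> extends to an isomorphism from \<open>G \<supseteq> C\<close> onto \<open>G'\<close>, provided that
  the dimensions agree.\<close>

lemma iso_extend:
  assumes k: "lin k" and C: "subspace C" "C \<subseteq> G" and inj: "inj_on k C" and kC: "k ` C \<subseteq> G'"
    and G: "findim G" "findim G'" and d: "dim G = dim G'"
  obtains h where "lin h" "\<And>x. x \<in> C \<Longrightarrow> h x = k x" "inj_on h G" "h ` G = G'"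
proof -
  have fC: "findim C" using findim_subset G C by blast
  obtain c where c: "c \<subseteq> C" "independent c" "span c = C" "finite c"
    using findim_basis[OF fC] by metis
  obtain b where b: "c \<subseteq> b" "b \<subseteq> G" "independent b" "span b = G" "finite b" "card b = dim G"
    using findim_basis_extend[OF G(1), of c] c C by (metis subset_trans)
  have ik: "independent (k ` c)"
    using E.linear_independent_injective_image[OF k c(2)] c inj by simp
  have "k ` c \<subseteq> G'" using c kC by auto
  then obtain b' where b': "k ` c \<subseteq> b'" "b' \<subseteq> G'" "independent b'" "span b' = G'" "finite b'"
      "card b' = dim G'"
    using findim_basis_extend[OF G(2) _ ik] by metis
  have "card (k ` c) = card c" using inj c by (meson card_image inj_on_subset)
  then have "card (b - c) = card (b' - k ` c)"
    using b b' c d by (simp add: card_Diff_subset)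
  then obtain t where t: "bij_betw t (b - c) (b' - k ` c)"
    using b b' by (meson finite_Diff finite_same_card_bij)
  obtain h where h: "lin h" "\<And>x. x \<in> b \<Longrightarrow> h x = (if x \<in> c then k x else t x)"
    using E.linear_independent_extend[OF b(3), of "\<lambda>x. if x \<in> c then k x else t x"] by blast
  have hC: "h x = k x" if "x \<in> C" for x
    using E.linear_eq_on[OF h(1) k, of x c] that h(2) b(1) c(3) by (metis subsetD)
  have "bij_betw h c (k ` c)"
    using inj c h b by (auto simp: bij_betw_def inj_on_def subset_iff)
  moreover have "bij_betw h (b - c) (b' - k ` c)"
    using t h by (subst bij_betw_cong[of _ _ t]) auto
  ultimately have "bij_betw h (c \<union> (b - c)) (k ` c \<union> (b' - k ` c))"
    by (rule bij_betw_combine) auto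
  then have bij: "bij_betw h b b'" using b b' by (simp add: Un_absorb1)
  have "h ` G = G'"
    using E.linear_span_image[OF h(1), of b] bij b b' by (simp add: bij_betw_def)
  moreover have "inj_on h G"
    using E.linear_inj_on_span_iff_independent_image[OF h(1), of b] bij b b' by (simp add: bij_betw_def)
  ultimately show thesis using that h(1) hC by blast
qed

end

section \<open>Isomorphisms compatible with flags\<close>

context field_vector_space
begin

interpretation E: vector_space_pair scale scale ..

text \<open>The basic extension step: an isomorphism \<open>k\<close> on \<open>Z\<close> that matches the traces of \<open>G\<close> and \<open>G'\<close>
  extends to \<open>Z + G\<close> so that it carries \<open>G\<close> onto \<open>G'\<close>.\<close>

lemma iso_extend_sum:
  assumes k: "lin k" "inj_on k Z" and Z: "subspace Z"
    and G: "findim G" "findim G'" "dim G = dim G'"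
    and kZ: "k ` (Z \<inter> G) = k ` Z \<inter> G'"
  shows "\<exists>h. lin h \<and> (\<forall>x\<in>Z. h x = k x) \<and> inj_on h (sum_space Z G) \<and> h ` G = G'"
proof -
  have ZG: "subspace (Z \<inter> G)" using Z G(1) by (simp add: subspace_inter findimD)
  have "inj_on k (Z \<inter> G)" using k(2) by (rule inj_on_subset) auto
  moreover have "k ` (Z \<inter> G) \<subseteq> G'" using kZ by auto
  ultimately obtain g where g: "lin g" "\<And>x. x \<in> Z \<inter> G \<Longrightarrow> g x = k x" "inj_on g G" "g ` G = G'"
    using iso_extend[OF k(1) ZG Int_lower2 _ _ G] by blast
  obtain h where h: "lin h" "\<And>x. x \<in> Z \<Longrightarrow> h x = k x" "\<And>x. x \<in> G \<Longrightarrow> h x = g x"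
    using linear_glue[OF Z findimD[OF G(1)] k(1) g(1)] g(2) by (metis IntI)
  have "inj_on h (sum_space Z G)"
  proof (subst E.linear_inj_on_iff_eq_0[OF h(1) subspace_sums[OF Z findimD[OF G(1)]]], safe)
    fix x y assume x: "x \<in> Z" and y: "y \<in> G" and 0: "h (x + y) = 0"
    have e: "k x = g (- y)"
      using 0 h x y g(1) by (simp add: E.linear_add E.linear_neg add_eq_0_iff2)
    have my: "- y \<in> G" using y G(1) by (simp add: findimD subspace_neg)
    then have "k x \<in> G'" using e g(4) by auto
    then have "k x \<in> k ` Z \<inter> G'" using x by auto
    then obtain x' where "x' \<in> Z \<inter> G" "k x = k x'" using kZ by auto
    then have xG: "x \<in> Z \<inter> G" using k(2) x by (metis IntD1 inj_onD)
    then have "g x = g (- y)" using e g(2) by simp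
    then have "x = - y" using g(3) my xG by (meson IntD2 inj_onD)
    then show "x + y = 0" by simp
  qed
  moreover have "h ` G = G'" using h(3) g(4) by (metis image_cong)
  ultimately show ?thesis using h(1,2) by (intro exI[of _ h]) simp
qed

text \<open>The same for an increasing chain \<open>G 0 \<subseteq> \<dots> \<subseteq> G m\<close>. In the induction, the trace of \<open>G (m + 1)\<close> on
  \<open>Z + G m\<close> is the sum of its trace on \<open>Z\<close> and \<open>G m\<close>, by the modular law.\<close>

lemma iso_extend_chain:
  assumes k: "lin k" "inj_on k Z" and Z: "subspace Z"
    and G: "\<And>i. i \<le> m \<Longrightarrow> findim (G i) \<and> findim (G' i) \<and> dim (G i) = dim (G' i)"
    and inc: "\<And>i. i < m \<Longrightarrow> G i \<subseteq> G (Suc i) \<and> G' i \<subseteq> G' (Suc i)"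
    and kZ: "\<And>i. i \<le> m \<Longrightarrow> k ` (Z \<inter> G i) = k ` Z \<inter> G' i"
  shows "\<exists>h. lin h \<and> (\<forall>x\<in>Z. h x = k x) \<and> inj_on h (sum_space Z (G m)) \<and> (\<forall>i\<le>m. h ` G i = G' i)"
  using G inc kZ
proof (induction m)
  case 0
  have G0: "findim (G 0)" "findim (G' 0)" "dim (G 0) = dim (G' 0)"
    and kZ: "k ` (Z \<inter> G 0) = k ` Z \<inter> G' 0"
    using "0.prems" by simp_all
  show ?case
    using iso_extend_sum[OF k Z G0 kZ] by simp
next
  case (Suc m)
  have "\<exists>h. lin h \<and> (\<forall>x\<in>Z. h x = k x) \<and> inj_on h (sum_space Z (G m)) \<and> (\<forall>i\<le>m. h ` G i = G' i)"
    by (rule Suc.IH) (use Suc.prems in auto)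
  then obtain h where h: "lin h" "\<And>x. x \<in> Z \<Longrightarrow> h x = k x" "inj_on h (sum_space Z (G m))"
      "\<And>i. i \<le> m \<Longrightarrow> h ` G i = G' i"
    by auto
  let ?Z = "sum_space Z (G m)"
  have fG: "findim (G m)" "findim (G (Suc m))" "findim (G' (Suc m))" "dim (G (Suc m)) = dim (G' (Suc m))"
    using Suc.prems(1) by auto
  have Gi: "G m \<subseteq> G (Suc m)" "G' m \<subseteq> G' (Suc m)" using Suc.prems(2) by auto
  have sZ: "subspace ?Z" by (rule subspace_sums[OF Z findimD[OF fG(1)]])
  note sG = findimD[OF fG(2)] and sG' = findimD[OF fG(3)]
  have kS: "k ` (Z \<inter> G (Suc m)) = k ` Z \<inter> G' (Suc m)" by (rule Suc.prems(3)) simp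
  have hm: "h ` G m = G' m" using h(4) by auto
  have "h ` (?Z \<inter> G (Suc m)) = h ` ?Z \<inter> G' (Suc m)"
  proof safe
    fix z g assume zg: "z \<in> Z" "g \<in> G m" "z + g \<in> G (Suc m)"
    then have "z \<in> G (Suc m)" using sG Gi subspace_diff[of "G (Suc m)" "z + g" g] by auto
    then have "k z \<in> G' (Suc m)" using kS zg by auto
    moreover have "h g \<in> G' (Suc m)" using hm zg Gi by auto
    ultimately show "h (z + g) \<in> G' (Suc m)"
      using h(1,2) zg sG' by (simp add: E.linear_add subspace_add)
  next
    fix z g assume zg: "z \<in> Z" "g \<in> G m" "h (z + g) \<in> G' (Suc m)"
    have hg: "h g \<in> G' (Suc m)" using hm zg Gi by auto
    have "h (z + g) = k z + h g" using h(1,2) zg by (simp add: E.linear_add)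
    then have "k z \<in> G' (Suc m)" using subspace_diff[OF sG' zg(3) hg] by simp
    then obtain z' where z': "z' \<in> Z" "z' \<in> G (Suc m)" "k z = k z'" using kS zg by blast
    have "h (z + g) = h (z' + g)" using z' h zg by (simp add: E.linear_add)
    moreover have "z' + g \<in> G (Suc m)" using z' zg Gi sG subspace_add by blast
    ultimately show "h (z + g) \<in> h ` (?Z \<inter> G (Suc m))" using z' zg by blast
  qed auto
  note hZ = this
  obtain h' where h': "lin h'" "\<And>x. x \<in> ?Z \<Longrightarrow> h' x = h x" "inj_on h' (sum_space ?Z (G (Suc m)))"
      "h' ` G (Suc m) = G' (Suc m)"
    using iso_extend_sum[OF h(1,3) sZ fG(2-4) hZ] by auto
  have ZZ: "x \<in> ?Z" if "x \<in> Z" for x using that subspace_0[OF findimD[OF fG(1)]] by force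
  have GZ: "x \<in> ?Z" if "x \<in> G i" "i \<le> m" for x i
  proof -
    have "G i \<subseteq> G m" using that(2) Suc.prems(2)
    proof (induction m)
      case (Suc r)
      then show ?case by (cases "i = Suc r") (auto, meson less_Suc_eq less_SucI subsetD)
    qed auto
    then show ?thesis using that subspace_0[OF Z] by force
  qed
  have "h' ` G i = G' i" if "i \<le> Suc m" for i
  proof (cases "i = Suc m")
    case False
    then have "i \<le> m" using that by simp
    have "h' ` G i = h ` G i" using h'(2)[OF GZ[OF _ \<open>i \<le> m\<close>]] by (rule image_cong[OF refl])
    then show ?thesis using h(4) \<open>i \<le> m\<close> by simp
  qed (use h' in auto)
  moreover have "inj_on h' (sum_space Z (G (Suc m)))"
    by (rule inj_on_subset[OF h'(3)]) (use ZZ in blast)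
  moreover have "h' x = k x" if "x \<in> Z" for x using h'(2)[OF ZZ[OF that]] h(2)[OF that] by simp
  ultimately show ?case using h'(1) by (intro exI[of _ h']) simp
qed

text \<open>Two pairs of flags whose pairwise intersections have the same dimensions are conjugate. The
  isomorphism is built along the flag \<open>A\<close>: at each step it is extended from \<open>A q\<close> to \<open>A (q + 1)\<close>,
  compatibly with the chain of the spaces \<open>A (q + 1) \<inter> B i\<close>.\<close>

lemma flag_pair_iso:
  assumes A: "\<And>j. j \<le> m \<Longrightarrow> findim (A j) \<and> findim (A' j)"
    and B: "\<And>i. i \<le> l \<Longrightarrow> subspace (B i) \<and> subspace (B' i)"
    and incA: "\<And>j. j < m \<Longrightarrow> A j \<subseteq> A (Suc j) \<and> A' j \<subseteq> A' (Suc j)"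
    and incB: "\<And>i. i < l \<Longrightarrow> B i \<subseteq> B (Suc i) \<and> B' i \<subseteq> B' (Suc i)"
    and AB: "\<And>j. j \<le> m \<Longrightarrow> A j \<subseteq> B l \<and> A' j \<subseteq> B' l"
    and d: "\<And>i j. i \<le> l \<Longrightarrow> j \<le> m \<Longrightarrow> dim (A j \<inter> B i) = dim (A' j \<inter> B' i)"
  shows "\<exists>h. lin h \<and> inj_on h (A m) \<and> (\<forall>j\<le>m. \<forall>i\<le>l. h ` (A j \<inter> B i) = A' j \<inter> B' i)"
proof -
  have fAB: "findim (A j \<inter> B i) \<and> findim (A' j \<inter> B' i) \<and> dim (A j \<inter> B i) = dim (A' j \<inter> B' i)"
    if "j \<le> m" "i \<le> l" for i j
  proof -
    have "subspace (A j \<inter> B i)" "subspace (A' j \<inter> B' i)"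
      using A[OF that(1)] B[OF that(2)] by (auto intro: subspace_inter findimD)
    then show ?thesis
      using A[OF that(1)] d[OF that(2,1)] by (meson Int_lower1 findim_subset)
  qed
  have step: "\<exists>h. lin h \<and> (\<forall>x\<in>Z. h x = k x) \<and> inj_on h (A j) \<and> (\<forall>i\<le>l. h ` (A j \<inter> B i) = A' j \<inter> B' i)"
    if j: "j \<le> m" and k: "lin k" "inj_on k Z" "subspace Z"
      and kZ: "\<And>i. i \<le> l \<Longrightarrow> k ` (Z \<inter> (A j \<inter> B i)) = k ` Z \<inter> (A' j \<inter> B' i)" for j k Z
  proof -
    have "A j \<subseteq> sum_space Z (A j \<inter> B l)" using AB[OF j] subspace_0[OF k(3)] by force
    moreover have "\<exists>h. lin h \<and> (\<forall>x\<in>Z. h x = k x) \<and> inj_on h (sum_space Z (A j \<inter> B l)) \<and>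
        (\<forall>i\<le>l. h ` (A j \<inter> B i) = A' j \<inter> B' i)"
      using fAB[OF j] incB kZ by (intro iso_extend_chain k) blast+
    ultimately show ?thesis by (meson inj_on_subset)
  qed
  have "\<exists>h. lin h \<and> inj_on h (A q) \<and> (\<forall>j\<le>q. \<forall>i\<le>l. h ` (A j \<inter> B i) = A' j \<inter> B' i)"
    if "q \<le> m" for q
    using that
  proof (induction q)
    case 0
    have "findim (A 0)" "findim (A' 0)" using A by auto
    then have z: "0 \<in> A 0" "0 \<in> A' 0" by (auto dest: findimD subspace_0)
    have "0 \<in> B i" "0 \<in> B' i" if "i \<le> l" for i using B[OF that] by (auto dest: subspace_0)
    then have "\<exists>h. lin h \<and> (\<forall>x\<in>{0}. h x = x) \<and> inj_on h (A 0) \<and>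
        (\<forall>i\<le>l. h ` (A 0 \<inter> B i) = A' 0 \<inter> B' i)"
      using z by (intro step lin_id) auto
    then show ?case by auto
  next
    case (Suc q)
    obtain h where h: "lin h" "inj_on h (A q)" "\<And>j i. j \<le> q \<Longrightarrow> i \<le> l \<Longrightarrow> h ` (A j \<inter> B i) = A' j \<inter> B' i"
      using Suc.IH Suc.prems by auto
    have qm: "q \<le> m" using Suc.prems by simp
    have sA: "subspace (A q)" using A[OF qm] by (simp add: findimD)
    have hA: "h ` A q = A' q" using h(3)[of q l] AB[OF qm] by (simp add: Int_absorb2)
    have inc: "A q \<subseteq> A (Suc q)" "A' q \<subseteq> A' (Suc q)" using incA Suc.prems by auto
    have "h ` (A q \<inter> (A (Suc q) \<inter> B i)) = h ` A q \<inter> (A' (Suc q) \<inter> B' i)" if "i \<le> l" for i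
    proof -
      have "A q \<inter> (A (Suc q) \<inter> B i) = A q \<inter> B i" "A' q \<inter> (A' (Suc q) \<inter> B' i) = A' q \<inter> B' i"
        using inc by auto
      then show ?thesis using h(3)[of q i] that hA by simp
    qed
    then obtain h' where h': "lin h'" "\<And>x. x \<in> A q \<Longrightarrow> h' x = h x" "inj_on h' (A (Suc q))"
        "\<And>i. i \<le> l \<Longrightarrow> h' ` (A (Suc q) \<inter> B i) = A' (Suc q) \<inter> B' i"
      using step[OF Suc.prems h(1,2) sA] by auto
    have sub: "A j \<subseteq> A q" if "j \<le> q" for j
      using that qm
    proof (induction q)
      case (Suc r)
      then show ?case using incA[of r] by (cases "j = Suc r") auto
    qed auto
    have "h' ` (A j \<inter> B i) = A' j \<inter> B' i" if "j \<le> Suc q" "i \<le> l" for i j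
    proof (cases "j = Suc q")
      case False
      then have j: "j \<le> q" using that by simp
      then have "h' ` (A j \<inter> B i) = h ` (A j \<inter> B i)"
        using sub h'(2) by (intro image_cong) auto
      then show ?thesis using h(3) j that by simp
    qed (use h' that in auto)
    then show ?case using h' by blast
  qed
  then show ?thesis by blast
qed

end

section \<open>Conjugacy of subrepresentations that are projective with injective quotient\<close>

text \<open>The composite of the maps \<open>M i\<close>, \<open>\<dots>\<close>, \<open>M (j - 1)\<close>, which goes from vertex \<open>i\<close> to vertex \<open>j\<close>; the
  identity for \<open>i \<ge> j\<close>.\<close>

definition path :: "(nat \<Rightarrow> 'b \<Rightarrow> 'b) \<Rightarrow> nat \<Rightarrow> nat \<Rightarrow> 'b \<Rightarrow> 'b"
  where "path M i j = fold M [i..<j]"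

lemma path_refl: "path M i i = id"
  by (simp add: path_def)

lemma path_Suc: "i \<le> j \<Longrightarrow> path M i (Suc j) v = M j (path M i j v)"
  by (simp add: path_def)

lemma path_path: "i \<le> j \<Longrightarrow> j \<le> k \<Longrightarrow> path M j k (path M i j v) = path M i k v"
  unfolding path_def using upt_add_eq_append[of i j "k - j"] by simp

context field_vector_space
begin

interpretation E: vector_space_pair scale scale ..

text \<open>A representation of the equioriented quiver of type A with vertices \<open>1, \<dots>, n\<close> by subspaces \<open>V i\<close>
  of the ambient space. The map of the arrow from \<open>i\<close> to \<open>i + 1\<close> is the restriction of \<open>M i\<close> to \<open>V i\<close>.\<close>

definition linear_rep :: "nat \<Rightarrow> (nat \<Rightarrow> 'b set) \<Rightarrow> (nat \<Rightarrow> 'b \<Rightarrow> 'b) \<Rightarrow> bool"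
  where "linear_rep n V M \<longleftrightarrow> (\<forall>i\<in>{1..n}. findim (V i)) \<and>
    (\<forall>i\<in>{1..<n}. lin (M i) \<and> M i ` V i \<subseteq> V (Suc i))"

text \<open>The inj-surj subrepresentations \<open>U\<close>: their maps are injective, and the maps of the quotient
  \<open>V / U\<close> are surjective.\<close>

definition inj_surj_subrep ::
  "nat \<Rightarrow> (nat \<Rightarrow> 'b set) \<Rightarrow> (nat \<Rightarrow> 'b \<Rightarrow> 'b) \<Rightarrow> (nat \<Rightarrow> 'b set) \<Rightarrow> bool"
  where "inj_surj_subrep n V M U \<longleftrightarrow> (\<forall>i\<in>{1..n}. subspace (U i) \<and> U i \<subseteq> V i) \<and>
    (\<forall>i\<in>{1..<n}. M i ` U i \<subseteq> U (Suc i) \<and> inj_on (M i) (U i) \<and>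
       V (Suc i) \<subseteq> sum_space (M i ` V i) (U (Suc i)))"

lemma dim_preimage:
  assumes f: "lin f" and X: "findim X" and Y: "subspace Y"
  shows "dim {v \<in> X. f v \<in> Y} = dim (f ` X \<inter> Y) + dim {v \<in> X. f v = 0}"
proof -
  have S: "findim {v \<in> X. f v \<in> Y}"
    by (rule findim_subset[OF X subspace_preimage[OF f findimD[OF X] Y]]) auto
  have "f ` {v \<in> X. f v \<in> Y} = f ` X \<inter> Y" by auto
  moreover have "{x \<in> {v \<in> X. f v \<in> Y}. f x = 0} = {v \<in> X. f v = 0}"
    using subspace_0[OF Y] by auto
  ultimately show ?thesis using rank_nullity[OF f S] by simp
qed

context
  fixes n V M
  assumes rep: "linear_rep n V M"
begin

lemma findim_V: "1 \<le> i \<Longrightarrow> i \<le> n \<Longrightarrow> findim (V i)"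
  using rep by (auto simp: linear_rep_def)

lemma path_lin: "i \<le> j \<Longrightarrow> 1 \<le> i \<Longrightarrow> j \<le> n \<Longrightarrow> lin (path M i j)"
proof (induction rule: dec_induct)
  case base
  then show ?case by (simp add: path_refl id_def lin_id)
next
  case (step k)
  have "path M i (Suc k) = (\<lambda>v. M k (path M i k v))" using step by (auto simp: path_Suc)
  moreover have "lin (path M i k)" using step by simp
  moreover have "lin (M k)" using step rep by (simp add: linear_rep_def)
  ultimately show ?case using lin_compose[of "path M i k" "M k"] by simp
qed

lemma path_V: "i \<le> j \<Longrightarrow> 1 \<le> i \<Longrightarrow> j \<le> n \<Longrightarrow> v \<in> V i \<Longrightarrow> path M i j v \<in> V j"
proof (induction rule: dec_induct)
  case (step k)
  then show ?case using rep by (force simp: linear_rep_def path_Suc)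
qed (simp add: path_refl)

context
  fixes U
  assumes good: "inj_surj_subrep n V M U"
begin

lemma subspace_U: "1 \<le> i \<Longrightarrow> i \<le> n \<Longrightarrow> subspace (U i)"
  and U_V: "1 \<le> i \<Longrightarrow> i \<le> n \<Longrightarrow> U i \<subseteq> V i"
  using good by (auto simp: inj_surj_subrep_def)

lemma findim_U: "1 \<le> i \<Longrightarrow> i \<le> n \<Longrightarrow> findim (U i)"
  using findim_subset[OF findim_V subspace_U U_V] .

lemma path_U: "i \<le> j \<Longrightarrow> 1 \<le> i \<Longrightarrow> j \<le> n \<Longrightarrow> v \<in> U i \<Longrightarrow> path M i j v \<in> U j"
proof (induction rule: dec_induct)
  case (step k)
  then show ?case using good by (force simp: inj_surj_subrep_def path_Suc)
qed (simp add: path_refl)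

lemma path_inj: "i \<le> j \<Longrightarrow> 1 \<le> i \<Longrightarrow> j \<le> n \<Longrightarrow> inj_on (path M i j) (U i)"
proof (induction rule: dec_induct)
  case (step k)
  have "inj_on (M k) (path M i k ` U i)"
    by (rule inj_on_subset[of _ "U k"]) (use step good path_U in \<open>auto simp: inj_surj_subrep_def\<close>)
  then have "inj_on (M k \<circ> path M i k) (U i)"
    using step by (intro comp_inj_on) auto
  moreover have "path M i (Suc k) = M k \<circ> path M i k" using step by (auto simp: path_Suc)
  ultimately show ?case by metis
qed (simp add: path_refl)

lemma path_surj:
  "i \<le> j \<Longrightarrow> 1 \<le> i \<Longrightarrow> j \<le> n \<Longrightarrow> y \<in> V j \<Longrightarrow> \<exists>x\<in>V i. \<exists>u\<in>U j. y = path M i j x + u"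
proof (induction arbitrary: y rule: dec_induct)
  case base
  then have "y = path M i i y + 0" "0 \<in> U i" using subspace_0[OF subspace_U] by (auto simp: path_refl)
  then show ?case using base by blast
next
  case (step k)
  have k: "k \<in> {1..<n}" using step by auto
  then have "V (Suc k) \<subseteq> sum_space (M k ` V k) (U (Suc k))"
    using good unfolding inj_surj_subrep_def by blast
  then obtain z u where z: "z \<in> V k" "u \<in> U (Suc k)" "y = M k z + u" using step.prems by blast
  obtain x u' where x: "x \<in> V i" "u' \<in> U k" "z = path M i k x + u'" using step.IH[OF _ _ z(1)] step.prems by auto
  have lM: "lin (M k)" and Mu: "M k u' \<in> U (Suc k)"
    using rep good k x(2) by (auto simp: linear_rep_def inj_surj_subrep_def image_subset_iff)
  have "y = path M i (Suc k) x + (M k u' + u)"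
    using z x step(1) lM by (simp add: path_Suc E.linear_add add.assoc)
  moreover have "M k u' + u \<in> U (Suc k)"
    using Mu z subspace_add[OF subspace_U] step.prems by simp
  ultimately show ?case using x by blast
qed

text \<open>The images of \<open>V 1\<close> and \<open>U i\<close> in \<open>V j\<close> span the image of \<open>V i\<close>, which does not depend on \<open>U\<close>. This
  makes the dimensions of the intersections of the two flags below independent of \<open>U\<close>.\<close>

lemma path_sum_image:
  assumes "1 \<le> i" "i \<le> j" "j \<le> n"
  shows "sum_space (path M 1 j ` V 1) (path M i j ` U i) = path M i j ` V i"
proof -
  have l: "lin (path M i j)" by (rule path_lin) (use assms in auto)
  have "path M 1 j x + path M i j u \<in> path M i j ` V i" if "x \<in> V 1" "u \<in> U i" for x u
  proof -
    have "path M 1 j x + path M i j u = path M i j (path M 1 i x + u)"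
      using l assms path_path[of 1 i j M x] by (simp add: E.linear_add)
    moreover have "path M 1 i x + u \<in> V i"
      using path_V[of 1 i x] that assms U_V[of i] subspace_add[OF findimD[OF findim_V[of i]]] by auto
    ultimately show ?thesis by simp
  qed
  moreover have "\<exists>a b. path M i j y = a + b \<and> a \<in> path M 1 j ` V 1 \<and> b \<in> path M i j ` U i" if y: "y \<in> V i" for y
  proof -
    have "\<exists>x\<in>V 1. \<exists>u\<in>U i. y = path M 1 i x + u" by (rule path_surj) (use assms y in auto)
    then obtain x u where "x \<in> V 1" "u \<in> U i" "y = path M 1 i x + u" by auto
    moreover from this have "path M i j y = path M 1 j x + path M i j u"
      using l assms path_path[of 1 i j M x] by (simp add: E.linear_add)
    ultimately show ?thesis by blast
  qed
  ultimately show ?thesis by auto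
qed

text \<open>The two flags in \<open>V 1\<close>. The member \<open>i\<close> of the first consists of the vectors whose image in \<open>V n\<close>
  comes from \<open>U i\<close>, and member \<open>0\<close> is the kernel of the map to \<open>V n\<close>. The member \<open>j\<close> of the second
  consists of the vectors that reach \<open>U j\<close> at vertex \<open>j\<close>, and member \<open>0\<close> is the zero space.\<close>

definition target_flag :: "nat \<Rightarrow> 'b set"
  where "target_flag i = {v \<in> V 1. path M 1 n v \<in> (if i = 0 then {0} else path M i n ` U i)}"

definition source_flag :: "nat \<Rightarrow> 'b set"
  where "source_flag j = (if j = 0 then {0} else {v \<in> V 1. path M 1 j v \<in> U j})"

lemma source_Int_target_0:
  assumes "1 \<le> j" "j \<le> n"
  shows "source_flag j \<inter> target_flag 0 = {v \<in> V 1. path M 1 j v = 0}"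
proof -
  have 1: "path M j n (path M 1 j v) = path M 1 n v" for v by (rule path_path) (use assms in auto)
  have 2: "path M j n 0 = 0" by (rule E.linear_0[OF path_lin]) (use assms in auto)
  have 3: "0 \<in> U j" using subspace_0[OF subspace_U] assms by auto
  have 4: "path M 1 j v = 0" if "path M 1 j v \<in> U j" "path M 1 n v = 0" for v
    using inj_onD[OF path_inj[of j n], of "path M 1 j v" 0] assms that 1[of v] 2 3 by auto
  show ?thesis using assms 3 4 2 1[symmetric] by (auto simp: source_flag_def target_flag_def)
qed

lemma source_Int_target_less:
  assumes "1 \<le> i" "i \<le> j" "j \<le> n"
  shows "source_flag j \<inter> target_flag i = {v \<in> V 1. path M 1 j v \<in> path M i j ` U i}"
proof -
  have 1: "path M j n (path M 1 j v) = path M 1 n v" for v by (rule path_path) (use assms in auto)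
  have 2: "path M j n (path M i j v) = path M i n v" for v by (rule path_path) (use assms in auto)
  have 3: "path M i j u \<in> U j" if "u \<in> U i" for u by (rule path_U) (use assms that in auto)
  have 4: "path M 1 j v = path M i j u"
    if "path M 1 j v \<in> U j" "u \<in> U i" "path M 1 n v = path M i n u" for u v
    using inj_onD[OF path_inj[of j n], of "path M 1 j v" "path M i j u"] assms that 1[of v] 2[of u] 3[of u] by auto
  show ?thesis
  proof safe
    fix v assume "v \<in> source_flag j" "v \<in> target_flag i"
    then show "path M 1 j v \<in> path M i j ` U i" "v \<in> V 1"
      using assms 4 by (auto simp: source_flag_def target_flag_def)
  next
    fix v u assume v: "v \<in> V 1" "path M 1 j v = path M i j u" "u \<in> U i"
    then show "v \<in> source_flag j" using assms 3 by (auto simp: source_flag_def)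
    have "path M 1 n v = path M i n u" using v 1[of v] 2[of u] by simp
    then show "v \<in> target_flag i" using assms v by (auto simp: target_flag_def)
  qed
qed

lemma source_subset_target:
  assumes "1 \<le> j" "j \<le> i" "i \<le> n"
  shows "source_flag j \<subseteq> target_flag i"
proof
  fix v assume "v \<in> source_flag j"
  then have v: "v \<in> V 1" "path M 1 j v \<in> U j" using assms by (auto simp: source_flag_def)
  have "path M j i (path M 1 j v) \<in> U i" by (rule path_U) (use assms v in auto)
  then have "path M 1 i v \<in> U i" using path_path[of 1 j i M v] assms by simp
  moreover have "path M i n (path M 1 i v) = path M 1 n v" by (rule path_path) (use assms in auto)
  ultimately show "v \<in> target_flag i" using v assms by (auto simp: target_flag_def intro: rev_image_eqI)
qed

lemma dim_source_target:
  assumes "1 \<le> i" "i \<le> j" "j \<le> n"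
  shows "dim (source_flag j \<inter> target_flag i) + dim (path M i j ` V i) =
    dim (path M 1 j ` V 1) + dim (U i) + dim {v \<in> V 1. path M 1 j v = 0}"
proof -
  have l: "lin (path M i j)" by (rule path_lin) (use assms in auto)
  have l1: "lin (path M 1 j)" by (rule path_lin) (use assms in auto)
  have f1: "findim (V 1)" by (rule findim_V) (use assms in auto)
  have fU: "findim (U i)" by (rule findim_U) (use assms in auto)
  have inj: "inj_on (path M i j) (U i)" by (rule path_inj) (use assms in auto)
  show ?thesis
    unfolding source_Int_target_less[OF assms]
    using dim_preimage[OF l1 f1 subspace_lin_image[OF l findimD[OF fU]]]
      dim_sum_space[OF findim_image[OF l1 f1] findim_image[OF l fU]]
      path_sum_image[OF assms] dim_image_inj[OF l fU inj] by simp
qed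

lemma subspace_source:
  assumes "j \<le> n" "1 \<le> n"
  shows "subspace (source_flag j)"
proof (cases "j = 0")
  case False
  then show ?thesis
    using subspace_preimage[OF path_lin[of 1 j] findimD[OF findim_V[of 1]] subspace_U[of j]] assms
    by (simp add: source_flag_def)
qed (simp add: source_flag_def)

lemma source_V: "1 \<le> n \<Longrightarrow> source_flag j \<subseteq> V 1"
  using subspace_0[OF findimD[OF findim_V[of 1]]] by (auto simp: source_flag_def)

lemma findim_source: "j \<le> n \<Longrightarrow> 1 \<le> n \<Longrightarrow> findim (source_flag j)"
  using findim_subset[OF findim_V[of 1] subspace_source source_V] by simp

lemma subspace_target:
  assumes "i \<le> n" "1 \<le> n"
  shows "subspace (target_flag i)"
proof -
  have "subspace (if i = 0 then {0} else path M i n ` U i)"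
    using subspace_lin_image[OF path_lin[of i n] subspace_U[of i]] assms by simp
  then show ?thesis
    unfolding target_flag_def
    by (intro subspace_preimage path_lin findimD[OF findim_V]) (use assms in auto)
qed

lemma source_mono:
  assumes "j < n"
  shows "source_flag j \<subseteq> source_flag (Suc j)"
proof (cases "j = 0")
  case True
  have "0 \<in> V 1" "0 \<in> U 1" using subspace_0[OF findimD[OF findim_V[of 1]]] subspace_0[OF subspace_U[of 1]] assms by auto
  then show ?thesis using True by (simp add: source_flag_def path_refl)
next
  case False
  then show ?thesis using path_U[of j "Suc j"] assms
    by (auto simp: source_flag_def path_Suc path_refl)
qed

lemma target_mono:
  assumes "i < n"
  shows "target_flag i \<subseteq> target_flag (Suc i)"
proof (cases "i = 0")
  case True
  have "subspace (path M 1 n ` U 1)" by (intro subspace_lin_image path_lin subspace_U) (use assms in auto)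
  then show ?thesis using True subspace_0 by (auto simp: target_flag_def)
next
  case False
  have "path M i n u \<in> path M (Suc i) n ` U (Suc i)" if "u \<in> U i" for u
    using path_path[of i "Suc i" n M u] path_U[of i "Suc i" u] assms False that
    by (metis Suc_leI imageI le_SucI less_one not_le order_refl)
  then show ?thesis using False by (auto simp: target_flag_def)
qed

lemma image_source_target:
  assumes "1 \<le> i" "i \<le> n"
  shows "path M 1 n ` source_flag n \<inter> path M i n ` U i = path M 1 n ` (source_flag n \<inter> target_flag i)"
proof -
  have "source_flag n \<inter> target_flag i = {v \<in> source_flag n. path M 1 n v \<in> path M i n ` U i}"
    using assms source_V by (auto simp: target_flag_def)
  then show ?thesis by blast
qed

end

text \<open>Any two inj-surj subrepresentations of the same dimension vector are conjugate under the
  automorphisms of the representation.\<close>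

lemma inj_surj_subrep_conjugate:
  assumes n: "1 \<le> n" and U: "inj_surj_subrep n V M U" and U': "inj_surj_subrep n V M U'"
    and d: "\<And>i. 1 \<le> i \<Longrightarrow> i \<le> n \<Longrightarrow> dim (U i) = dim (U' i)"
  shows "\<exists>g. (\<forall>i\<in>{1..n}. lin (g i) \<and> g i ` V i = V i \<and> g i ` U i = U' i) \<and>
    (\<forall>i\<in>{1..<n}. \<forall>v\<in>V i. g (Suc i) (M i v) = M i (g i v))"
proof -
  let ?S = "source_flag U" and ?S' = "source_flag U'" and ?T = "target_flag U" and ?T' = "target_flag U'"
  have V1: "findim (V 1)" using findim_V n by simp
  have S0: "?S 0 = {0}" "?S' 0 = {0}" by (simp_all add: source_flag_def[OF U] source_flag_def[OF U'])
  have sT: "subspace (?T i)" "subspace (?T' i)" if "i \<le> n" for i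
    using subspace_target[OF U that n] subspace_target[OF U' that n] .
  have ST: "?S j \<inter> ?T i = ?S j" "?S' j \<inter> ?T' i = ?S' j" if "j \<le> i" "i \<le> n" for i j
  proof -
    have "?S j \<subseteq> ?T i \<and> ?S' j \<subseteq> ?T' i"
    proof (cases "j = 0")
      case True
      then show ?thesis using S0 subspace_0[OF sT(1)] subspace_0[OF sT(2)] that by simp
    next
      case False
      then have "1 \<le> j" by simp
      then show ?thesis
        using source_subset_target[OF U _ that] source_subset_target[OF U' _ that] by blast
    qed
    then show "?S j \<inter> ?T i = ?S j" "?S' j \<inter> ?T' i = ?S' j" by auto
  qed
  have dST: "dim (?S j \<inter> ?T i) = dim (?S' j \<inter> ?T' i)" if ij: "i \<le> j" "1 \<le> j" "j \<le> n" for i j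
  proof (cases "i = 0")
    case True
    then show ?thesis using source_Int_target_0[OF U] source_Int_target_0[OF U'] that by simp
  next
    case False
    then have "1 \<le> i" by simp
    from dim_source_target[OF U this ij(1,3)] dim_source_target[OF U' this ij(1,3)]
    show ?thesis using d[OF \<open>1 \<le> i\<close>] ij by simp
  qed
  have dST: "dim (?S j \<inter> ?T i) = dim (?S' j \<inter> ?T' i)" if "i \<le> n" "j \<le> n" for i j
  proof -
    consider "j = 0" | "1 \<le> j" "i \<le> j" | "1 \<le> j" "j \<le> i" by linarith
    then show ?thesis
    proof cases
      case 1
      then show ?thesis using ST[of 0 i] S0 that by simp
    next
      case 2
      then show ?thesis using dST that by simp
    next
      case 3
      then show ?thesis using dST[of j j] ST[of j i] ST[of j j] that by simp
    qed
  qed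
  \<comment> \<open>An isomorphism of \<open>S n\<close> onto \<open>S' n\<close> respecting both flags, extended to an automorphism \<open>h\<close> of \<open>V 1\<close>.\<close>
  have "\<exists>h. lin h \<and> inj_on h (?S n) \<and> (\<forall>j\<le>n. \<forall>i\<le>n. h ` (?S j \<inter> ?T i) = ?S' j \<inter> ?T' i)"
  proof (rule flag_pair_iso)
    show "findim (?S j) \<and> findim (?S' j)" if "j \<le> n" for j
      using findim_source[OF U that n] findim_source[OF U' that n] by simp
    show "subspace (?T i) \<and> subspace (?T' i)" if "i \<le> n" for i using sT[OF that] by simp
    show "?S j \<subseteq> ?S (Suc j) \<and> ?S' j \<subseteq> ?S' (Suc j)" if "j < n" for j
      using source_mono[OF U that] source_mono[OF U' that] by simp
    show "?T j \<subseteq> ?T (Suc j) \<and> ?T' j \<subseteq> ?T' (Suc j)" if "j < n" for j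
      using target_mono[OF U that] target_mono[OF U' that] by simp
    show "?S j \<subseteq> ?T n \<and> ?S' j \<subseteq> ?T' n" if "j \<le> n" for j using ST[OF that] by auto
  qed (rule dST)
  then obtain h0 where h0: "lin h0" "inj_on h0 (?S n)"
      "\<And>i j. j \<le> n \<Longrightarrow> i \<le> n \<Longrightarrow> h0 ` (?S j \<inter> ?T i) = ?S' j \<inter> ?T' i" by auto
  have "h0 ` ?S n \<subseteq> V 1" using h0(3)[of n n] ST[of n n] source_V[OF U' n] by auto
  then obtain h where h: "lin h" "\<And>x. x \<in> ?S n \<Longrightarrow> h x = h0 x" "inj_on h (V 1)" "h ` V 1 = V 1"
    using iso_extend[OF h0(1) subspace_source[OF U order_refl n] source_V[OF U n] h0(2) _ V1 V1 refl]
    by metis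
  have Sn: "?S j \<subseteq> ?S n" if "j \<le> n" for j
    using that
  proof (induction rule: inc_induct)
    case (step j)
    then show ?case using source_mono[OF U, of j] by auto
  qed simp
  have hST: "h ` (?S j \<inter> ?T i) = ?S' j \<inter> ?T' i" if "j \<le> n" "i \<le> n" for i j
  proof -
    have "h ` (?S j \<inter> ?T i) = h0 ` (?S j \<inter> ?T i)" using Sn[OF that(1)] h(2) by (intro image_cong) auto
    then show ?thesis using h0(3)[OF that] by simp
  qed
  have hS: "h ` ?S j = ?S' j" if "j \<le> n" for j using hST[OF that order_refl] ST[OF that] by simp
  let ?p = "path M 1 n"
  have lp: "lin (path M i j)" if "1 \<le> i" "i \<le> j" "j \<le> n" for i j using path_lin that by simp
  have lpn: "lin ?p" using lp n by simp
  have ker: "path M 1 i (h x) = 0" if "1 \<le> i" "i \<le> n" "x \<in> V 1" "path M 1 i x = 0" for i x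
  proof -
    have "x \<in> ?S i \<inter> ?T 0" using source_Int_target_0[OF U that(1,2)] that by auto
    then have "h x \<in> ?S' i \<inter> ?T' 0" using hST[of i 0] that by blast
    then show ?thesis using source_Int_target_0[OF U' that(1,2)] by auto
  qed
  have SV: "?S n \<subseteq> V 1" using source_V[OF U n] .
  \<comment> \<open>As \<open>h\<close> preserves the kernel of \<open>M 1 n\<close>, it induces \<open>q0\<close> on the image of \<open>S n\<close> in \<open>U n\<close>.\<close>
  obtain q0 where q0: "lin q0" "\<And>x. x \<in> ?S n \<Longrightarrow> q0 (?p x) = ?p (h x)"
    using linear_factor[OF lpn lin_compose[OF h(1) lpn] subspace_source[OF U order_refl n]]
      ker[OF n order_refl] SV by (metis subsetD)
  let ?Z = "?p ` ?S n"
  have sZ: "subspace ?Z" by (rule subspace_lin_image[OF lpn subspace_source[OF U order_refl n]])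
  have injZ: "inj_on q0 ?Z"
  proof (subst E.linear_inj_on_iff_eq_0[OF q0(1) sZ], safe)
    fix x assume x: "x \<in> ?S n" "q0 (?p x) = 0"
    have "h x \<in> V 1" using x SV h(4) by blast
    moreover have "?p (h x) = 0" using x q0(2) by simp
    ultimately have "h x \<in> ?S' n \<inter> ?T' 0"
      unfolding source_Int_target_0[OF U' n order_refl] by simp
    then obtain x' where x': "x' \<in> ?S n \<inter> ?T 0" "h x = h x'" using hST[of n 0] by auto
    then have "x = x'" using h(3) x SV by (meson IntD1 inj_onD subsetD)
    then show "?p x = 0" using x' source_Int_target_0[OF U n order_refl] by auto
  qed
  \<comment> \<open>The chain \<open>G\<close> is the image in \<open>U n\<close> of \<open>U 1, \<dots>, U n\<close>, with indices shifted to start at 0; its last member is \<open>U n\<close>.\<close>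
  let ?G = "\<lambda>i. path M (Suc i) n ` U (Suc i)" and ?G' = "\<lambda>i. path M (Suc i) n ` U' (Suc i)"
  have "\<exists>q. lin q \<and> (\<forall>x\<in>?Z. q x = q0 x) \<and> inj_on q (sum_space ?Z (?G (n - 1))) \<and> (\<forall>i\<le>n-1. q ` ?G i = ?G' i)"
  proof (rule iso_extend_chain[OF q0(1) injZ sZ])
    fix i assume "i \<le> n - 1"
    then have i: "1 \<le> Suc i" "Suc i \<le> n" using n by auto
    have l: "lin (path M (Suc i) n)" using lp i by simp
    show "findim (?G i) \<and> findim (?G' i) \<and> dim (?G i) = dim (?G' i)"
      using findim_image[OF l findim_U[OF U i]] findim_image[OF l findim_U[OF U' i]] d[OF i]
        dim_image_inj[OF l findim_U[OF U i]  path_inj[OF U i(2,1)]]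
        dim_image_inj[OF l findim_U[OF U' i]  path_inj[OF U' i(2,1)]] by simp
    have "q0 ` (?Z \<inter> ?G i) = q0 ` ?p ` (?S n \<inter> ?T (Suc i))"
      using image_source_target[OF U i] by simp
    also have "\<dots> = ?p ` h ` (?S n \<inter> ?T (Suc i))"
      using q0(2) by (simp add: image_image)
    also have "\<dots> = ?p ` ?S' n \<inter> ?G' i"
      using hST[of n "Suc i"] i image_source_target[OF U' i] by simp
    also have "?p ` ?S' n = q0 ` ?Z"
      using hS[of n] q0(2) by (simp add: image_image flip: hS)
    finally show "q0 ` (?Z \<inter> ?G i) = q0 ` ?Z \<inter> ?G' i" .
  next
    fix i assume "i < n - 1"
    then have i: "1 \<le> Suc i" "Suc (Suc i) \<le> n" by auto
    have "path M (Suc i) n ` W (Suc i) \<subseteq> path M (Suc (Suc i)) n ` W (Suc (Suc i))"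
      if W: "inj_surj_subrep n V M W" for W
    proof safe
      fix u assume "u \<in> W (Suc i)"
      then have "path M (Suc i) (Suc (Suc i)) u \<in> W (Suc (Suc i))" using path_U[OF W] i by simp
      moreover have "path M (Suc (Suc i)) n (path M (Suc i) (Suc (Suc i)) u) = path M (Suc i) n u"
        by (rule path_path) (use i in auto)
      ultimately show "path M (Suc i) n u \<in> path M (Suc (Suc i)) n ` W (Suc (Suc i))"
        by (metis imageI)
    qed
    then show "?G i \<subseteq> ?G (Suc i) \<and> ?G' i \<subseteq> ?G' (Suc i)" using U U' by blast
  qed
  then obtain q where q: "lin q" "\<And>x. x \<in> ?Z \<Longrightarrow> q x = q0 x" "\<And>i. i \<le> n - 1 \<Longrightarrow> q ` ?G i = ?G' i"
    by auto
  have qG: "q ` path M i n ` U i = path M i n ` U' i" if "1 \<le> i" "i \<le> n" for i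
    using q(3)[of "i - 1"] that by auto
  \<comment> \<open>At vertex \<open>i\<close>, the map induced by \<open>h\<close> on the image of \<open>V 1\<close> and the map induced by \<open>q\<close> on \<open>U i\<close> agree on the intersection.\<close>
  have ex: "\<exists>g. lin g \<and> (\<forall>x\<in>V 1. g (path M 1 i x) = path M 1 i (h x)) \<and>
      (\<forall>u\<in>U i. g u \<in> U' i \<and> path M i n (g u) = q (path M i n u))" if "i \<in> {1..n}" for i
  proof -
    have i: "1 \<le> i" "i \<le> n" using that by auto
    have l1: "lin (path M 1 i)" and l: "lin (path M i n)"
      using lp[OF order_refl i] lp[OF i order_refl] .
    have injU': "inj_on (path M i n) (U' i)" by (rule path_inj[OF U' i(2,1) order_refl])
    obtain t where t: "lin t" "\<And>x. x \<in> V 1 \<Longrightarrow> t (path M 1 i x) = path M 1 i (h x)"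
      using linear_factor[OF l1 lin_compose[OF h(1) l1] findimD[OF V1]] ker[OF i] by metis
    obtain r where r: "lin r" "\<And>x. x \<in> U' i \<Longrightarrow> r (path M i n x) = x"
      using linear_factor[OF l lin_id subspace_U[OF U' i]] injU'
        E.linear_inj_on_iff_eq_0[OF l subspace_U[OF U' i]] by metis
    define s where "s = (\<lambda>u. r (q (path M i n u)))"
    have ls: "lin s" unfolding s_def by (intro lin_compose[OF lin_compose[OF l q(1)] r(1)])
    have s: "s u \<in> U' i \<and> path M i n (s u) = q (path M i n u)" if "u \<in> U i" for u
    proof -
      have "q (path M i n u) \<in> path M i n ` U' i" using qG[OF i] that by blast
      then show ?thesis using r(2) by (auto simp: s_def)
    qed
    have agree: "t y = s y" if "y \<in> path M 1 i ` V 1" "y \<in> U i" for y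
    proof -
      obtain x where x: "x \<in> V 1" "y = path M 1 i x" using \<open>y \<in> path M 1 i ` V 1\<close> by auto
      then have xS: "x \<in> ?S i" using that i by (simp add: source_flag_def[OF U])
      then have "h x \<in> ?S' i" using hS[OF i(2)] by blast
      then have 1: "path M 1 i (h x) \<in> U' i" using i by (simp add: source_flag_def[OF U'])
      have xn: "x \<in> ?S n" using xS Sn[OF i(2)] by auto
      have "path M i n (path M 1 i (h x)) = ?p (h x)" by (rule path_path) (use i in auto)
      also have "\<dots> = q (?p x)" using q0(2) q(2) xn by simp
      also have "?p x = path M i n y" unfolding x(2) by (rule path_path[symmetric]) (use i in auto)
      finally have "path M i n (path M 1 i (h x)) = path M i n (s y)" using s that by simp
      then have "path M 1 i (h x) = s y" using injU' 1 s that by (meson inj_onD)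
      then show ?thesis using t(2) x by simp
    qed
    obtain g where "lin g" "\<And>x. x \<in> path M 1 i ` V 1 \<Longrightarrow> g x = t x" "\<And>x. x \<in> U i \<Longrightarrow> g x = s x"
      using linear_glue[OF subspace_lin_image[OF l1 findimD[OF V1]] subspace_U[OF U i] t(1) ls agree] by blast
    then show ?thesis using s t(2) by (intro exI[of _ g]) auto
  qed
  then have "\<forall>i\<in>{1..n}. \<exists>g. lin g \<and> (\<forall>x\<in>V 1. g (path M 1 i x) = path M 1 i (h x)) \<and>
      (\<forall>u\<in>U i. g u \<in> U' i \<and> path M i n (g u) = q (path M i n u))" by blast
  from bchoice[OF this] obtain g where gg: "\<forall>i\<in>{1..n}. lin (g i) \<and>
      (\<forall>x\<in>V 1. g i (path M 1 i x) = path M 1 i (h x)) \<and>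
      (\<forall>u\<in>U i. g i u \<in> U' i \<and> path M i n (g i u) = q (path M i n u))" ..
  have g: "lin (g i)" "x \<in> V 1 \<Longrightarrow> g i (path M 1 i x) = path M 1 i (h x)"
      "u \<in> U i \<Longrightarrow> g i u \<in> U' i" "u \<in> U i \<Longrightarrow> path M i n (g i u) = q (path M i n u)"
    if "i \<in> {1..n}" for i x u
    using bspec[OF gg that] by blast+
  have gU: "g i ` U i = U' i" if "i \<in> {1..n}" for i
  proof
    show "g i ` U i \<subseteq> U' i" using g(3) that by auto
    show "U' i \<subseteq> g i ` U i"
    proof
      fix u' assume u': "u' \<in> U' i"
      then have "path M i n u' \<in> q ` path M i n ` U i" using qG[of i] that by simp
      then obtain u where u: "u \<in> U i" "path M i n u' = q (path M i n u)" by blast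
      then have "path M i n u' = path M i n (g i u)" using g(4) that by simp
      then have "u' = g i u" using path_inj[OF U', of i n] that u' g(3) u by (auto dest: inj_onD)
      then show "u' \<in> g i ` U i" using u by auto
    qed
  qed
  have gV: "g i ` V i = V i" if i: "i \<in> {1..n}" for i
  proof -
    have sV: "subspace (V i)" using findimD[OF findim_V] i by simp
    have dec: "\<exists>x\<in>V 1. \<exists>u\<in>W i. y = path M 1 i x + u" if "inj_surj_subrep n V M W" "y \<in> V i" for W y
      using path_surj[OF that(1), of 1 i y] that i by auto
    have pV: "path M 1 i x \<in> V i" if "x \<in> V 1" for x using path_V[of 1 i x] that i by auto
    have UV: "U' i \<subseteq> V i" "U i \<subseteq> V i" using U_V[OF U'] U_V[OF U] i by auto
    show ?thesis
    proof safe
      fix y assume "y \<in> V i"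
      from dec[OF U this] obtain x u where xu: "x \<in> V 1" "u \<in> U i" "y = path M 1 i x + u" by auto
      have "g i y = path M 1 i (h x) + g i u" using xu g i by (simp add: E.linear_add)
      moreover have "path M 1 i (h x) \<in> V i" using pV h(4) xu by auto
      moreover have "g i u \<in> V i" using g(3) UV i xu by auto
      ultimately show "g i y \<in> V i" using sV subspace_add by metis
    next
      fix y assume "y \<in> V i"
      from dec[OF U' this] obtain x' u' where xu: "x' \<in> V 1" "u' \<in> U' i" "y = path M 1 i x' + u'" by auto
      obtain x where x: "x \<in> V 1" "x' = h x" using h(4) xu by auto
      obtain u where u: "u \<in> U i" "u' = g i u" using gU[OF i] xu by auto
      have "y = g i (path M 1 i x + u)" using xu x u g i by (simp add: E.linear_add)
      moreover have "path M 1 i x + u \<in> V i" using sV subspace_add pV x u UV by blast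
      ultimately show "y \<in> g i ` V i" by blast
    qed
  qed
  have comm: "g (Suc i) (M i v) = M i (g i v)" if i: "i \<in> {1..<n}" and v: "v \<in> V i" for i v
  proof -
    have i': "i \<in> {1..n}" "Suc i \<in> {1..n}" using i by auto
    have lM: "lin (M i)" using rep i by (auto simp: linear_rep_def)
    have MU: "M i u \<in> W (Suc i)" if "inj_surj_subrep n V M W" "u \<in> W i" for W u
      using path_U[OF that(1), of i "Suc i" u] that i by (auto simp: path_Suc path_refl)
    have pS: "path M 1 (Suc i) x = M i (path M 1 i x)" for x using path_Suc[of 1 i M x] i by simp
    have pn: "path M (Suc i) n (M i u) = path M i n u" for u
      using path_path[of i "Suc i" n M u] i by (simp add: path_Suc path_refl)
    obtain x u where xu: "x \<in> V 1" "u \<in> U i" "v = path M 1 i x + u"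
      using path_surj[OF U, of 1 i v] v i by auto
    have "path M (Suc i) n (g (Suc i) (M i u)) = path M (Suc i) n (M i (g i u))"
      using g(4)[OF i'(2) MU[OF U xu(2)]] g(4)[OF i'(1) xu(2)] pn by simp
    then have e: "g (Suc i) (M i u) = M i (g i u)"
      using path_inj[OF U', of "Suc i" n] g(3)[OF i'(2) MU[OF U xu(2)]] MU[OF U' g(3)[OF i'(1) xu(2)]] i
      by (auto dest: inj_onD)
    have "g (Suc i) (M i v) = g (Suc i) (path M 1 (Suc i) x) + g (Suc i) (M i u)"
      using xu lM g(1)[OF i'(2)] pS by (simp add: E.linear_add)
    also have "\<dots> = M i (path M 1 i (h x)) + M i (g i u)"
      using g(2)[OF i'(2) xu(1)] pS e by simp
    also have "\<dots> = M i (g i v)"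
      using xu lM g(1)[OF i'(1)] g(2)[OF i'(1) xu(1)] by (simp add: E.linear_add)
    finally show ?thesis .
  qed
  show ?thesis using g(1) gU gV comm by (intro exI[of _ g]) blast
qed

end
end

section \<open>Maximal minors and points of Grassmannians\<close>

text \<open>The matrix with the rows \<open>f 0, f 1, \<dots>\<close> of \<open>B\<close> has determinant zero or plus or minus a maximal minor
  of \<open>B\<close>, and the sign does not depend on \<open>B\<close>.\<close>

lemma maximal_minor_rows:
  assumes f: "\<And>i. i < k \<Longrightarrow> f i < m"
  shows "\<exists>c. (inj_on f {0..<k} \<or> c = 0) \<and> (\<forall>B\<in>carrier_mat m k.
    det (mat\<^sub>r k k (\<lambda>i. row B (f i))) = c * det (submatrix (B :: 'a::comm_ring_1 mat) (f ` {0..<k}) UNIV))"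
proof (cases "inj_on f {0..<k}")
  case False
  then obtain i j where ij: "i \<noteq> j" "i < k" "j < k" "f i = f j"
    by (auto simp: inj_on_def)
  have "det (mat\<^sub>r k k (\<lambda>i. row B (f i))) = 0" if "B \<in> carrier_mat m k" for B :: "'a mat"
    by (rule det_identical_rows[OF _ ij(1-3)]) (use ij that in \<open>auto simp: f\<close>)
  then show ?thesis by (intro exI[of _ 0]) auto
next
  case True
  let ?S = "f ` {0..<k}"
  have cS: "card ?S = k" using True by (simp add: card_image)
  define p where "p i = (if i < k then card {a \<in> ?S. a < f i} else i)" for i
  have pick: "pick ?S (p i) = f i" if "i < k" for i
    using that pick_card_in_set[of "f i" ?S] by (simp add: p_def)
  have pk: "p i < k" if "i < k" for i
  proof -
    have "{a \<in> ?S. a < f i} \<subset> ?S" using that by auto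
    then show ?thesis using that cS psubset_card_mono[of ?S] by (simp add: p_def)
  qed
  have "inj_on p {0..<k}"
    using True pick by (metis (no_types, lifting) atLeastLessThan_iff inj_on_def)
  then have p: "p permutes {0..<k}"
    by (intro inj_on_nat_permutes) (auto simp: pk, auto simp: p_def)
  have "det (mat\<^sub>r k k (\<lambda>i. row B (f i))) = signof p * det (submatrix B ?S UNIV)"
    if B: "B \<in> carrier_mat m k" for B :: "'a mat"
  proof -
    have "{i. i < m \<and> i \<in> ?S} = ?S" using f by auto
    then have cr: "card {i. i < dim_row B \<and> i \<in> ?S} = k" using B cS by auto
    have cc: "card {j. j < dim_col B \<and> j \<in> UNIV} = k" using B by simp
    have sc: "submatrix B ?S UNIV \<in> carrier_mat k k"
      by (rule carrier_matI) (simp_all only: dim_submatrix cr cc)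
    have "mat\<^sub>r k k (\<lambda>i. row B (f i)) = mat k k (\<lambda>(i, j). submatrix B ?S UNIV $$ (p i, j))"
    proof (rule eq_matI; simp)
      fix i j assume ij: "i < k" "j < k"
      have "submatrix B ?S UNIV $$ (p i, j) = B $$ (pick ?S (p i), pick UNIV j)"
        by (rule submatrix_index) (simp_all only: cr cc pk ij)
      then show "row B (f i) $ j = submatrix B ?S UNIV $$ (p i, j)"
        using ij B f by (simp add: pick pick_UNIV)
    qed
    then show ?thesis using det_permute_rows[OF sc p] by simp
  qed
  then show ?thesis using True by blast
qed

text \<open>The part of the Cauchy-Binet formula that is needed here: for fixed \<open>A\<close>, the determinant of
  \<open>A * B\<close> is a linear form in the maximal minors of \<open>B\<close>.\<close>

lemma det_mult_maximal_minors:
  fixes A :: "'a::comm_ring_1 mat"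
  assumes A: "A \<in> carrier_mat k m"
  obtains c where "\<And>B. B \<in> carrier_mat m k \<Longrightarrow>
    det (A * B) = (\<Sum>S | S \<subseteq> {..<m} \<and> card S = k. c S * det (submatrix B S UNIV))"
proof -
  let ?F = "{f. (\<forall>i\<in>{0..<k}. f i \<in> {0..<m}) \<and> (\<forall>i. i \<notin> {0..<k} \<longrightarrow> f i = i)}"
  let ?T = "{S. S \<subseteq> {..<m} \<and> card S = k}"
  let ?S = "\<lambda>f::nat \<Rightarrow> nat. f ` {0..<k}"
  have fF: "finite ?F" by (rule finite_bounded_functions) auto
  have fT: "finite ?T" by simp
  have "\<forall>f\<in>?F. \<exists>c. (inj_on f {0..<k} \<or> c = 0) \<and> (\<forall>B\<in>carrier_mat m k.
    det (mat\<^sub>r k k (\<lambda>i. row B (f i))) = c * det (submatrix (B::'a mat) (?S f) UNIV))"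
    by (intro ballI maximal_minor_rows) auto
  from bchoice[OF this] obtain c where c: "\<forall>f\<in>?F. (inj_on f {0..<k} \<or> c f = 0) \<and> (\<forall>B\<in>carrier_mat m k.
    det (mat\<^sub>r k k (\<lambda>i. row B (f i))) = c f * det (submatrix (B::'a mat) (?S f) UNIV))" ..
  define a where "a f = (\<Prod>i = 0..<k. A $$ (i, f i)) * c f" for f
  let ?J = "{f \<in> ?F. inj_on f {0..<k}}"
  show thesis
  proof (rule that)
    fix B :: "'a mat" assume B: "B \<in> carrier_mat m k"
    have "det (A * B) = (\<Sum>f\<in>?F. det (mat\<^sub>r k k (\<lambda>i. A $$ (i, f i) \<cdot>\<^sub>v row B (f i))))"
      unfolding mat_mul_finsum_alt[OF A B] by (rule det_linear_rows_sum) (use A B in auto)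
    also have "\<dots> = (\<Sum>f\<in>?F. a f * det (submatrix B (?S f) UNIV))"
    proof (rule sum.cong[OF refl])
      fix f assume f: "f \<in> ?F"
      have "det (mat\<^sub>r k k (\<lambda>i. A $$ (i, f i) \<cdot>\<^sub>v row B (f i))) =
          (\<Prod>i = 0..<k. A $$ (i, f i)) * det (mat\<^sub>r k k (\<lambda>i. row B (f i)))"
        by (rule det_rows_mul) (use f B in auto)
      then show "det (mat\<^sub>r k k (\<lambda>i. A $$ (i, f i) \<cdot>\<^sub>v row B (f i))) = a f * det (submatrix B (?S f) UNIV)"
        using c f B by (simp add: a_def mult.assoc)
    qed
    also have "\<dots> = (\<Sum>f\<in>?J. a f * det (submatrix B (?S f) UNIV))"
    proof (rule sum.mono_neutral_right[OF fF])
      show "\<forall>f\<in>?F - ?J. a f * det (submatrix B (?S f) UNIV) = 0"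
      proof
        fix f assume "f \<in> ?F - ?J"
        then have "c f = 0" using c by blast
        then show "a f * det (submatrix B (?S f) UNIV) = 0" by (simp add: a_def)
      qed
    qed auto
    also have "\<dots> = (\<Sum>S\<in>?T. \<Sum>f\<in>{f \<in> ?J. ?S f = S}. a f * det (submatrix B (?S f) UNIV))"
    proof (rule sum.group[symmetric])
      show "finite ?J" by (rule finite_subset[OF _ fF]) auto
      show "?S ` ?J \<subseteq> ?T" by (auto simp: card_image)
    qed (rule fT)
    also have "\<dots> = (\<Sum>S\<in>?T. (\<Sum>f\<in>{f \<in> ?J. ?S f = S}. a f) * det (submatrix B S UNIV))"
      by (intro sum.cong refl) (simp add: sum_distrib_right)
    finally show "det (A * B) = (\<Sum>S\<in>?T. (\<Sum>f\<in>{f \<in> ?J. ?S f = S}. a f) * det (submatrix B S UNIV))" .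
  qed
qed

lemma mult_mat_zero_vec:
  "A \<in> carrier_mat m k \<Longrightarrow> A *\<^sub>v 0\<^sub>v k = (0\<^sub>v m :: 'a::comm_ring_1 vec)"
  by (intro eq_vecI) auto

lemma inj_on_mult_mat_vec_iff:
  fixes B :: "'a::comm_ring_1 mat"
  assumes B: "B \<in> carrier_mat m k"
  shows "inj_on (\<lambda>x. B *\<^sub>v x) (carrier_vec k) \<longleftrightarrow> (\<forall>x\<in>carrier_vec k. B *\<^sub>v x = 0\<^sub>v m \<longrightarrow> x = 0\<^sub>v k)"
proof
  assume inj: "inj_on (\<lambda>x. B *\<^sub>v x) (carrier_vec k)"
  have "B *\<^sub>v 0\<^sub>v k = 0\<^sub>v m" using B by (intro eq_vecI) auto
  then show "\<forall>x\<in>carrier_vec k. B *\<^sub>v x = 0\<^sub>v m \<longrightarrow> x = 0\<^sub>v k"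
    using inj by (metis inj_onD zero_carrier_vec)
next
  assume z: "\<forall>x\<in>carrier_vec k. B *\<^sub>v x = 0\<^sub>v m \<longrightarrow> x = 0\<^sub>v k"
  show "inj_on (\<lambda>x. B *\<^sub>v x) (carrier_vec k)"
  proof (rule inj_onI)
    fix x y assume xy: "x \<in> carrier_vec k" "y \<in> carrier_vec k" "B *\<^sub>v x = B *\<^sub>v y"
    then have "B *\<^sub>v (x - y) = 0\<^sub>v m" using B by (simp add: mult_minus_distrib_mat_vec[OF B])
    then have "x - y = 0\<^sub>v k" using z xy by simp
    show "x = y"
    proof (rule eq_vecI)
      fix i assume "i < dim_vec y"
      then have "(x - y) $ i = 0" using \<open>x - y = 0\<^sub>v k\<close> xy by simp
      then show "x $ i = y $ i" using xy \<open>i < dim_vec y\<close> by simp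
    qed (use xy in simp)
  qed
qed

text \<open>The points of the Grassmannian are the column spaces of the matrices with independent columns.\<close>

lemma Grassmannian_iff:
  "W \<in> Grassmannian k m \<longleftrightarrow> (\<exists>B\<in>carrier_mat m k.
     inj_on (\<lambda>x. B *\<^sub>v x) (carrier_vec k) \<and> W = (\<lambda>x. B *\<^sub>v x) ` carrier_vec k)"
proof -
  interpret V: vec_space "TYPE(complex)" m .
  have spanim: "V.span (set (cols B)) = (\<lambda>x. B *\<^sub>v x) ` carrier_vec k" if "B \<in> carrier_mat m k" for B
    using V.col_space_eq[OF that] that unfolding V.col_space_def by auto
  have dimspan: "vectorspace.dim class_ring (V.span_vs S) = card S"
    if "S \<subseteq> carrier_vec m" "finite S" "V.lin_indpt S" for S
    using V.dim_span[of S S] that by (auto simp: maximal_def)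
  show ?thesis
  proof
    assume "W \<in> Grassmannian k m"
    then have W: "VectorSpace.subspace class_ring W V.V"
      and d: "vectorspace.dim class_ring (V.vs W) = k" by (auto simp: Grassmannian_def)
    have WV: "W \<subseteq> carrier_vec m" using W by (auto simp: subspace_def submodule_def)
    have "\<exists>A. finite A \<and> maximal A (\<lambda>S. S \<subseteq> W \<and> V.lin_indpt S)"
    proof (rule maximal_exists[of _ m])
      show "finite A \<and> card A \<le> m" if "A \<subseteq> W \<and> V.lin_indpt A" for A
        using V.li_le_dim[of A] that WV V.dim_is_n by auto
      show "{} \<subseteq> W \<and> V.lin_indpt {}" by (auto simp: V.lin_dep_def)
    qed
    then obtain A where A: "finite A" "A \<subseteq> W" "V.lin_indpt A"
      and mx: "\<And>T. A \<subseteq> T \<Longrightarrow> T \<subseteq> W \<Longrightarrow> V.lin_indpt T \<Longrightarrow> T = A" by (auto simp: maximal_def)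
    have AV: "A \<subseteq> carrier_vec m" using A WV by auto
    have "V.span A \<subseteq> W" using V.span_is_subset[of A W] A W by (simp add: subspace_def)
    moreover have "W \<subseteq> V.span A"
    proof
      fix w assume w: "w \<in> W"
      show "w \<in> V.span A"
      proof (rule ccontr)
        assume nw: "w \<notin> V.span A"
        then have wA: "w \<notin> A" using V.in_own_span[of A] AV by auto
        have "V.lin_indpt (A \<union> {w})"
          using V.lin_dep_iff_in_span[of A w] A AV w WV wA nw by auto
        then show False using mx[of "A \<union> {w}"] w wA A by auto
      qed
    qed
    ultimately have sp: "V.span A = W" by auto
    then have cA: "card A = k" using dimspan[OF AV A(1,3)] d by simp
    obtain as where as: "distinct as" "set as = A" using A(1) finite_distinct_list by blast
    let ?B = "mat_of_cols m as"
    have cols: "cols ?B = as" using as AV by auto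
    have len: "length as = k" using as cA distinct_card by fastforce
    then have B: "?B \<in> carrier_mat m k" by auto
    have "inj_on (\<lambda>x. ?B *\<^sub>v x) (carrier_vec k)"
      using V.lin_depI[OF B] A cols as unfolding inj_on_mult_mat_vec_iff[OF B] by metis
    moreover have "W = (\<lambda>x. ?B *\<^sub>v x) ` carrier_vec k" using spanim[OF B] cols as sp by simp
    ultimately show "\<exists>B\<in>carrier_mat m k.
     inj_on (\<lambda>x. B *\<^sub>v x) (carrier_vec k) \<and> W = (\<lambda>x. B *\<^sub>v x) ` carrier_vec k" using B by blast
  next
    assume "\<exists>B\<in>carrier_mat m k.
     inj_on (\<lambda>x. B *\<^sub>v x) (carrier_vec k) \<and> W = (\<lambda>x. B *\<^sub>v x) ` carrier_vec k"
    then obtain B where B: "B \<in> carrier_mat m k" "inj_on (\<lambda>x. B *\<^sub>v x) (carrier_vec k)"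
      "W = (\<lambda>x. B *\<^sub>v x) ` carrier_vec k" by blast
    have cB: "set (cols B) \<subseteq> carrier_vec m" using B(1) cols_dim by blast
    have dist: "distinct (cols B)"
    proof -
      have "i = j" if ij: "i < k" "j < k" "col B i = col B j" for i j
      proof -
        have "B *\<^sub>v unit_vec k i = B *\<^sub>v unit_vec k j"
          using ij B(1) by (intro eq_vecI) (auto simp: vec_eq_iff)
        then have "unit_vec k i = (unit_vec k j :: complex vec)" using B(2) by (auto dest: inj_onD)
        then show ?thesis using ij by simp
      qed
      then show ?thesis using B(1) by (auto simp: distinct_conv_nth)
    qed
    have li: "V.lin_indpt (set (cols B))"
    proof
      assume "V.lin_dep (set (cols B))"
      from V.lin_depE[OF B(1) this dist] obtain v where
        "v \<in> carrier_vec k" "v \<noteq> 0\<^sub>v k" "B *\<^sub>v v = 0\<^sub>v m" .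
      then show False using B(2) inj_on_mult_mat_vec_iff[OF B(1)] by blast
    qed
    have W: "W = V.span (set (cols B))" using spanim[OF B(1)] B(3) by simp
    have "card (set (cols B)) = k" using dist B(1) by (simp add: distinct_card)
    then show "W \<in> Grassmannian k m"
      unfolding Grassmannian_def W using V.span_is_subspace[of "set (cols B)"] dimspan[OF cB _ li] cB by simp
  qed
qed

section \<open>Matrices as linear maps on one ambient space\<close>

lemma mat_eq_if_mult_vec_eq:
  fixes A B :: "'a::comm_ring_1 mat"
  assumes A: "A \<in> carrier_mat m k" and B: "B \<in> carrier_mat m k"
    and eq: "\<And>v. v \<in> carrier_vec k \<Longrightarrow> A *\<^sub>v v = B *\<^sub>v v"
  shows "A = B"
proof (rule eq_matI)
  fix r c assume "r < dim_row B" "c < dim_col B"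
  then have rc: "r < m" "c < k" using B by auto
  have "(C *\<^sub>v unit_vec k c) $ r = C $$ (r, c)" if "C \<in> carrier_mat m k" for C :: "'a mat"
    using that rc by simp
  from this[OF A] this[OF B] show "A $$ (r, c) = B $$ (r, c)" using eq[of "unit_vec k c"] by simp
qed (use A B in auto)

lemma invertible_matE:
  assumes "invertible_mat A" "A \<in> carrier_mat n n"
  obtains B where "B \<in> carrier_mat n n" "A * B = 1\<^sub>m n" "B * A = 1\<^sub>m n"
proof -
  obtain B where B: "A * B = 1\<^sub>m (dim_row A)" "B * A = 1\<^sub>m (dim_row B)"
    using assms by (auto simp: invertible_mat_def inverts_mat_def)
  have "dim_col (A * B) = n" "dim_col (B * A) = dim_row B" unfolding B using assms by auto
  then have "B \<in> carrier_mat n n" using assms by auto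
  then show thesis using B assms by (intro that[of B]) auto
qed

lemma invertible_matI:
  assumes "A \<in> carrier_mat n n" "B \<in> carrier_mat n n" "A * B = 1\<^sub>m n" "B * A = 1\<^sub>m n"
  shows "invertible_mat A"
  using assms by (auto simp: invertible_mat_def inverts_mat_def)

lemma det_nonzero_obtain_inverse:
  fixes A :: "'a::field mat"
  assumes A: "A \<in> carrier_mat n n" and "det A \<noteq> 0"
  obtains B where "B \<in> carrier_mat n n" "A * B = 1\<^sub>m n" "B * A = 1\<^sub>m n"
  using det_non_zero_imp_unit[OF assms, of "()"]
  by (auto simp: Units_def ring_mat_def)

lemma invertible_mat_if_injective:
  fixes A :: "'a::field mat"
  assumes A: "A \<in> carrier_mat n n" and inj: "\<And>v. v \<in> carrier_vec n \<Longrightarrow> A *\<^sub>v v = 0\<^sub>v n \<Longrightarrow> v = 0\<^sub>v n"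
  shows "invertible_mat A"
proof -
  have "det A \<noteq> 0" using det_0_iff_vec_prod_zero_field[OF A] inj by auto
  then show ?thesis using det_nonzero_obtain_inverse[OF A] invertible_matI[OF A] by metis
qed

lemma mat_inverse_invertible:
  assumes A: "(A :: 'a::field mat) \<in> carrier_mat n n" and "invertible_mat A"
  shows "the (mat_inverse A) \<in> carrier_mat n n" "A * the (mat_inverse A) = 1\<^sub>m n"
    "the (mat_inverse A) * A = 1\<^sub>m n"
proof -
  obtain B where "B \<in> carrier_mat n n" "A * B = 1\<^sub>m n" "B * A = 1\<^sub>m n"
    using invertible_matE[OF assms(2,1)] .
  then have "A \<in> Units (ring_mat TYPE('a) n ())"
    using A by (auto simp: Units_def ring_mat_def)
  then obtain C where C: "mat_inverse A = Some C"
    using mat_inverse(1)[OF A, of "()"] by (cases "mat_inverse A") auto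
  show "the (mat_inverse A) \<in> carrier_mat n n" "A * the (mat_inverse A) = 1\<^sub>m n"
    "the (mat_inverse A) * A = 1\<^sub>m n"
    using mat_inverse(2)[OF A C] C by auto
qed

context field_vector_space
begin

interpretation E: vector_space_pair scale scale ..

text \<open>A projection onto \<open>S\<close>, defined on \<open>S + X\<close>, whose kernel lies in \<open>X\<close>.\<close>

lemma projection_along:
  assumes S: "subspace S" and X: "findim X"
  obtains p where "lin p" "\<And>x. x \<in> S \<Longrightarrow> p x = x"
    "\<And>y. y \<in> sum_space S X \<Longrightarrow> p y \<in> S \<and> y - p y \<in> X"
proof -
  note sX = findimD[OF X]
  obtain q where q: "lin q" "\<And>x. x \<in> S \<inter> X \<Longrightarrow> q x = 0" "\<And>x. x \<in> X \<Longrightarrow> x - q x \<in> S \<inter> X"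
    using projection_exists[OF subspace_inter[OF S sX] Int_lower2 X] by blast
  have l: "lin (\<lambda>x. x - q x)" using E.linear_compose_sub[OF lin_id q(1)] .
  have "x = x - q x" if "x \<in> S" "x \<in> X" for x using q(2) that by simp
  from linear_glue[OF S sX lin_id l this]
  obtain p where p: "lin p" "\<And>x. x \<in> S \<Longrightarrow> p x = x" "\<And>x. x \<in> X \<Longrightarrow> p x = x - q x" by blast
  have "p y \<in> S \<and> y - p y \<in> X" if "y \<in> sum_space S X" for y
  proof -
    obtain s x where y: "y = s + x" "s \<in> S" "x \<in> X" using \<open>y \<in> sum_space S X\<close> by blast
    have e: "p y = s + (x - q x)" using y p by (simp add: E.linear_add)
    have "p y \<in> S" unfolding e using y q(3)[OF y(3)] S by (simp add: subspace_add)
    moreover have "x - (x - q x) \<in> X" using y q(3)[OF y(3)] sX by (blast intro: subspace_diff)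
    then have "y - p y \<in> X" unfolding e using y by simp
    ultimately show ?thesis by simp
  qed
  then show thesis using that[OF p(1,2)] by blast
qed

end

text \<open>The ambient space for all \<open>carrier_vec d\<close> at once is the space of functions from the natural
  numbers to the complex numbers; vectors are embedded by extending them by zero.\<close>

definition fscale :: "complex \<Rightarrow> (nat \<Rightarrow> complex) \<Rightarrow> nat \<Rightarrow> complex"
  where "fscale c f = (\<lambda>i. c * f i)"

lemma fscale_apply [simp]: "fscale c f i = c * f i"
  by (simp add: fscale_def)

interpretation fn: field_vector_space fscale
  by unfold_locales (auto simp: fun_eq_iff algebra_simps)

interpretation fnp: vector_space_pair fscale fscale ..

text \<open>The embedding of vectors of any length into the ambient space.\<close>

definition emb :: "complex vec \<Rightarrow> nat \<Rightarrow> complex"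
  where "emb v = (\<lambda>i. if i < dim_vec v then v $ i else 0)"

lemma emb_add: "dim_vec v = dim_vec w \<Longrightarrow> emb (v + w) = emb v + emb w"
  by (auto simp: emb_def)

lemma emb_smult: "emb (c \<cdot>\<^sub>v v) = fscale c (emb v)"
  by (auto simp: emb_def)

lemma emb_zero: "emb (0\<^sub>v n) = 0"
  by (auto simp: emb_def)

lemma vec_emb: "v \<in> carrier_vec d \<Longrightarrow> vec d (emb v) = v"
  by (auto simp: emb_def)

lemma emb_inj: "v \<in> carrier_vec d \<Longrightarrow> w \<in> carrier_vec d \<Longrightarrow> emb v = emb w \<Longrightarrow> v = w"
  using vec_emb by metis

text \<open>The image of \<open>carrier_vec d\<close>: the functions that vanish from \<open>d\<close> onwards.\<close>

definition coord_space :: "nat \<Rightarrow> (nat \<Rightarrow> complex) set"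
  where "coord_space d = emb ` carrier_vec d"

lemma emb_vec: "f \<in> coord_space d \<Longrightarrow> emb (vec d f) = f"
  by (auto simp: coord_space_def vec_emb)

text \<open>The linear map of a matrix on the ambient space, which ignores the coordinates beyond the number
  of columns.\<close>

definition mat_map :: "complex mat \<Rightarrow> (nat \<Rightarrow> complex) \<Rightarrow> nat \<Rightarrow> complex"
  where "mat_map A f = emb (A *\<^sub>v vec (dim_col A) f)"

lemma lin_mat_map: "fn.lin (mat_map A)"
proof (unfold linear_iff_module_hom, unfold_locales)
  fix f g :: "nat \<Rightarrow> complex" and c
  have "vec (dim_col A) (f + g) = vec (dim_col A) f + vec (dim_col A) g"
    by (intro eq_vecI) auto
  then show "mat_map A (f + g) = mat_map A f + mat_map A g"
    unfolding mat_map_def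
    by (simp add: mult_add_distrib_mat_vec[of A "dim_row A" "dim_col A"] emb_add)
  have "vec (dim_col A) (fscale c f) = c \<cdot>\<^sub>v vec (dim_col A) f"
    by (intro eq_vecI) auto
  then show "mat_map A (fscale c f) = fscale c (mat_map A f)"
    unfolding mat_map_def
    by (simp add: mult_mat_vec[of A "dim_row A" "dim_col A"] emb_smult)
qed

lemma mat_map_emb: "A \<in> carrier_mat p q \<Longrightarrow> v \<in> carrier_vec q \<Longrightarrow> mat_map A (emb v) = emb (A *\<^sub>v v)"
  by (auto simp: mat_map_def vec_emb)

lemma sum_apply: "(\<Sum>c\<in>A. (f c :: nat \<Rightarrow> complex)) i = (\<Sum>c\<in>A. f c i)"
  by (induction A rule: infinite_finite_induct) auto

lemma emb_units: "v \<in> carrier_vec q \<Longrightarrow> emb v = (\<Sum>c<q. fscale (v $ c) (emb (unit_vec q c)))"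
proof
  fix i assume v: "v \<in> carrier_vec q"
  have "(\<Sum>c<q. fscale (v $ c) (emb (unit_vec q c))) i = (\<Sum>c<q. v $ c * emb (unit_vec q c) i)"
    by (simp add: sum_apply)
  also have "\<dots> = (\<Sum>c<q. if c = i then v $ i else 0)"
    by (intro sum.cong) (auto simp: emb_def)
  also have "\<dots> = emb v i" using v by (auto simp: emb_def)
  finally show "emb v i = (\<Sum>c<q. fscale (v $ c) (emb (unit_vec q c))) i" by simp
qed

text \<open>The \<open>p \<times> q\<close> matrix of a linear map of the ambient space.\<close>

definition mat_of_map :: "nat \<Rightarrow> nat \<Rightarrow> ((nat \<Rightarrow> complex) \<Rightarrow> nat \<Rightarrow> complex) \<Rightarrow> complex mat"
  where "mat_of_map p q g = mat p q (\<lambda>(r, c). g (emb (unit_vec q c)) r)"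

lemma mat_of_map_carrier: "mat_of_map p q g \<in> carrier_mat p q"
  by (simp add: mat_of_map_def)

lemma mat_of_map_mult:
  assumes g: "fn.lin g" and v: "v \<in> carrier_vec q"
  shows "mat_of_map p q g *\<^sub>v v = vec p (g (emb v))"
proof (rule eq_vecI)
  fix r assume "r < dim_vec (vec p (g (emb v)))"
  then have r: "r < p" by simp
  have "g (emb v) = (\<Sum>c<q. fscale (v $ c) (g (emb (unit_vec q c))))"
    unfolding emb_units[OF v] by (simp only: fnp.linear_sum[OF g] fnp.linear_scale[OF g])
  then have "g (emb v) r = (\<Sum>c<q. v $ c * g (emb (unit_vec q c)) r)" by (simp add: sum_apply)
  then show "(mat_of_map p q g *\<^sub>v v) $ r = vec p (g (emb v)) $ r"
    using r v by (auto simp: mat_of_map_def scalar_prod_def mult.commute lessThan_atLeast0 intro!: sum.cong)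
qed (simp add: mat_of_map_def)

lemma coord_space_findim: "fn.findim (coord_space d)"
proof -
  have "fn.subspace (coord_space d)"
    unfolding fn.subspace_def
  proof (intro conjI ballI allI)
    show "0 \<in> coord_space d"
      unfolding coord_space_def by (rule image_eqI[of _ _ "0\<^sub>v d"]) (auto simp: emb_zero)
    fix f assume f: "f \<in> coord_space d"
    then obtain v where v: "v \<in> carrier_vec d" "f = emb v" by (auto simp: coord_space_def)
    show "fscale c f \<in> coord_space d" for c
      unfolding coord_space_def by (rule image_eqI[of _ _ "c \<cdot>\<^sub>v v"]) (use v in \<open>auto simp: emb_smult\<close>)
    fix g assume "g \<in> coord_space d"
    then obtain w where w: "w \<in> carrier_vec d" "g = emb w" by (auto simp: coord_space_def)
    show "f + g \<in> coord_space d"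
      unfolding coord_space_def by (rule image_eqI[of _ _ "v + w"]) (use v w in \<open>auto simp: emb_add\<close>)
  qed
  moreover have "coord_space d \<subseteq> fn.span ((\<lambda>c. emb (unit_vec d c)) ` {..<d})"
    unfolding coord_space_def
    by (auto simp: emb_units intro!: fn.span_sum fn.span_scale intro: fn.span_base)
  ultimately show ?thesis unfolding fn.findim_def by blast
qed

lemma emb_image_mult:
  "B \<in> carrier_mat m k \<Longrightarrow> emb ` (\<lambda>x. B *\<^sub>v x) ` carrier_vec k = mat_map B ` coord_space k"
  by (auto simp: coord_space_def image_image mat_map_emb)

text \<open>If the columns of \<open>A\<close> and \<open>B\<close> together span the whole space and those of \<open>B\<close> are independent, then
  \<open>B\<close> has a left inverse whose kernel lies in the column space of \<open>A\<close>. Both conditions that define an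
  inj-surj point become determinantal conditions by means of such left inverses.\<close>

lemma left_inverse_with_kernel:
  fixes A B :: "complex mat"
  assumes A: "A \<in> carrier_mat m p" and B: "B \<in> carrier_mat m k"
    and inj: "inj_on (\<lambda>x. B *\<^sub>v x) (carrier_vec k)"
    and gen: "\<And>y. y \<in> carrier_vec m \<Longrightarrow> \<exists>x\<in>carrier_vec p. \<exists>z\<in>carrier_vec k. y = A *\<^sub>v x + B *\<^sub>v z"
  obtains L where "L \<in> carrier_mat k m" "L * B = 1\<^sub>m k"
    "\<And>y. y \<in> carrier_vec m \<Longrightarrow> L *\<^sub>v y = 0\<^sub>v k \<Longrightarrow> \<exists>x\<in>carrier_vec p. y = A *\<^sub>v x"
proof -
  let ?S = "mat_map B ` coord_space k" and ?X = "mat_map A ` coord_space p"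
  have S: "fn.subspace ?S" and X: "fn.findim ?X"
    by (intro fn.subspace_lin_image fn.findim_image lin_mat_map coord_space_findim fn.findimD)+
  obtain q where q: "fn.lin q" "\<And>x. x \<in> ?S \<Longrightarrow> q x = x"
    "\<And>y. y \<in> fn.sum_space ?S ?X \<Longrightarrow> q y \<in> ?S \<and> y - q y \<in> ?X"
    using fn.projection_along[OF S X] by blast
  have "x = 0" if "x \<in> coord_space k" "mat_map B x = 0" for x
  proof -
    obtain v where v: "v \<in> carrier_vec k" "x = emb v" using \<open>x \<in> coord_space k\<close> by (auto simp: coord_space_def)
    then have "emb (B *\<^sub>v v) = emb (0\<^sub>v m)" using \<open>mat_map B x = 0\<close> B by (simp add: mat_map_emb emb_zero)
    then have "B *\<^sub>v v = 0\<^sub>v m" using emb_inj[of "B *\<^sub>v v" m "0\<^sub>v m"] B v by simp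
    then have "v = 0\<^sub>v k" using inj v inj_on_mult_mat_vec_iff[OF B] by blast
    then show "x = 0" using v by (simp add: emb_zero)
  qed
  from fn.linear_factor[OF lin_mat_map fn.lin_id fn.findimD[OF coord_space_findim] this]
  obtain r where r: "fn.lin r" "\<And>x. x \<in> coord_space k \<Longrightarrow> r (mat_map B x) = x" by blast
  define L where "L = mat_of_map k m (\<lambda>f. r (q f))"
  have l: "fn.lin (\<lambda>f. r (q f))" by (rule fn.lin_compose[OF q(1) r(1)])
  have L: "L \<in> carrier_mat k m" by (simp add: L_def mat_of_map_carrier)
  have Lm: "L *\<^sub>v y = vec k (r (q (emb y)))" if "y \<in> carrier_vec m" for y
    unfolding L_def by (rule mat_of_map_mult[OF l that])
  have LB: "L *\<^sub>v (B *\<^sub>v z) = z" if z: "z \<in> carrier_vec k" for z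
  proof -
    have e: "emb (B *\<^sub>v z) = mat_map B (emb z)" using mat_map_emb[OF B z] by simp
    have "emb z \<in> coord_space k" using z by (simp add: coord_space_def)
    then have "r (q (emb (B *\<^sub>v z))) = emb z" using q(2) r(2) e by simp
    then show ?thesis using Lm[of "B *\<^sub>v z"] B z by (simp add: vec_emb)
  qed
  have "L * B = 1\<^sub>m k"
  proof (rule mat_eq_if_mult_vec_eq)
    show "(L * B) *\<^sub>v v = 1\<^sub>m k *\<^sub>v v" if "v \<in> carrier_vec k" for v
      using LB[OF that] that by (simp add: assoc_mult_mat_vec[OF L B])
  qed (use L B in auto)
  moreover have "\<exists>x\<in>carrier_vec p. y = A *\<^sub>v x" if y: "y \<in> carrier_vec m" "L *\<^sub>v y = 0\<^sub>v k" for y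
  proof -
    obtain x z where xz: "x \<in> carrier_vec p" "z \<in> carrier_vec k" "y = A *\<^sub>v x + B *\<^sub>v z" using gen[OF y(1)] by blast
    have "emb y = mat_map B (emb z) + mat_map A (emb x)"
      unfolding xz(3) using A B xz by (simp add: emb_add mat_map_emb[OF A] mat_map_emb[OF B] add.commute)
    then have "emb y \<in> fn.sum_space ?S ?X" using xz by (auto simp: coord_space_def)
    from q(3)[OF this] obtain z' x' where z': "z' \<in> carrier_vec k" "q (emb y) = mat_map B (emb z')"
      and x': "x' \<in> carrier_vec p" "emb y - q (emb y) = mat_map A (emb x')" by (auto simp: coord_space_def)
    have "emb z' \<in> coord_space k" using z' by (simp add: coord_space_def)
    then have "vec k (emb z') = 0\<^sub>v k" using Lm[OF y(1)] y(2) z' r(2) by simp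
    then have "z' = 0\<^sub>v k" using z' by (simp add: vec_emb)
    then have "q (emb y) = 0" using z' fnp.linear_0[OF lin_mat_map] by (simp add: emb_zero)
    then have "emb y = emb (A *\<^sub>v x')" using x' A by (simp add: mat_map_emb)
    then have "y = A *\<^sub>v x'" using emb_inj[of y m "A *\<^sub>v x'"] y A x' by simp
    then show ?thesis using x' by blast
  qed
  ultimately show thesis using that[OF L] by blast
qed

section \<open>Conjugacy of inj-surj points of the quiver Grassmannian\<close>

lemma equioriented_A_simps [simp]:
  "verts (equioriented_A n) = {1..n}" "arcs (equioriented_A n) = {1..<n}"
  "tail (equioriented_A n) = (\<lambda>i. i)" "head (equioriented_A n) = Suc"
  by (simp_all add: equioriented_A_def)

text \<open>The points \<open>U\<close> of the quiver Grassmannian for which all maps of \<open>U\<close> are injective and all maps of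
  \<open>M / U\<close> are surjective.\<close>

definition inj_surj_locus ::
  "nat \<Rightarrow> (nat \<Rightarrow> nat) \<Rightarrow> (nat \<Rightarrow> nat) \<Rightarrow> (nat \<Rightarrow> complex mat) \<Rightarrow> (nat \<Rightarrow> complex vec set) set"
  where "inj_surj_locus n e d M = {U \<in> quiver_Grassmannian (equioriented_A n) e d M.
    \<forall>i\<in>{1..<n}. inj_on (\<lambda>x. M i *\<^sub>v x) (U i) \<and>
      (\<forall>y\<in>carrier_vec (d (Suc i)). \<exists>x\<in>carrier_vec (d i). \<exists>u\<in>U (Suc i). y = M i *\<^sub>v x + u)}"

lemma quiver_Grassmannian_basis:
  assumes "U \<in> quiver_Grassmannian (equioriented_A n) e d M" "i \<in> {1..n}"
  obtains B where "B \<in> carrier_mat (d i) (e i)" "inj_on (\<lambda>x. B *\<^sub>v x) (carrier_vec (e i))"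
    "U i = (\<lambda>x. B *\<^sub>v x) ` carrier_vec (e i)"
proof -
  have "U i \<in> Grassmannian (e i) (d i)" using assms by (auto simp: quiver_Grassmannian_def)
  then show thesis using that by (auto simp: Grassmannian_iff)
qed

lemma quiver_Grassmannian_carrier:
  assumes "U \<in> quiver_Grassmannian (equioriented_A n) e d M" "i \<in> {1..n}"
  shows "U i \<subseteq> carrier_vec (d i)"
  using quiver_Grassmannian_basis[OF assms] by (metis image_subsetI mult_mat_vec_carrier)

lemma rep_linear_rep:
  assumes "M \<in> rep_space (equioriented_A n) d"
  shows "fn.linear_rep n (\<lambda>i. coord_space (d i)) (\<lambda>i. mat_map (M i))"
proof -
  have "mat_map (M i) ` coord_space (d i) \<subseteq> coord_space (d (Suc i))" if "i \<in> {1..<n}" for i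
  proof -
    have "M i \<in> carrier_mat (d (Suc i)) (d i)" using assms that by (auto simp: rep_space_def)
    then show ?thesis by (auto simp: coord_space_def mat_map_emb)
  qed
  then show ?thesis by (simp add: fn.linear_rep_def coord_space_findim lin_mat_map)
qed

lemma emb_inj_surj_subrep:
  assumes M: "M \<in> rep_space (equioriented_A n) d" and U: "U \<in> inj_surj_locus n e d M"
  shows "fn.inj_surj_subrep n (\<lambda>i. coord_space (d i)) (\<lambda>i. mat_map (M i)) (\<lambda>i. emb ` U i)"
    and "\<And>i. 1 \<le> i \<Longrightarrow> i \<le> n \<Longrightarrow> fn.dim (emb ` U i) = fn.dim (coord_space (e i))"
proof -
  have UG: "U \<in> quiver_Grassmannian (equioriented_A n) e d M" using U by (simp add: inj_surj_locus_def)
  have UV: "U i \<subseteq> carrier_vec (d i)" if "i \<in> {1..n}" for i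
    by (rule quiver_Grassmannian_carrier[OF UG that])
  have *: "fn.subspace (emb ` U i) \<and> fn.dim (emb ` U i) = fn.dim (coord_space (e i))" if i: "i \<in> {1..n}" for i
  proof -
    obtain B where B: "B \<in> carrier_mat (d i) (e i)" "inj_on (\<lambda>x. B *\<^sub>v x) (carrier_vec (e i))"
      "U i = (\<lambda>x. B *\<^sub>v x) ` carrier_vec (e i)" using quiver_Grassmannian_basis[OF UG i] .
    have eU: "emb ` U i = mat_map B ` coord_space (e i)" unfolding B(3) by (rule emb_image_mult[OF B(1)])
    have "inj_on (mat_map B) (coord_space (e i))"
    proof (rule inj_onI)
      fix f g assume "f \<in> coord_space (e i)" "g \<in> coord_space (e i)" and eq: "mat_map B f = mat_map B g"
      then obtain v w where vw: "v \<in> carrier_vec (e i)" "f = emb v" "w \<in> carrier_vec (e i)" "g = emb w"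
        by (auto simp: coord_space_def)
      then have "B *\<^sub>v v = B *\<^sub>v w" using eq B(1) emb_inj[of "B *\<^sub>v v" "d i" "B *\<^sub>v w"] by (simp add: mat_map_emb)
      then show "f = g" using B(2) vw by (auto dest: inj_onD)
    qed
    then show ?thesis unfolding eU
      using fn.subspace_lin_image[OF lin_mat_map fn.findimD[OF coord_space_findim]]
        fn.dim_image_inj[OF lin_mat_map coord_space_findim] by simp
  qed
  then show "fn.dim (emb ` U i) = fn.dim (coord_space (e i))" if "1 \<le> i" "i \<le> n" for i using that by simp
  show "fn.inj_surj_subrep n (\<lambda>i. coord_space (d i)) (\<lambda>i. mat_map (M i)) (\<lambda>i. emb ` U i)"
    unfolding fn.inj_surj_subrep_def
  proof (intro conjI ballI)
    fix i assume i: "i \<in> {1..n}"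
    show "fn.subspace (emb ` U i)" using * i by simp
    show "emb ` U i \<subseteq> coord_space (d i)" using UV[OF i] by (auto simp: coord_space_def)
  next
    fix i assume i: "i \<in> {1..<n}"
    have Mi: "M i \<in> carrier_mat (d (Suc i)) (d i)" using M i by (auto simp: rep_space_def)
    have UVi: "U i \<subseteq> carrier_vec (d i)" "U (Suc i) \<subseteq> carrier_vec (d (Suc i))" using UV i by auto
    have e: "mat_map (M i) (emb u) = emb (M i *\<^sub>v u)" if "u \<in> carrier_vec (d i)" for u
      using mat_map_emb[OF Mi that] .
    have "(\<lambda>x. M i *\<^sub>v x) ` U i \<subseteq> U (Suc i)" using UG i by (simp add: quiver_Grassmannian_def)
    then show "mat_map (M i) ` emb ` U i \<subseteq> emb ` U (Suc i)" using e UVi by fastforce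
    have inj: "inj_on (\<lambda>x. M i *\<^sub>v x) (U i)" using U i by (simp add: inj_surj_locus_def)
    show "inj_on (mat_map (M i)) (emb ` U i)"
    proof (rule inj_onI, safe)
      fix u u' assume u: "u \<in> U i" "u' \<in> U i" "mat_map (M i) (emb u) = mat_map (M i) (emb u')"
      then have "u \<in> carrier_vec (d i)" "u' \<in> carrier_vec (d i)" using UVi by auto
      then have "emb (M i *\<^sub>v u) = emb (M i *\<^sub>v u')" using u(3) by (simp add: e)
      moreover have "M i *\<^sub>v u \<in> carrier_vec (d (Suc i))" "M i *\<^sub>v u' \<in> carrier_vec (d (Suc i))"
        using Mi u UVi by (auto intro: mult_mat_vec_carrier)
      ultimately have "M i *\<^sub>v u = M i *\<^sub>v u'" using emb_inj by blast
      then show "emb u = emb u'" using inj u by (auto dest: inj_onD)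
    qed
    show "coord_space (d (Suc i)) \<subseteq> fn.sum_space (mat_map (M i) ` coord_space (d i)) (emb ` U (Suc i))"
    proof
      fix f assume "f \<in> coord_space (d (Suc i))"
      then obtain y where y: "y \<in> carrier_vec (d (Suc i))" "f = emb y" by (auto simp: coord_space_def)
      obtain x u where xu: "x \<in> carrier_vec (d i)" "u \<in> U (Suc i)" "y = M i *\<^sub>v x + u"
        using U i y(1) unfolding inj_surj_locus_def by blast
      have "dim_vec (M i *\<^sub>v x) = dim_vec u" using Mi xu UVi by auto
      then have "f = mat_map (M i) (emb x) + emb u" using y xu e by (simp add: emb_add)
      then show "f \<in> fn.sum_space (mat_map (M i) ` coord_space (d i)) (emb ` U (Suc i))"
        using xu by (auto simp: coord_space_def)
    qed
  qed
qed

lemma inj_surj_locus_conjugate: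
  assumes n: "n \<ge> 1" and M: "M \<in> rep_space (equioriented_A n) d"
    and U: "U \<in> inj_surj_locus n e d M" and U': "U' \<in> inj_surj_locus n e d M"
  obtains g where "g \<in> rep_aut (equioriented_A n) d M" "aut_action (equioriented_A n) g U = U'"
proof -
  have UG: "U \<in> quiver_Grassmannian (equioriented_A n) e d M" "U' \<in> quiver_Grassmannian (equioriented_A n) e d M"
    using U U' by (auto simp: inj_surj_locus_def)
  have "\<exists>h. (\<forall>i\<in>{1..n}. fn.lin (h i) \<and> h i ` coord_space (d i) = coord_space (d i) \<and> h i ` emb ` U i = emb ` U' i) \<and>
    (\<forall>i\<in>{1..<n}. \<forall>v\<in>coord_space (d i). h (Suc i) (mat_map (M i) v) = mat_map (M i) (h i v))"
    using fn.inj_surj_subrep_conjugate[OF rep_linear_rep[OF M] n emb_inj_surj_subrep(1)[OF M U] emb_inj_surj_subrep(1)[OF M U']]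
      emb_inj_surj_subrep(2)[OF M U] emb_inj_surj_subrep(2)[OF M U'] by simp
  then obtain h where hh:
    "\<forall>i\<in>{1..n}. fn.lin (h i) \<and> h i ` coord_space (d i) = coord_space (d i) \<and> h i ` emb ` U i = emb ` U' i"
    "\<forall>i\<in>{1..<n}. \<forall>v\<in>coord_space (d i). h (Suc i) (mat_map (M i) v) = mat_map (M i) (h i v)"
    by (elim exE conjE)
  have h: "fn.lin (h i)" "h i ` coord_space (d i) = coord_space (d i)" "h i ` emb ` U i = emb ` U' i"
    if "i \<in> {1..n}" for i
    using bspec[OF hh(1) that] by simp_all
  have h4: "h (Suc i) (mat_map (M i) v) = mat_map (M i) (h i v)"
    if "i \<in> {1..<n}" "v \<in> coord_space (d i)" for i v
    using hh(2) that by blast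
  define g where "g = (\<lambda>i\<in>{1..n}. mat_of_map (d i) (d i) (h i))"
  have gc: "g i \<in> carrier_mat (d i) (d i)" if "i \<in> {1..n}" for i using that by (simp add: g_def mat_of_map_carrier)
  have gm: "emb (g i *\<^sub>v v) = h i (emb v)" if "i \<in> {1..n}" "v \<in> carrier_vec (d i)" for i v
  proof -
    have "emb v \<in> coord_space (d i)" using that by (simp add: coord_space_def)
    then have "h i (emb v) \<in> coord_space (d i)" using h(2)[OF that(1)] by blast
    then show ?thesis using that by (simp add: g_def mat_of_map_mult[OF h(1)] emb_vec)
  qed
  have inv: "invertible_mat (g i)" if i: "i \<in> {1..n}" for i
  proof (rule invertible_mat_if_injective[OF gc[OF i]])
    fix v assume v: "v \<in> carrier_vec (d i)" "g i *\<^sub>v v = 0\<^sub>v (d i)"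
    have "fn.dim {x \<in> coord_space (d i). h i x = 0} = 0"
      using fn.rank_nullity[OF h(1)[OF i] coord_space_findim, of "d i"] h(2)[OF i] by simp
    moreover have s: "fn.subspace {x \<in> coord_space (d i). h i x = 0}"
      using fn.subspace_preimage[OF h(1)[OF i] fn.findimD[OF coord_space_findim] fn.subspace_zero] by simp
    have f: "fn.findim {x \<in> coord_space (d i). h i x = 0}"
      by (rule fn.findim_subset[OF coord_space_findim s]) auto
    have "fn.dim {0} = 0" using fn.dim_eq_card_independent[OF fn.independent_empty] fn.dim_span[of "{}"] by simp
    ultimately have "{0} = {x \<in> coord_space (d i). h i x = 0}"
      by (intro fn.dim_eq_imp_eq[OF _ _ f]) (use fn.subspace_0[OF s] in auto)
    moreover have "h i (emb v) = 0" using gm[OF i v(1)] v(2) by (simp add: emb_zero)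
    ultimately have "emb v = 0" using v(1) by (auto simp: coord_space_def)
    then show "v = 0\<^sub>v (d i)" using emb_inj[OF v(1), of "0\<^sub>v (d i)"] by (simp add: emb_zero)
  qed
  have comm: "g (Suc i) * M i = M i * g i" if i: "i \<in> {1..<n}" for i
  proof -
    have i': "i \<in> {1..n}" "Suc i \<in> {1..n}" using i by auto
    have Mi: "M i \<in> carrier_mat (d (Suc i)) (d i)" using M i by (auto simp: rep_space_def)
    note gi = gc[OF i'(1)] and gi' = gc[OF i'(2)]
    have v: "g (Suc i) *\<^sub>v (M i *\<^sub>v v) = M i *\<^sub>v (g i *\<^sub>v v)" if v: "v \<in> carrier_vec (d i)" for v
    proof -
      have "emb (g (Suc i) *\<^sub>v (M i *\<^sub>v v)) = h (Suc i) (mat_map (M i) (emb v))"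
        using gm[OF i'(2), of "M i *\<^sub>v v"] Mi v by (simp add: mat_map_emb)
      also have "\<dots> = mat_map (M i) (h i (emb v))" using h4[OF i] v by (simp add: coord_space_def)
      also have "\<dots> = emb (M i *\<^sub>v (g i *\<^sub>v v))"
        using gm[OF i'(1) v] gi Mi v by (metis mat_map_emb mult_mat_vec_carrier)
      finally show ?thesis
        by (rule emb_inj[rotated 2, of _ _ "d (Suc i)"]) (use gi gi' Mi v in auto)
    qed
    show ?thesis
    proof (rule mat_eq_if_mult_vec_eq)
      show "(g (Suc i) * M i) *\<^sub>v u = (M i * g i) *\<^sub>v u" if "u \<in> carrier_vec (d i)" for u
        using v[OF that] that by (simp add: assoc_mult_mat_vec[OF gi' Mi] assoc_mult_mat_vec[OF Mi gi])
    qed (use gi gi' Mi in auto)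
  qed
  have "g \<in> rep_aut (equioriented_A n) d M"
    using gc inv comm by (auto simp: rep_aut_def rep_hom_def g_def)
  moreover have "aut_action (equioriented_A n) g U = U'"
  proof
    fix i
    show "aut_action (equioriented_A n) g U i = U' i"
    proof (cases "i \<in> {1..n}")
      case True
      have Uc: "U i \<subseteq> carrier_vec (d i)" "U' i \<subseteq> carrier_vec (d i)"
        using quiver_Grassmannian_carrier[OF UG(1) True] quiver_Grassmannian_carrier[OF UG(2) True] .
      have "emb ` (\<lambda>x. g i *\<^sub>v x) ` U i = emb ` U' i"
        using h(3)[OF True] gm[OF True] Uc by (auto simp: image_image subset_iff)
      moreover have "(\<lambda>x. g i *\<^sub>v x) ` U i \<subseteq> carrier_vec (d i)" using gc[OF True] Uc by auto
      moreover have "inj_on emb (carrier_vec (d i))" using emb_inj by (auto intro: inj_onI)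
      ultimately have "(\<lambda>x. g i *\<^sub>v x) ` U i = U' i" using Uc by (meson inj_on_image_eq_iff)
      then show ?thesis using True by (simp add: aut_action_def)
    next
      case False
      then show ?thesis using UG(2) by (auto simp: aut_action_def quiver_Grassmannian_def PiE_def extensional_def)
    qed
  qed
  ultimately show thesis using that by blast
qed

section \<open>The locus of inj-surj points is open\<close>

lemma polynomial_functions_sum:
  "(\<And>i. i \<in> A \<Longrightarrow> f i \<in> polynomial_functions V) \<Longrightarrow> (\<lambda>x. \<Sum>i\<in>A. f i x) \<in> polynomial_functions V"
proof (induction A rule: infinite_finite_induct)
  case (insert a A)
  then show ?case by (simp add: polynomial_functions.add)
qed (simp_all add: polynomial_functions.const)

lemma polynomial_functions_prod:
  "(\<And>i. i \<in> A \<Longrightarrow> f i \<in> polynomial_functions V) \<Longrightarrow> (\<lambda>x. \<Prod>i\<in>A. f i x) \<in> polynomial_functions V"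
proof (induction A rule: infinite_finite_induct)
  case (insert a A)
  then show ?case by (simp add: polynomial_functions.mult)
qed (simp_all add: polynomial_functions.const)

lemma openin_nonvanishing_locus:
  assumes "F \<in> polynomial_functions {(i, S). i \<in> verts Q \<and> S \<subseteq> {..<d i} \<and> card S = e i}"
    and "multihomogeneous (verts Q) F"
  shows "openin (quiver_Grassmannian_topology Q e d M)
    {U \<in> quiver_Grassmannian Q e d M. \<exists>B\<in>basis_matrices Q e d U. F (pluecker_coords B) \<noteq> 0}"
  unfolding quiver_Grassmannian_topology_def openin_topology_generated_by_iff
  by (rule generate_topology_on.Basis) (use assms in blast)

text \<open>The condition \<open>det (L * B i) \<noteq> 0\<close> says that \<open>L\<close> maps \<open>U i\<close> isomorphically. The determinant is linear in
  the coordinates of block \<open>i\<close> and does not involve the other blocks.\<close>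

lemma openin_det_mult_nonzero:
  assumes fin: "finite (verts Q)" and i: "i \<in> verts Q" and L: "L \<in> carrier_mat (e i) (d i)"
  shows "openin (quiver_Grassmannian_topology Q e d M)
    {U \<in> quiver_Grassmannian Q e d M. \<exists>B\<in>basis_matrices Q e d U. det (L * B i) \<noteq> 0}"
proof -
  obtain c where c: "\<And>B. B \<in> carrier_mat (d i) (e i) \<Longrightarrow>
    det (L * B) = (\<Sum>S | S \<subseteq> {..<d i} \<and> card S = e i. c S * det (submatrix B S UNIV))"
    using det_mult_maximal_minors[OF L] by blast
  let ?T = "{S. S \<subseteq> {..<d i} \<and> card S = e i}"
  let ?F = "\<lambda>x. \<Sum>S\<in>?T. c S * x (i, S)"
  have "?F \<in> polynomial_functions {(i, S). i \<in> verts Q \<and> S \<subseteq> {..<d i} \<and> card S = e i}"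
    by (intro polynomial_functions_sum polynomial_functions.mult polynomial_functions.const
        polynomial_functions.coord) (use i in auto)
  moreover have "multihomogeneous (verts Q) ?F"
    unfolding multihomogeneous_def
  proof (intro exI[of _ "\<lambda>j. if j = i then 1 else 0"] allI)
    fix b :: "'a \<Rightarrow> complex" and x :: "'a \<times> nat set \<Rightarrow> complex"
    have "(\<Prod>j\<in>verts Q. b j ^ (if j = i then 1 else 0)) = (\<Prod>j\<in>verts Q. if j = i then b i else 1)"
      by (intro prod.cong) auto
    also have "\<dots> = b i" using fin i by simp
    finally show "?F (\<lambda>(j, k). b j * x (j, k)) = (\<Prod>j\<in>verts Q. b j ^ (if j = i then 1 else 0)) * ?F x"
      by (simp add: sum_distrib_left mult.left_commute)
  qed
  moreover have "?F (pluecker_coords B) = det (L * B i)" if "B \<in> basis_matrices Q e d U" for B U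
  proof -
    have "B i \<in> carrier_mat (d i) (e i)" using that i by (auto simp: basis_matrices_def)
    then show ?thesis by (simp add: c pluecker_coords_def)
  qed
  ultimately show ?thesis using openin_nonvanishing_locus[of ?F Q d e M] by (simp cong: conj_cong bex_cong)
qed

lemma basis_matrices_exists:
  assumes "U \<in> quiver_Grassmannian Q e d M"
  shows "\<exists>B\<in>basis_matrices Q e d U. \<forall>i\<in>verts Q. inj_on (\<lambda>x. B i *\<^sub>v x) (carrier_vec (e i))"
proof -
  have "\<forall>i\<in>verts Q. \<exists>B. B \<in> carrier_mat (d i) (e i) \<and> inj_on (\<lambda>x. B *\<^sub>v x) (carrier_vec (e i)) \<and>
      U i = (\<lambda>x. B *\<^sub>v x) ` carrier_vec (e i)"
  proof
    fix i assume "i \<in> verts Q"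
    then have "U i \<in> Grassmannian (e i) (d i)" using assms by (auto simp: quiver_Grassmannian_def)
    then show "\<exists>B. B \<in> carrier_mat (d i) (e i) \<and> inj_on (\<lambda>x. B *\<^sub>v x) (carrier_vec (e i)) \<and>
      U i = (\<lambda>x. B *\<^sub>v x) ` carrier_vec (e i)" unfolding Grassmannian_iff by blast
  qed
  from bchoice[OF this] obtain B where B: "\<forall>i\<in>verts Q. B i \<in> carrier_mat (d i) (e i) \<and>
      inj_on (\<lambda>x. B i *\<^sub>v x) (carrier_vec (e i)) \<and> U i = (\<lambda>x. B i *\<^sub>v x) ` carrier_vec (e i)" ..
  show ?thesis
    by (rule bexI[of _ "restrict B (verts Q)"]) (use B in \<open>auto simp: basis_matrices_def\<close>)
qed

lemma openin_quiver_Grassmannian: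
  "openin (quiver_Grassmannian_topology Q e d M) (quiver_Grassmannian Q e d M)"
proof -
  have "multihomogeneous (verts Q) (\<lambda>x. 1)"
    unfolding multihomogeneous_def by (rule exI[of _ "\<lambda>_. 0"]) simp
  from openin_nonvanishing_locus[OF polynomial_functions.const this]
  have "openin (quiver_Grassmannian_topology Q e d M)
    {U \<in> quiver_Grassmannian Q e d M. \<exists>B\<in>basis_matrices Q e d U. (1::complex) \<noteq> 0}" .
  moreover have "{U \<in> quiver_Grassmannian Q e d M. \<exists>B\<in>basis_matrices Q e d U. (1::complex) \<noteq> 0} =
      quiver_Grassmannian Q e d M"
    using basis_matrices_exists[of _ Q e d M] by fastforce
  ultimately show ?thesis by simp
qed

lemma det_nonzero_kernel:
  fixes A :: "'a::field mat"
  assumes "A \<in> carrier_mat n n" "det A \<noteq> 0" "v \<in> carrier_vec n" "A *\<^sub>v v = 0\<^sub>v n"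
  shows "v = 0\<^sub>v n"
  using det_0_iff_vec_prod_zero_field[OF assms(1)] assms by blast

text \<open>The map \<open>M i\<close> is injective on \<open>U i\<close> if and only if \<open>L * M i\<close> is an isomorphism on \<open>U i\<close> for some \<open>L\<close>.\<close>

lemma openin_inj_on_subspace:
  assumes M: "M \<in> rep_space (equioriented_A n) d" and i: "i \<in> {1..<n}"
  shows "openin (quiver_Grassmannian_topology (equioriented_A n) e d M)
    {U \<in> quiver_Grassmannian (equioriented_A n) e d M. inj_on (\<lambda>x. M i *\<^sub>v x) (U i)}"
proof -
  let ?Q = "equioriented_A n" and ?d = "d (Suc i)"
  let ?O = "\<lambda>L. {U \<in> quiver_Grassmannian ?Q e d M. \<exists>B\<in>basis_matrices ?Q e d U. det (L * M i * B i) \<noteq> 0}"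
  have Mi: "M i \<in> carrier_mat ?d (d i)" using M i by (auto simp: rep_space_def)
  have "{U \<in> quiver_Grassmannian ?Q e d M. inj_on (\<lambda>x. M i *\<^sub>v x) (U i)} =
    (\<Union>L\<in>carrier_mat (e i) ?d. ?O L)"
  proof (intro equalityI subsetI)
    fix U assume "U \<in> {U \<in> quiver_Grassmannian ?Q e d M. inj_on (\<lambda>x. M i *\<^sub>v x) (U i)}"
    then have U: "U \<in> quiver_Grassmannian ?Q e d M" and inj: "inj_on (\<lambda>x. M i *\<^sub>v x) (U i)" by auto
    obtain B where B: "B \<in> basis_matrices ?Q e d U"
      and injB: "\<forall>i\<in>verts ?Q. inj_on (\<lambda>x. B i *\<^sub>v x) (carrier_vec (e i))"
      using basis_matrices_exists[OF U] by blast
    have Bi: "B i \<in> carrier_mat (d i) (e i)" and Ui: "U i = (\<lambda>x. B i *\<^sub>v x) ` carrier_vec (e i)"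
      using B i by (auto simp: basis_matrices_def)
    have MB: "M i * B i \<in> carrier_mat ?d (e i)" using Mi Bi by simp
    have "inj_on (\<lambda>x. (M i * B i) *\<^sub>v x) (carrier_vec (e i))"
    proof (rule inj_onI)
      fix x y assume xy: "x \<in> carrier_vec (e i)" "y \<in> carrier_vec (e i)" "M i * B i *\<^sub>v x = M i * B i *\<^sub>v y"
      then have "M i *\<^sub>v (B i *\<^sub>v x) = M i *\<^sub>v (B i *\<^sub>v y)" using assoc_mult_mat_vec[OF Mi Bi] by simp
      then have "B i *\<^sub>v x = B i *\<^sub>v y" using inj xy Ui by (auto dest: inj_onD)
      then show "x = y" using injB i xy by (auto dest: inj_onD)
    qed
    moreover have "\<exists>x\<in>carrier_vec ?d. \<exists>z\<in>carrier_vec (e i). y = 1\<^sub>m ?d *\<^sub>v x + (M i * B i) *\<^sub>v z"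
      if "y \<in> carrier_vec ?d" for y
    proof (intro bexI)
      show "y = 1\<^sub>m ?d *\<^sub>v y + (M i * B i) *\<^sub>v 0\<^sub>v (e i)" using that by (simp add: mult_mat_zero_vec[OF MB])
    qed (use that in auto)
    ultimately obtain L where L: "L \<in> carrier_mat (e i) ?d" "L * (M i * B i) = 1\<^sub>m (e i)"
      using left_inverse_with_kernel[OF one_carrier_mat MB] by metis
    have "L * M i * B i = 1\<^sub>m (e i)" using L Mi Bi by simp
    then have "det (L * M i * B i) \<noteq> 0" by simp
    then show "U \<in> (\<Union>L\<in>carrier_mat (e i) ?d. ?O L)" using L(1) U B by blast
  next
    fix U assume "U \<in> (\<Union>L\<in>carrier_mat (e i) ?d. ?O L)"
    then obtain L B where U: "U \<in> quiver_Grassmannian ?Q e d M" and L: "L \<in> carrier_mat (e i) ?d"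
      and B: "B \<in> basis_matrices ?Q e d U" and d: "det (L * M i * B i) \<noteq> 0" by blast
    have Bi: "B i \<in> carrier_mat (d i) (e i)" and Ui: "U i = (\<lambda>x. B i *\<^sub>v x) ` carrier_vec (e i)"
      using B i by (auto simp: basis_matrices_def)
    have "inj_on (\<lambda>x. M i *\<^sub>v x) (U i)"
    proof (rule inj_onI)
      fix u v assume uv: "u \<in> U i" "v \<in> U i" "M i *\<^sub>v u = M i *\<^sub>v v"
      then obtain x y where xy: "x \<in> carrier_vec (e i)" "u = B i *\<^sub>v x" "y \<in> carrier_vec (e i)" "v = B i *\<^sub>v y"
        using Ui by auto
      have LMB: "L * M i * B i \<in> carrier_mat (e i) (e i)" using L Mi Bi by simp
      have e: "(L * M i * B i) *\<^sub>v z = L *\<^sub>v (M i *\<^sub>v (B i *\<^sub>v z))" if "z \<in> carrier_vec (e i)" for z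
        using L Mi Bi that assoc_mult_mat_vec[of "L * M i" "e i" "d i" "B i" "e i" z]
          assoc_mult_mat_vec[OF L Mi, of "B i *\<^sub>v z"] by simp
      have "(L * M i * B i) *\<^sub>v x = (L * M i * B i) *\<^sub>v y" using uv xy e by simp
      moreover have "inj_on (\<lambda>x. (L * M i * B i) *\<^sub>v x) (carrier_vec (e i))"
        unfolding inj_on_mult_mat_vec_iff[OF LMB] using det_nonzero_kernel[OF LMB d] by blast
      ultimately show "u = v" using xy by (auto dest: inj_onD)
    qed
    then show "U \<in> {U \<in> quiver_Grassmannian ?Q e d M. inj_on (\<lambda>x. M i *\<^sub>v x) (U i)}" using U by simp
  qed
  moreover have "openin (quiver_Grassmannian_topology ?Q e d M) (?O L)" if "L \<in> carrier_mat (e i) ?d" for L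
    by (rule openin_det_mult_nonzero) (use i that Mi in auto)
  ultimately show ?thesis by auto
qed

text \<open>The spaces \<open>M i (V i)\<close> and \<open>U (i + 1)\<close> span \<open>V (i + 1)\<close> if and only if some \<open>L\<close> with kernel inside
  \<open>M i (V i)\<close> is an isomorphism on \<open>U (i + 1)\<close>.\<close>

lemma openin_image_plus_subspace:
  assumes M: "M \<in> rep_space (equioriented_A n) d" and i: "i \<in> {1..<n}"
  shows "openin (quiver_Grassmannian_topology (equioriented_A n) e d M)
    {U \<in> quiver_Grassmannian (equioriented_A n) e d M.
      \<forall>y\<in>carrier_vec (d (Suc i)). \<exists>x\<in>carrier_vec (d i). \<exists>u\<in>U (Suc i). y = M i *\<^sub>v x + u}"
    (is "openin _ {U \<in> _. ?P U}")
proof -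
  let ?Q = "equioriented_A n" and ?d = "d (Suc i)" and ?e = "e (Suc i)"
  let ?O = "\<lambda>L. {U \<in> quiver_Grassmannian ?Q e d M. \<exists>B\<in>basis_matrices ?Q e d U. det (L * B (Suc i)) \<noteq> 0}"
  let ?L = "{L \<in> carrier_mat ?e ?d. \<forall>y\<in>carrier_vec ?d. L *\<^sub>v y = 0\<^sub>v ?e \<longrightarrow> (\<exists>x\<in>carrier_vec (d i). y = M i *\<^sub>v x)}"
  have Mi: "M i \<in> carrier_mat ?d (d i)" using M i by (auto simp: rep_space_def)
  have "{U \<in> quiver_Grassmannian ?Q e d M. ?P U} = (\<Union>L\<in>?L. ?O L)"
  proof (intro equalityI subsetI)
    fix U assume "U \<in> {U \<in> quiver_Grassmannian ?Q e d M. ?P U}"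
    then have U: "U \<in> quiver_Grassmannian ?Q e d M" and P: "?P U" by auto
    obtain B where B: "B \<in> basis_matrices ?Q e d U"
      and injB: "\<forall>i\<in>verts ?Q. inj_on (\<lambda>x. B i *\<^sub>v x) (carrier_vec (e i))"
      using basis_matrices_exists[OF U] by blast
    have Bi: "B (Suc i) \<in> carrier_mat ?d ?e" and Ui: "U (Suc i) = (\<lambda>x. B (Suc i) *\<^sub>v x) ` carrier_vec ?e"
      using B i by (auto simp: basis_matrices_def)
    have inj: "inj_on (\<lambda>x. B (Suc i) *\<^sub>v x) (carrier_vec ?e)" using injB i by auto
    have gen: "\<exists>x\<in>carrier_vec (d i). \<exists>z\<in>carrier_vec ?e. y = M i *\<^sub>v x + B (Suc i) *\<^sub>v z"
      if "y \<in> carrier_vec ?d" for y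
      using P that unfolding Ui by blast
    obtain L where L: "L \<in> carrier_mat ?e ?d" "L * B (Suc i) = 1\<^sub>m ?e"
      "\<And>y. y \<in> carrier_vec ?d \<Longrightarrow> L *\<^sub>v y = 0\<^sub>v ?e \<Longrightarrow> \<exists>x\<in>carrier_vec (d i). y = M i *\<^sub>v x"
      using left_inverse_with_kernel[OF Mi Bi inj gen] by blast
    have "det (L * B (Suc i)) \<noteq> 0" using L(2) by simp
    then have "U \<in> ?O L" using U B by blast
    moreover have "L \<in> ?L" using L by blast
    ultimately show "U \<in> (\<Union>L\<in>?L. ?O L)" by blast
  next
    fix U assume "U \<in> (\<Union>L\<in>?L. ?O L)"
    then obtain L B where U: "U \<in> quiver_Grassmannian ?Q e d M" and L: "L \<in> carrier_mat ?e ?d"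
      and k: "\<forall>y\<in>carrier_vec ?d. L *\<^sub>v y = 0\<^sub>v ?e \<longrightarrow> (\<exists>x\<in>carrier_vec (d i). y = M i *\<^sub>v x)"
      and B: "B \<in> basis_matrices ?Q e d U" and d: "det (L * B (Suc i)) \<noteq> 0" by blast
    have Bi: "B (Suc i) \<in> carrier_mat ?d ?e" and Ui: "U (Suc i) = (\<lambda>x. B (Suc i) *\<^sub>v x) ` carrier_vec ?e"
      using B i by (auto simp: basis_matrices_def)
    have LB: "L * B (Suc i) \<in> carrier_mat ?e ?e" using L Bi by simp
    obtain C where C: "C \<in> carrier_mat ?e ?e" "L * B (Suc i) * C = 1\<^sub>m ?e"
      using det_nonzero_obtain_inverse[OF LB d] by metis
    have "?P U"
    proof
      fix y :: "complex vec" assume y: "y \<in> carrier_vec ?d"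
      define u where "u = B (Suc i) *\<^sub>v (C *\<^sub>v (L *\<^sub>v y))"
      have Ly: "L *\<^sub>v y \<in> carrier_vec ?e" and CLy: "C *\<^sub>v (L *\<^sub>v y) \<in> carrier_vec ?e" using L C y by auto
      have u: "u \<in> carrier_vec ?d" "u \<in> U (Suc i)" using Bi CLy Ui by (auto simp: u_def)
      have "L *\<^sub>v u = (L * B (Suc i)) *\<^sub>v (C *\<^sub>v (L *\<^sub>v y))"
        unfolding u_def by (rule assoc_mult_mat_vec[OF L Bi CLy, symmetric])
      also have "\<dots> = (L * B (Suc i) * C) *\<^sub>v (L *\<^sub>v y)"
        by (rule assoc_mult_mat_vec[OF LB C(1) Ly, symmetric])
      finally have "L *\<^sub>v u = L *\<^sub>v y" using C(2) Ly by simp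
      then have "L *\<^sub>v (y - u) = 0\<^sub>v ?e" using mult_minus_distrib_mat_vec[OF L y u(1)] Ly by simp
      moreover have "y - u \<in> carrier_vec ?d" using y u by simp
      ultimately obtain x where x: "x \<in> carrier_vec (d i)" "y - u = M i *\<^sub>v x" using k by blast
      have "y = (y - u) + u" using y u by (intro eq_vecI) auto
      then show "\<exists>x\<in>carrier_vec (d i). \<exists>u\<in>U (Suc i). y = M i *\<^sub>v x + u" using x u by metis
    qed
    then show "U \<in> {U \<in> quiver_Grassmannian ?Q e d M. ?P U}" using U by simp
  qed
  moreover have "openin (quiver_Grassmannian_topology ?Q e d M) (?O L)" if "L \<in> carrier_mat ?e ?d" for L
    by (rule openin_det_mult_nonzero) (use i that in auto)
  ultimately show ?thesis by auto
qed

lemma openin_inj_surj_locus: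
  assumes M: "M \<in> rep_space (equioriented_A n) d"
  shows "openin (quiver_Grassmannian_topology (equioriented_A n) e d M) (inj_surj_locus n e d M)"
proof -
  let ?X = "quiver_Grassmannian (equioriented_A n) e d M"
  let ?T = "quiver_Grassmannian_topology (equioriented_A n) e d M"
  let ?A = "\<lambda>i. {U \<in> ?X. inj_on (\<lambda>x. M i *\<^sub>v x) (U i)}"
  let ?B = "\<lambda>i. {U \<in> ?X. \<forall>y\<in>carrier_vec (d (Suc i)). \<exists>x\<in>carrier_vec (d i). \<exists>u\<in>U (Suc i). y = M i *\<^sub>v x + u}"
  have "openin ?T (?A i \<inter> ?B i)" if "i \<in> {1..<n}" for i
    using openin_inj_on_subspace[OF M that] openin_image_plus_subspace[OF M that] by (rule openin_Int)
  then have "openin ?T (\<Inter> (insert ?X ((\<lambda>i. ?A i \<inter> ?B i) ` {1..<n})))"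
    by (intro openin_Inter) (auto simp: openin_quiver_Grassmannian)
  moreover have "\<Inter> (insert ?X ((\<lambda>i. ?A i \<inter> ?B i) ` {1..<n})) = inj_surj_locus n e d M"
    unfolding inj_surj_locus_def by fastforce
  ultimately show ?thesis by simp
qed

section \<open>The locus of inj-surj points is a single orbit\<close>

text \<open>Isomorphisms of representations carry inj-surj points to inj-surj points.\<close>

lemma inj_surj_locus_transport:
  assumes M: "M \<in> rep_space (equioriented_A n) d" and M': "M' \<in> rep_space (equioriented_A n) d"
    and gc: "\<And>i. i \<in> {1..n} \<Longrightarrow> g i \<in> carrier_mat (d i) (d i)"
    and inv: "\<And>i. i \<in> {1..n} \<Longrightarrow> invertible_mat (g i)"
    and comm: "\<And>i. i \<in> {1..<n} \<Longrightarrow> g (Suc i) * M i = M' i * g i"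
    and U: "U \<in> inj_surj_locus n e d M"
  shows "(\<lambda>i\<in>{1..n}. (\<lambda>x. g i *\<^sub>v x) ` U i) \<in> inj_surj_locus n e d M'"
proof -
  let ?Q = "equioriented_A n" and ?U = "\<lambda>i\<in>{1..n}. (\<lambda>x. g i *\<^sub>v x) ` U i"
  have UG: "U \<in> quiver_Grassmannian ?Q e d M" using U by (simp add: inj_surj_locus_def)
  have Uc: "U i \<subseteq> carrier_vec (d i)" if "i \<in> {1..n}" for i by (rule quiver_Grassmannian_carrier[OF UG that])
  have ginj: "inj_on (\<lambda>x. g i *\<^sub>v x) (carrier_vec (d i))" if i: "i \<in> {1..n}" for i
  proof -
    obtain h where h: "h \<in> carrier_mat (d i) (d i)" "h * g i = 1\<^sub>m (d i)"
      using invertible_matE[OF inv[OF i] gc[OF i]] by metis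
    show ?thesis
    proof (rule inj_on_inverseI[of _ "\<lambda>x. h *\<^sub>v x"])
      show "h *\<^sub>v (g i *\<^sub>v x) = x" if "x \<in> carrier_vec (d i)" for x
        using assoc_mult_mat_vec[OF h(1) gc[OF i] that] h(2) that by simp
    qed
  qed
  have c: "M' i *\<^sub>v (g i *\<^sub>v x) = g (Suc i) *\<^sub>v (M i *\<^sub>v x)" if "i \<in> {1..<n}" "x \<in> carrier_vec (d i)" for i x
  proof -
    have i: "i \<in> {1..n}" "Suc i \<in> {1..n}" using that by auto
    have Mi: "M i \<in> carrier_mat (d (Suc i)) (d i)" "M' i \<in> carrier_mat (d (Suc i)) (d i)"
      using M M' that by (auto simp: rep_space_def)
    show ?thesis
      using assoc_mult_mat_vec[OF Mi(2) gc[OF i(1)] that(2)] assoc_mult_mat_vec[OF gc[OF i(2)] Mi(1) that(2)]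
        comm[OF that(1)] by simp
  qed
  have "?U \<in> quiver_Grassmannian ?Q e d M'"
    unfolding quiver_Grassmannian_def
  proof (intro CollectI conjI ballI)
    show "?U \<in> (\<Pi>\<^sub>E i\<in>verts ?Q. Grassmannian (e i) (d i))"
    proof (intro PiE_I)
      fix i assume "i \<in> verts ?Q"
      then have i: "i \<in> {1..n}" by simp
      obtain B where B: "B \<in> carrier_mat (d i) (e i)" "inj_on (\<lambda>x. B *\<^sub>v x) (carrier_vec (e i))"
        "U i = (\<lambda>x. B *\<^sub>v x) ` carrier_vec (e i)" using quiver_Grassmannian_basis[OF UG i] .
      have e: "(g i * B) *\<^sub>v x = g i *\<^sub>v (B *\<^sub>v x)" if "x \<in> carrier_vec (e i)" for x
        using assoc_mult_mat_vec[OF gc[OF i] B(1) that] .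
      have "inj_on ((\<lambda>x. g i *\<^sub>v x) \<circ> (\<lambda>x. B *\<^sub>v x)) (carrier_vec (e i))"
        by (rule comp_inj_on[OF B(2) inj_on_subset[OF ginj[OF i]]]) (use B Uc[OF i] in auto)
      then have "inj_on (\<lambda>x. (g i * B) *\<^sub>v x) (carrier_vec (e i))"
        using e by (simp add: inj_on_def)
      moreover have "?U i = (\<lambda>x. (g i * B) *\<^sub>v x) ` carrier_vec (e i)"
        using i B(3) e by (simp add: image_image)
      moreover have "g i * B \<in> carrier_mat (d i) (e i)" using gc[OF i] B(1) by simp
      ultimately show "?U i \<in> Grassmannian (e i) (d i)" unfolding Grassmannian_iff by blast
    qed auto
  next
    fix a assume "a \<in> arcs ?Q"
    then have a: "a \<in> {1..<n}" by simp
    have "(\<lambda>x. M a *\<^sub>v x) ` U a \<subseteq> U (Suc a)" using UG a by (auto simp: quiver_Grassmannian_def)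
    then have "M' a *\<^sub>v (g a *\<^sub>v x) \<in> (\<lambda>x. g (Suc a) *\<^sub>v x) ` U (Suc a)" if "x \<in> U a" for x
      using c[OF a, of x] Uc[of a] that a by auto
    then show "(\<lambda>x. M' a *\<^sub>v x) ` ?U (tail ?Q a) \<subseteq> ?U (head ?Q a)" using a by auto
  qed
  moreover have "inj_on (\<lambda>x. M' i *\<^sub>v x) (?U i) \<and>
      (\<forall>y\<in>carrier_vec (d (Suc i)). \<exists>x\<in>carrier_vec (d i). \<exists>u\<in>?U (Suc i). y = M' i *\<^sub>v x + u)"
    if i: "i \<in> {1..<n}" for i
  proof
    have i': "i \<in> {1..n}" "Suc i \<in> {1..n}" using i by auto
    have Mi: "M i \<in> carrier_mat (d (Suc i)) (d i)" using M i by (auto simp: rep_space_def)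
    have inj: "inj_on (\<lambda>x. M i *\<^sub>v x) (U i)"
      and gen: "\<forall>y\<in>carrier_vec (d (Suc i)). \<exists>x\<in>carrier_vec (d i). \<exists>u\<in>U (Suc i). y = M i *\<^sub>v x + u"
      using U i unfolding inj_surj_locus_def by blast+
    have "inj_on (\<lambda>x. M' i *\<^sub>v x) ((\<lambda>x. g i *\<^sub>v x) ` U i)"
    proof (rule inj_onI, safe)
      fix x y assume xy: "x \<in> U i" "y \<in> U i" "M' i *\<^sub>v (g i *\<^sub>v x) = M' i *\<^sub>v (g i *\<^sub>v y)"
      have xyc: "x \<in> carrier_vec (d i)" "y \<in> carrier_vec (d i)" using xy Uc[OF i'(1)] by auto
      have "g (Suc i) *\<^sub>v (M i *\<^sub>v x) = g (Suc i) *\<^sub>v (M i *\<^sub>v y)" using xy(3) c[OF i] xyc by simp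
      then have "M i *\<^sub>v x = M i *\<^sub>v y"
        by (rule inj_onD[OF ginj[OF i'(2)]]) (use Mi xyc in auto)
      then show "g i *\<^sub>v x = g i *\<^sub>v y" using inj xy by (auto dest: inj_onD)
    qed
    then show "inj_on (\<lambda>x. M' i *\<^sub>v x) (?U i)" using i' by simp
    show "\<forall>y\<in>carrier_vec (d (Suc i)). \<exists>x\<in>carrier_vec (d i). \<exists>u\<in>?U (Suc i). y = M' i *\<^sub>v x + u"
    proof
      fix y :: "complex vec" assume y: "y \<in> carrier_vec (d (Suc i))"
      obtain h where h: "h \<in> carrier_mat (d (Suc i)) (d (Suc i))" "g (Suc i) * h = 1\<^sub>m (d (Suc i))"
        using invertible_matE[OF inv[OF i'(2)] gc[OF i'(2)]] by metis
      obtain x u where xu: "x \<in> carrier_vec (d i)" "u \<in> U (Suc i)" "h *\<^sub>v y = M i *\<^sub>v x + u"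
        using gen h(1) y by (meson mult_mat_vec_carrier)
      have u: "u \<in> carrier_vec (d (Suc i))" using xu(2) Uc[OF i'(2)] by auto
      have "y = g (Suc i) *\<^sub>v (h *\<^sub>v y)"
        using assoc_mult_mat_vec[OF gc[OF i'(2)] h(1) y] h(2) y by simp
      also have "\<dots> = g (Suc i) *\<^sub>v (M i *\<^sub>v x) + g (Suc i) *\<^sub>v u"
        unfolding xu(3) by (rule mult_add_distrib_mat_vec[OF gc[OF i'(2)]]) (use Mi xu u in auto)
      also have "g (Suc i) *\<^sub>v (M i *\<^sub>v x) = M' i *\<^sub>v (g i *\<^sub>v x)" using c[OF i xu(1)] by simp
      finally have "y = M' i *\<^sub>v (g i *\<^sub>v x) + g (Suc i) *\<^sub>v u" .
      moreover have "g i *\<^sub>v x \<in> carrier_vec (d i)" using gc[OF i'(1)] xu(1) by simp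
      moreover have "g (Suc i) *\<^sub>v u \<in> ?U (Suc i)" using i' xu(2) by simp
      ultimately show "\<exists>x\<in>carrier_vec (d i). \<exists>u\<in>?U (Suc i). y = M' i *\<^sub>v x + u" by blast
    qed
  qed
  ultimately show ?thesis by (simp add: inj_surj_locus_def del: restrict_apply)
qed

lemma aut_orbit_eq_inj_surj_locus:
  assumes n: "n \<ge> 1" and M: "M \<in> rep_space (equioriented_A n) d" and U: "U \<in> inj_surj_locus n e d M"
  shows "aut_orbit (equioriented_A n) d M U = inj_surj_locus n e d M"
proof
  show "inj_surj_locus n e d M \<subseteq> aut_orbit (equioriented_A n) d M U"
    using inj_surj_locus_conjugate[OF n M U] unfolding aut_orbit_def by blast
  show "aut_orbit (equioriented_A n) d M U \<subseteq> inj_surj_locus n e d M"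
  proof
    fix W assume "W \<in> aut_orbit (equioriented_A n) d M U"
    then obtain g where g: "g \<in> rep_aut (equioriented_A n) d M" "W = aut_action (equioriented_A n) g U"
      by (auto simp: aut_orbit_def)
    have "(\<lambda>i\<in>{1..n}. (\<lambda>x. g i *\<^sub>v x) ` U i) \<in> inj_surj_locus n e d M"
      by (rule inj_surj_locus_transport[OF M M _ _ _ U]) (use g in \<open>auto simp: rep_aut_def rep_hom_def\<close>)
    then show "W \<in> inj_surj_locus n e d M" using g(2) by (simp add: aut_action_def)
  qed
qed

section \<open>Generic representations have inj-surj points\<close>

text \<open>Families of \<open>p \<times> q\<close> matrices whose entries are polynomial functions of the parameter.\<close>

definition polynomial_mat ::
  "'v set \<Rightarrow> nat \<Rightarrow> nat \<Rightarrow> (('v \<Rightarrow> complex) \<Rightarrow> complex mat) \<Rightarrow> bool"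
  where "polynomial_mat V p q A \<longleftrightarrow> (\<forall>x. A x \<in> carrier_mat p q) \<and>
    (\<forall>r<p. \<forall>c<q. (\<lambda>x. A x $$ (r, c)) \<in> polynomial_functions V)"

lemma polynomial_mat_const: "C \<in> carrier_mat p q \<Longrightarrow> polynomial_mat V p q (\<lambda>x. C)"
  by (simp add: polynomial_mat_def polynomial_functions.const)

lemma polynomial_mat_mult:
  assumes "polynomial_mat V p q A" "polynomial_mat V q s B"
  shows "polynomial_mat V p s (\<lambda>x. A x * B x)"
  unfolding polynomial_mat_def
proof (intro conjI allI impI)
  have A: "A x \<in> carrier_mat p q" and B: "B x \<in> carrier_mat q s" for x
    using assms by (auto simp: polynomial_mat_def)
  show "A x * B x \<in> carrier_mat p s" for x using A B by (meson mult_carrier_mat)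
  fix r c assume rc: "r < p" "c < s"
  have "(A x * B x) $$ (r, c) = (\<Sum>k\<in>{0..<q}. A x $$ (r, k) * B x $$ (k, c))" for x
    using A[of x] B[of x] rc by (auto simp: scalar_prod_def intro!: sum.cong)
  moreover have "(\<lambda>x. \<Sum>k\<in>{0..<q}. A x $$ (r, k) * B x $$ (k, c)) \<in> polynomial_functions V"
    using assms rc by (intro polynomial_functions_sum polynomial_functions.mult) (auto simp: polynomial_mat_def)
  ultimately show "(\<lambda>x. (A x * B x) $$ (r, c)) \<in> polynomial_functions V" by simp
qed

lemma polynomial_mat_add:
  assumes "polynomial_mat V p q A" "polynomial_mat V p q B"
  shows "polynomial_mat V p q (\<lambda>x. A x + B x)"
  unfolding polynomial_mat_def
proof (intro conjI allI impI)
  have A: "A x \<in> carrier_mat p q" and B: "B x \<in> carrier_mat p q" for x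
    using assms by (auto simp: polynomial_mat_def)
  show "A x + B x \<in> carrier_mat p q" for x using B by simp
  fix r c assume rc: "r < p" "c < q"
  have "(A x + B x) $$ (r, c) = A x $$ (r, c) + B x $$ (r, c)" for x
    using A[of x] B[of x] rc by simp
  then show "(\<lambda>x. (A x + B x) $$ (r, c)) \<in> polynomial_functions V"
    using assms rc by (auto simp: polynomial_mat_def intro: polynomial_functions.add)
qed

lemma polynomial_mat_det:
  assumes "polynomial_mat V p p A"
  shows "(\<lambda>x. det (A x)) \<in> polynomial_functions V"
proof -
  have "det (A x) = (\<Sum>q | q permutes {0..<p}. signof q * (\<Prod>i = 0..<p. A x $$ (i, q i)))" for x
    using assms by (intro det_def') (auto simp: polynomial_mat_def)
  moreover have "(\<lambda>x. \<Sum>q | q permutes {0..<p}. signof q * (\<Prod>i = 0..<p. A x $$ (i, q i))) \<in> polynomial_functions V"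
  proof (intro polynomial_functions_sum polynomial_functions.mult polynomial_functions.const polynomial_functions_prod)
    fix q i assume "q \<in> {q. q permutes {0..<p}}" "i \<in> {0..<p}"
    then have "i < p" "q i < p" using permutes_in_image[of q "{0..<p}" i] by auto
    then show "(\<lambda>x. A x $$ (i, q i)) \<in> polynomial_functions V"
      using assms by (auto simp: polynomial_mat_def)
  qed
  ultimately show ?thesis by simp
qed

text \<open>The matrix of the map that sends the basis vector \<open>c\<close> to the basis vector \<open>f c\<close>, or to zero if \<open>f c\<close> is
  undefined or out of range. These matrices are closed under products, which makes the computations
  at the split representation below mechanical.\<close>

definition partial_mat :: "nat \<Rightarrow> nat \<Rightarrow> (nat \<Rightarrow> nat option) \<Rightarrow> complex mat"
  where "partial_mat p q f = mat p q (\<lambda>(r, c). if f c = Some r then 1 else 0)"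

lemma partial_mat_carrier [simp]: "partial_mat p q f \<in> carrier_mat p q"
  by (simp add: partial_mat_def)

lemma partial_mat_mult:
  "partial_mat p q f * partial_mat q s g =
    partial_mat p s (\<lambda>c. case g c of None \<Rightarrow> None | Some k \<Rightarrow> if k < q then f k else None)"
    (is "_ = partial_mat p s ?h")
proof (rule eq_matI)
  fix r c assume "r < dim_row (partial_mat p s ?h)" "c < dim_col (partial_mat p s ?h)"
  then have rc: "r < p" "c < s" by (simp_all add: partial_mat_def)
  have "(partial_mat p q f * partial_mat q s g) $$ (r, c) =
      (\<Sum>k\<in>{0..<q}. (if f k = Some r then 1 else 0) * (if g c = Some k then 1 else 0))"
    using rc by (auto simp: partial_mat_def scalar_prod_def intro!: sum.cong)
  also have "\<dots> = (\<Sum>k\<in>{0..<q}. if g c = Some k then if f k = Some r then 1 else 0 else 0)"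
    by (intro sum.cong) auto
  also have "\<dots> = (if ?h c = Some r then 1 else 0)"
    by (cases "g c") auto
  finally show "(partial_mat p q f * partial_mat q s g) $$ (r, c) = partial_mat p s ?h $$ (r, c)"
    using rc by (simp add: partial_mat_def)
qed (simp_all add: partial_mat_def)

lemma partial_mat_add:
  assumes "\<And>c. c < q \<Longrightarrow> f c = None \<or> g c = None"
  shows "partial_mat p q f + partial_mat p q g =
    partial_mat p q (\<lambda>c. case f c of None \<Rightarrow> g c | Some r \<Rightarrow> Some r)"
  by (rule eq_matI) (use assms in \<open>force simp: partial_mat_def split: option.split\<close>)+

lemma partial_mat_cong:
  assumes "\<And>c r. c < q \<Longrightarrow> r < p \<Longrightarrow> f c = Some r \<longleftrightarrow> g c = Some r"
  shows "partial_mat p q f = partial_mat p q g"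
  unfolding partial_mat_def by (rule cong_mat) (use assms in auto)

lemma partial_mat_one: "partial_mat p p Some = 1\<^sub>m p"
  unfolding partial_mat_def one_mat_def by (rule cong_mat) auto

lemma partial_mat_zero: "partial_mat p q (\<lambda>c. None) = 0\<^sub>m p q"
  unfolding partial_mat_def zero_mat_def by (rule cong_mat) auto

text \<open>The subrepresentation generated by fixed vectors: at vertex \<open>i\<close>, the new generators are the basis
  vectors with the indices \<open>e (i - 1), \<dots>, e i - 1\<close> (all indices below \<open>e 1\<close> at vertex \<open>1\<close>). The columns of
  \<open>frame e d M k\<close> are the images at vertex \<open>k + 1\<close> of all generators up to that vertex: the columns of the
  previous frame, mapped by \<open>M\<close>, followed by the new generators.\<close>

primrec frame :: "(nat \<Rightarrow> nat) \<Rightarrow> (nat \<Rightarrow> nat) \<Rightarrow> (nat \<Rightarrow> complex mat) \<Rightarrow> nat \<Rightarrow> complex mat"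
  where
    "frame e d M 0 = partial_mat (d 1) (e 1) Some"
  | "frame e d M (Suc k) = M (Suc k) * frame e d M k * partial_mat (e (Suc k)) (e (Suc (Suc k))) Some +
      partial_mat (d (Suc (Suc k))) (e (Suc (Suc k))) (\<lambda>c. if c < e (Suc k) then None else Some c)"

lemma frame_carrier:
  assumes "\<And>i. i \<in> {1..<n} \<Longrightarrow> M i \<in> carrier_mat (d (Suc i)) (d i)" "k < n"
  shows "frame e d M k \<in> carrier_mat (d (Suc k)) (e (Suc k))"
  using assms(2) by (cases k) simp_all

lemma frame_cong:
  assumes "\<And>i. i \<in> {1..<n} \<Longrightarrow> M i = M' i" "k < n"
  shows "frame e d M k = frame e d M' k"
  using assms(2) by (induction k) (simp_all add: assms(1))

lemma polynomial_mat_frame: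
  assumes "\<And>i. i \<in> {1..<n} \<Longrightarrow> polynomial_mat V (d (Suc i)) (d i) (\<lambda>x. M x i)" "k < n"
  shows "polynomial_mat V (d (Suc k)) (e (Suc k)) (\<lambda>x. frame e d (M x) k)"
  using assms(2)
proof (induction k)
  case 0
  then show ?case by (simp add: polynomial_mat_const)
next
  case (Suc k)
  have "polynomial_mat V (d (Suc (Suc k))) (d (Suc k)) (\<lambda>x. M x (Suc k))"
    using assms(1)[of "Suc k"] Suc.prems by simp
  moreover have "polynomial_mat V (d (Suc k)) (e (Suc k)) (\<lambda>x. frame e d (M x) k)"
    using Suc by simp
  ultimately show ?case
    unfolding frame.simps
    by (intro polynomial_mat_add polynomial_mat_mult[of _ _ "e (Suc k)"] polynomial_mat_mult[of _ _ "d (Suc k)"]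
        polynomial_mat_const partial_mat_carrier)
qed

context
  fixes n :: nat and e w :: "nat \<Rightarrow> nat"
  assumes e: "\<And>i. i \<in> {1..<n} \<Longrightarrow> e i \<le> e (Suc i)"
    and w: "\<And>i. i \<in> {1..<n} \<Longrightarrow> w (Suc i) \<le> w i"
begin

text \<open>The dimension vector of the extensions of an injective by a projective.\<close>

abbreviation (input) "total_dim \<equiv> \<lambda>i. e i + w i"

text \<open>The direct sum of a representation of dimension vector \<open>e\<close> with the standard inclusions as maps and
  one of dimension vector \<open>w\<close> with the standard projections as maps. In every space, the basis of the
  first summand precedes that of the second.\<close>

definition split_rep :: "nat \<Rightarrow> complex mat"
  where "split_rep = (\<lambda>i\<in>{1..<n}. partial_mat (total_dim (Suc i)) (total_dim i)
    (\<lambda>c. Some (if c < e i then c else e (Suc i) + (c - e i))))"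

text \<open>The first \<open>e n\<close> rows of the last frame. If the determinant does not vanish, the generators stay
  independent up to vertex \<open>n\<close>, and then all maps are injective on the generated subrepresentation.\<close>

definition frame_minor :: "(nat \<Rightarrow> complex mat) \<Rightarrow> complex mat"
  where "frame_minor M = partial_mat (e n) (total_dim n) Some * frame e total_dim M (n - 1)"

text \<open>A combination of the columns of \<open>M i\<close> and of the frame at vertex \<open>i + 1\<close>. If its determinant does not
  vanish, these columns span the space at vertex \<open>i + 1\<close>. The coefficients are chosen so that the
  combination is the identity at the split representation.\<close>

definition generation_minor :: "(nat \<Rightarrow> complex mat) \<Rightarrow> nat \<Rightarrow> complex mat"
  where "generation_minor M i =
    M i * partial_mat (total_dim i) (total_dim (Suc i)) (\<lambda>c. if c < e (Suc i) then None else Some (e i + (c - e (Suc i)))) +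
    frame e total_dim M i * partial_mat (e (Suc i)) (total_dim (Suc i)) Some"

lemma split_rep_space: "split_rep \<in> rep_space (equioriented_A n) total_dim"
  by (auto simp: rep_space_def split_rep_def)

lemma frame_split_rep: "k < n \<Longrightarrow> frame e total_dim split_rep k = partial_mat (total_dim (Suc k)) (e (Suc k)) Some"
proof (induction k)
  case (Suc k)
  then have "e (Suc k) \<le> e (Suc (Suc k))" using e by simp
  then show ?case
    using Suc by (auto simp: split_rep_def partial_mat_mult partial_mat_add split: option.splits if_splits intro!: partial_mat_cong)
qed simp

lemma frame_minor_split_rep: "1 \<le> n \<Longrightarrow> frame_minor split_rep = 1\<^sub>m (e n)"
  unfolding frame_minor_def
  by (auto simp: frame_split_rep partial_mat_mult partial_mat_one[symmetric] intro!: partial_mat_cong)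

lemma generation_minor_split_rep:
  assumes i: "i \<in> {1..<n}"
  shows "generation_minor split_rep i = 1\<^sub>m (total_dim (Suc i))"
proof -
  have "frame e total_dim split_rep i = partial_mat (total_dim (Suc i)) (e (Suc i)) Some"
    using frame_split_rep i by simp
  moreover have "split_rep i = partial_mat (total_dim (Suc i)) (total_dim i)
      (\<lambda>c. Some (if c < e i then c else e (Suc i) + (c - e i)))"
    using i by (simp add: split_rep_def)
  ultimately show ?thesis
    using e[OF i] w[OF i]
    by (auto simp: generation_minor_def partial_mat_mult partial_mat_add partial_mat_one[symmetric]
        split: option.splits if_splits intro!: partial_mat_cong)
qed

text \<open>If the determinants of all these matrices are nonzero, the subrepresentation generated by the fixed
  vectors is an inj-surj point.\<close>

lemma frame_inj_surj_locus:
  assumes n: "1 \<le> n" and M: "M \<in> rep_space (equioriented_A n) total_dim"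
    and det1: "det (frame_minor M) \<noteq> 0"
    and det2: "\<And>i. i \<in> {1..<n} \<Longrightarrow> det (generation_minor M i) \<noteq> 0"
  shows "(\<lambda>i\<in>{1..n}. (\<lambda>x. frame e total_dim M (i - 1) *\<^sub>v x) ` carrier_vec (e i)) \<in> inj_surj_locus n e total_dim M"
proof -
  let ?F = "frame e total_dim M" and ?Q = "equioriented_A n"
  let ?U = "\<lambda>i\<in>{1..n}. (\<lambda>x. frame e total_dim M (i - 1) *\<^sub>v x) ` carrier_vec (e i)"
  have Mc: "M i \<in> carrier_mat (total_dim (Suc i)) (total_dim i)" if "i \<in> {1..<n}" for i
    using M that by (auto simp: rep_space_def)
  have F: "?F k \<in> carrier_mat (total_dim (Suc k)) (e (Suc k))" if "k < n" for k
    using frame_carrier[of n M total_dim k e] Mc that by simp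
  let ?J = "\<lambda>k. partial_mat (e (Suc (Suc k))) (e (Suc k)) Some"
  \<comment> \<open>The first columns of a frame are the image of the previous frame.\<close>
  have step: "?F (Suc k) * ?J k = M (Suc k) * ?F k" if k: "Suc k < n" for k
  proof -
    have ek: "e (Suc k) \<le> e (Suc (Suc k))" using e that by simp
    let ?J' = "partial_mat (e (Suc k)) (e (Suc (Suc k))) Some"
    let ?u = "partial_mat (total_dim (Suc (Suc k))) (e (Suc (Suc k))) (\<lambda>c. if c < e (Suc k) then None else Some c)"
    have MF: "M (Suc k) * ?F k \<in> carrier_mat (total_dim (Suc (Suc k))) (e (Suc k))" using Mc[of "Suc k"] F[of k] k by simp
    have J: "?J' * ?J k = 1\<^sub>m (e (Suc k))"
      using ek by (auto simp: partial_mat_mult partial_mat_one[symmetric] intro!: partial_mat_cong)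
    have "?u * ?J k = partial_mat (total_dim (Suc (Suc k))) (e (Suc k)) (\<lambda>c. None)"
      unfolding partial_mat_mult by (rule partial_mat_cong) auto
    then have u: "?u * ?J k = 0\<^sub>m (total_dim (Suc (Suc k))) (e (Suc k))" by (simp add: partial_mat_zero)
    have "?F (Suc k) * ?J k = M (Suc k) * ?F k * ?J' * ?J k + ?u * ?J k"
      unfolding frame.simps
      by (rule add_mult_distrib_mat[OF mult_carrier_mat[OF MF partial_mat_carrier] partial_mat_carrier partial_mat_carrier])
    also have "M (Suc k) * ?F k * ?J' * ?J k = M (Suc k) * ?F k"
      using assoc_mult_mat[OF MF, of ?J' "e (Suc (Suc k))" "?J k" "e (Suc k)"] J right_mult_one_mat[OF MF] by simp
    finally show ?thesis using u MF by simp
  qed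
  have stepv: "M (Suc k) *\<^sub>v (?F k *\<^sub>v x) = ?F (Suc k) *\<^sub>v (?J k *\<^sub>v x)"
    if k: "Suc k < n" and x: "x \<in> carrier_vec (e (Suc k))" for k and x :: "complex vec"
  proof -
    have "M (Suc k) *\<^sub>v (?F k *\<^sub>v x) = (M (Suc k) * ?F k) *\<^sub>v x"
      by (rule assoc_mult_mat_vec[OF Mc F x, symmetric]) (use k in auto)
    also have "\<dots> = ?F (Suc k) *\<^sub>v (?J k *\<^sub>v x)"
      unfolding step[OF k, symmetric] by (rule assoc_mult_mat_vec[OF F[OF k] partial_mat_carrier x])
    finally show ?thesis .
  qed
  have Jinj: "x = 0\<^sub>v (e (Suc k))"
    if k: "Suc k < n" and x: "x \<in> carrier_vec (e (Suc k))" "?J k *\<^sub>v x = 0\<^sub>v (e (Suc (Suc k)))" for k x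
  proof -
    have ek: "e (Suc k) \<le> e (Suc (Suc k))" using e that by simp
    let ?J' = "partial_mat (e (Suc k)) (e (Suc (Suc k))) Some"
    have J: "?J' * ?J k = 1\<^sub>m (e (Suc k))"
      using ek by (auto simp: partial_mat_mult partial_mat_one[symmetric] intro!: partial_mat_cong)
    have "x = (?J' * ?J k) *\<^sub>v x" using J x by simp
    also have "\<dots> = ?J' *\<^sub>v (?J k *\<^sub>v x)" by (rule assoc_mult_mat_vec[OF partial_mat_carrier partial_mat_carrier x(1)])
    also have "\<dots> = 0\<^sub>v (e (Suc k))" unfolding x(2) by (rule mult_mat_zero_vec) simp
    finally show ?thesis .
  qed
  \<comment> \<open>Independence of the columns descends from vertex \<open>n\<close>.\<close>
  have Finj: "\<forall>x\<in>carrier_vec (e (Suc k)). ?F k *\<^sub>v x = 0\<^sub>v (total_dim (Suc k)) \<longrightarrow> x = 0\<^sub>v (e (Suc k))" if "k \<le> n - 1" for k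
    using that
  proof (induction rule: inc_induct)
    case base
    have Fn: "?F (n - 1) \<in> carrier_mat (total_dim n) (e n)" using F[of "n - 1"] n by simp
    have fm: "frame_minor M \<in> carrier_mat (e n) (e n)"
      unfolding frame_minor_def by (rule mult_carrier_mat[OF partial_mat_carrier Fn])
    show ?case
    proof (intro ballI impI)
      fix x assume x: "x \<in> carrier_vec (e (Suc (n - 1)))" "?F (n - 1) *\<^sub>v x = 0\<^sub>v (total_dim (Suc (n - 1)))"
      have xn: "x \<in> carrier_vec (e n)" using x n by simp
      have "frame_minor M *\<^sub>v x = partial_mat (e n) (total_dim n) Some *\<^sub>v (?F (n - 1) *\<^sub>v x)"
        unfolding frame_minor_def by (rule assoc_mult_mat_vec[OF partial_mat_carrier Fn xn])
      also have "\<dots> = 0\<^sub>v (e n)" using x n by (simp add: mult_mat_zero_vec[of _ "e n" "total_dim n"])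
      finally have "x = 0\<^sub>v (e n)"
        by (rule det_nonzero_kernel[OF fm det1 xn])
      then show "x = 0\<^sub>v (e (Suc (n - 1)))" using n by simp
    qed
  next
    case (step k)
    then have k: "Suc k < n" by simp
    show ?case
    proof (intro ballI impI)
      fix x assume x: "x \<in> carrier_vec (e (Suc k))" "?F k *\<^sub>v x = 0\<^sub>v (total_dim (Suc k))"
      have "?F (Suc k) *\<^sub>v (?J k *\<^sub>v x) = M (Suc k) *\<^sub>v 0\<^sub>v (total_dim (Suc k))" using stepv[OF k x(1)] x(2) by simp
      also have "\<dots> = 0\<^sub>v (total_dim (Suc (Suc k)))" by (rule mult_mat_zero_vec[OF Mc]) (use k in simp)
      finally have "?J k *\<^sub>v x = 0\<^sub>v (e (Suc (Suc k)))" using step.IH x(1) by (meson mult_mat_vec_carrier partial_mat_carrier)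
      then show "x = 0\<^sub>v (e (Suc k))" using Jinj[OF k x(1)] by simp
    qed
  qed
  have Ui: "?U (Suc k) = (\<lambda>x. ?F k *\<^sub>v x) ` carrier_vec (e (Suc k))" if "k < n" for k using that by simp
  have "?U \<in> quiver_Grassmannian ?Q e total_dim M"
    unfolding quiver_Grassmannian_def
  proof (intro CollectI conjI ballI)
    show "?U \<in> (\<Pi>\<^sub>E i\<in>verts ?Q. Grassmannian (e i) (total_dim i))"
    proof (intro PiE_I)
      fix i assume "i \<in> verts ?Q"
      then obtain k where k: "i = Suc k" "k < n" by (cases i) auto
      have "k \<le> n - 1" using k by simp
      from Finj[OF this] have "inj_on (\<lambda>x. ?F k *\<^sub>v x) (carrier_vec (e (Suc k)))"
        unfolding inj_on_mult_mat_vec_iff[OF F[OF k(2)]] .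
      then show "?U i \<in> Grassmannian (e i) (total_dim i)"
        unfolding Grassmannian_iff k(1) Ui[OF k(2)] using F[OF k(2)] by blast
    qed auto
  next
    fix a assume "a \<in> arcs ?Q"
    then obtain k where k: "a = Suc k" "Suc k < n" by (cases a) auto
    have "M (Suc k) *\<^sub>v (?F k *\<^sub>v x) \<in> ?U (Suc (Suc k))" if "x \<in> carrier_vec (e (Suc k))" for x
      unfolding Ui[OF k(2)] stepv[OF k(2) that] using that by (meson imageI mult_mat_vec_carrier partial_mat_carrier)
    then show "(\<lambda>x. M a *\<^sub>v x) ` ?U (tail ?Q a) \<subseteq> ?U (head ?Q a)"
      using Ui[of k] k by (auto simp del: restrict_apply)
  qed
  moreover have "inj_on (\<lambda>x. M i *\<^sub>v x) (?U i) \<and>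
      (\<forall>y\<in>carrier_vec (total_dim (Suc i)). \<exists>x\<in>carrier_vec (total_dim i). \<exists>u\<in>?U (Suc i). y = M i *\<^sub>v x + u)"
    if i: "i \<in> {1..<n}" for i
  proof
    obtain k where k: "i = Suc k" "Suc k < n" using i by (cases i) auto
    then have kn: "k < n" and kn': "Suc k \<le> n - 1" by auto
    have FSinj: "inj_on (\<lambda>x. ?F (Suc k) *\<^sub>v x) (carrier_vec (e (Suc (Suc k))))"
      unfolding inj_on_mult_mat_vec_iff[OF F[OF k(2)]] by (rule Finj[OF kn'])
    have JI: "inj_on (\<lambda>x. ?J k *\<^sub>v x) (carrier_vec (e (Suc k)))"
      unfolding inj_on_mult_mat_vec_iff[OF partial_mat_carrier] using Jinj[OF k(2)] by blast
    show "inj_on (\<lambda>x. M i *\<^sub>v x) (?U i)"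
      unfolding k(1) Ui[OF kn]
    proof (rule inj_onI, safe)
      fix x y assume x: "x \<in> carrier_vec (e (Suc k))" and y: "y \<in> carrier_vec (e (Suc k))"
        and eq: "M (Suc k) *\<^sub>v (?F k *\<^sub>v x) = M (Suc k) *\<^sub>v (?F k *\<^sub>v y)"
      have "?F (Suc k) *\<^sub>v (?J k *\<^sub>v x) = ?F (Suc k) *\<^sub>v (?J k *\<^sub>v y)"
        using eq stepv[OF k(2) x] stepv[OF k(2) y] by simp
      then have "?J k *\<^sub>v x = ?J k *\<^sub>v y"
        by (rule inj_onD[OF FSinj]) (use x y in \<open>auto intro: mult_mat_vec_carrier[OF partial_mat_carrier]\<close>)
      then have "x = y" by (rule inj_onD[OF JI]) (use x y in auto)
      then show "?F k *\<^sub>v x = ?F k *\<^sub>v y" by simp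
    qed
    show "\<forall>y\<in>carrier_vec (total_dim (Suc i)). \<exists>x\<in>carrier_vec (total_dim i). \<exists>u\<in>?U (Suc i). y = M i *\<^sub>v x + u"
    proof
      fix y :: "complex vec" assume y: "y \<in> carrier_vec (total_dim (Suc i))"
      have ii: "i < n" using i by simp
      note Mi = Mc[OF i] and Fi = F[OF ii]
      let ?R = "partial_mat (total_dim i) (total_dim (Suc i)) (\<lambda>c. if c < e (Suc i) then None else Some (e i + (c - e (Suc i))))"
      let ?I = "partial_mat (e (Suc i)) (total_dim (Suc i)) Some"
      have MR: "M i * ?R \<in> carrier_mat (total_dim (Suc i)) (total_dim (Suc i))" using Mi by (rule mult_carrier_mat) simp
      have FI: "?F i * ?I \<in> carrier_mat (total_dim (Suc i)) (total_dim (Suc i))" using Fi by (rule mult_carrier_mat) simp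
      have G: "generation_minor M i \<in> carrier_mat (total_dim (Suc i)) (total_dim (Suc i))"
        unfolding generation_minor_def by (rule add_carrier_mat[OF FI])
      obtain C where C: "C \<in> carrier_mat (total_dim (Suc i)) (total_dim (Suc i))" "generation_minor M i * C = 1\<^sub>m (total_dim (Suc i))"
        using det_nonzero_obtain_inverse[OF G det2[OF i]] by metis
      have z: "C *\<^sub>v y \<in> carrier_vec (total_dim (Suc i))" using C y by simp
      have "y = generation_minor M i *\<^sub>v (C *\<^sub>v y)"
        using assoc_mult_mat_vec[OF G C(1) y] C(2) y by simp
      also have "\<dots> = (M i * ?R) *\<^sub>v (C *\<^sub>v y) + (?F i * ?I) *\<^sub>v (C *\<^sub>v y)"
        unfolding generation_minor_def by (rule add_mult_distrib_mat_vec[OF MR FI z])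
      also have "\<dots> = M i *\<^sub>v (?R *\<^sub>v (C *\<^sub>v y)) + ?F i *\<^sub>v (?I *\<^sub>v (C *\<^sub>v y))"
        using assoc_mult_mat_vec[OF Mi partial_mat_carrier z] assoc_mult_mat_vec[OF Fi partial_mat_carrier z] by simp
      finally have "y = M i *\<^sub>v (?R *\<^sub>v (C *\<^sub>v y)) + ?F i *\<^sub>v (?I *\<^sub>v (C *\<^sub>v y))" .
      moreover have "?R *\<^sub>v (C *\<^sub>v y) \<in> carrier_vec (total_dim i)" by (rule mult_mat_vec_carrier[OF partial_mat_carrier z])
      moreover have "?F i *\<^sub>v (?I *\<^sub>v (C *\<^sub>v y)) \<in> ?U (Suc i)"
        unfolding Ui[OF ii] by (rule imageI, rule mult_mat_vec_carrier[OF partial_mat_carrier z])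
      ultimately show "\<exists>x\<in>carrier_vec (total_dim i). \<exists>u\<in>?U (Suc i). y = M i *\<^sub>v x + u" by blast
    qed
  qed
  ultimately show ?thesis by (simp add: inj_surj_locus_def del: restrict_apply)
qed

lemma generic_inj_surj_locus_nonempty:
  assumes n: "1 \<le> n" and gen: "generic_rep (equioriented_A n) total_dim M"
  shows "inj_surj_locus n e total_dim M \<noteq> {}"
proof -
  let ?Q = "equioriented_A n"
  let ?V = "{(a, r, c). a \<in> arcs ?Q \<and> r < total_dim (head ?Q a) \<and> c < total_dim (tail ?Q a)}"
  define R :: "(nat \<times> nat \<times> nat \<Rightarrow> complex) \<Rightarrow> nat \<Rightarrow> complex mat"
    where "R x i = mat (total_dim (Suc i)) (total_dim i) (\<lambda>(r, c). x (i, r, c))" for x i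
  have RM: "R (rep_coords N) i = N i" if "N \<in> rep_space ?Q total_dim" "i \<in> {1..<n}" for N i
    unfolding R_def rep_coords_def using that by (intro eq_matI) (auto simp: rep_space_def PiE_def Pi_def)
  have pR: "polynomial_mat ?V (total_dim (Suc i)) (total_dim i) (\<lambda>x. R x i)" if "i \<in> {1..<n}" for i
    using that by (auto simp: polynomial_mat_def R_def intro!: polynomial_functions.coord)
  define f where "f x = det (frame_minor (R x)) * (\<Prod>i = 1..<n. det (generation_minor (R x) i))" for x
  have p1: "(\<lambda>x. det (frame_minor (R x))) \<in> polynomial_functions ?V"
    unfolding frame_minor_def
    using polynomial_mat_frame[of n ?V total_dim R "n - 1" e] pR n
    by (intro polynomial_mat_det[of _ "e n"] polynomial_mat_mult[of _ _ "total_dim n"] polynomial_mat_const) auto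
  have p2: "(\<lambda>x. det (generation_minor (R x) i)) \<in> polynomial_functions ?V" if "i \<in> {1..<n}" for i
    unfolding generation_minor_def
    using polynomial_mat_frame[of n ?V total_dim R i e] pR that
    by (intro polynomial_mat_det[of _ "total_dim (Suc i)"] polynomial_mat_add polynomial_mat_mult[of _ _ "total_dim i"]
        polynomial_mat_mult[of _ _ "e (Suc i)"] polynomial_mat_const) auto
  have f: "f \<in> polynomial_functions ?V"
    unfolding f_def by (intro polynomial_functions.mult polynomial_functions_prod p1 p2)
  have fN: "f (rep_coords N) = det (frame_minor N) * (\<Prod>i = 1..<n. det (generation_minor N i))"
    if N: "N \<in> rep_space ?Q total_dim" for N
  proof -
    have fr: "frame e total_dim (R (rep_coords N)) k = frame e total_dim N k" if "k < n" for k
      using frame_cong[of n "R (rep_coords N)" N k e total_dim] RM[OF N] that by simp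
    have "frame_minor (R (rep_coords N)) = frame_minor N" using fr n by (simp add: frame_minor_def)
    moreover have "generation_minor (R (rep_coords N)) i = generation_minor N i" if "i \<in> {1..<n}" for i
      using fr that RM[OF N that] by (simp add: generation_minor_def)
    ultimately show ?thesis unfolding f_def by simp
  qed
  \<comment> \<open>The locus of \<open>f \<noteq> 0\<close> is open and contains the split representation, so it meets the dense orbit of \<open>M\<close>.\<close>
  let ?O = "{N \<in> rep_space ?Q total_dim. f (rep_coords N) \<noteq> 0}"
  have op: "openin (rep_space_topology ?Q total_dim) ?O"
    unfolding rep_space_topology_def openin_topology_generated_by_iff
    by (rule generate_topology_on.Basis) (use f in blast)
  have mem: "split_rep \<in> ?O"
    using split_rep_space fN[OF split_rep_space] frame_minor_split_rep[OF n] generation_minor_split_rep by simp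
  have "split_rep \<in> rep_space_topology ?Q total_dim closure_of rep_orbit ?Q total_dim M"
    using gen split_rep_space by (simp add: generic_rep_def)
  then have "\<forall>T. split_rep \<in> T \<and> openin (rep_space_topology ?Q total_dim) T \<longrightarrow> (\<exists>N. N \<in> rep_orbit ?Q total_dim M \<and> N \<in> T)"
    unfolding in_closure_of by (rule conjunct2)
  from this[THEN spec, of ?O] op mem have "\<exists>N. N \<in> rep_orbit ?Q total_dim M \<and> N \<in> ?O" by simp
  then obtain N where N: "N \<in> rep_orbit ?Q total_dim M" "N \<in> rep_space ?Q total_dim" "f (rep_coords N) \<noteq> 0"
    by blast
  have "det (frame_minor N) \<noteq> 0" "det (generation_minor N i) \<noteq> 0" if "i \<in> {1..<n}" for i
    using N(3) that unfolding fN[OF N(2)] by auto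
  moreover have "det (frame_minor N) \<noteq> 0" using N(3) unfolding fN[OF N(2)] by auto
  ultimately obtain W where W: "W \<in> inj_surj_locus n e total_dim N"
    using frame_inj_surj_locus[OF n N(2)] by blast
  have M: "M \<in> rep_space ?Q total_dim" using gen by (simp add: generic_rep_def)
  obtain g where g: "g \<in> GL_rep ?Q total_dim" "N = conj_action ?Q g M" using N(1) by (auto simp: rep_orbit_def)
  \<comment> \<open>An inj-surj point of a representation in the orbit is transported back to \<open>M\<close>.\<close>
  define h where "h i = the (mat_inverse (g i))" for i
  have gi: "g i \<in> carrier_mat (total_dim i) (total_dim i)" "invertible_mat (g i)" if "i \<in> {1..n}" for i
    using g(1) that by (auto simp: GL_rep_def PiE_def Pi_def)
  note hi = mat_inverse_invertible[OF gi, folded h_def]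
  have "(\<lambda>i\<in>{1..n}. (\<lambda>x. h i *\<^sub>v x) ` W i) \<in> inj_surj_locus n e total_dim M"
  proof (rule inj_surj_locus_transport[OF N(2) M _ _ _ W])
    fix i assume i: "i \<in> {1..n}"
    show "h i \<in> carrier_mat (total_dim i) (total_dim i)" by (rule hi(1)[OF i i])
    show "invertible_mat (h i)"
      using invertible_matI[OF hi(1)[OF i i] gi(1)[OF i] hi(3)[OF i i] hi(2)[OF i i]] .
  next
    fix i assume i: "i \<in> {1..<n}"
    then have i': "i \<in> {1..n}" "Suc i \<in> {1..n}" by auto
    have Mi: "M i \<in> carrier_mat (total_dim (Suc i)) (total_dim i)" using M i by (auto simp: rep_space_def)
    note c = gi(1)[OF i'(2)] hi(1)[OF i'(1) i'(1)] hi(1)[OF i'(2) i'(2)]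
    have "N i = g (Suc i) * M i * h i" using i by (simp add: g(2) conj_action_def h_def)
    also have "h (Suc i) * \<dots> = (h (Suc i) * (g (Suc i) * M i)) * h i"
      using c Mi by (intro assoc_mult_mat[symmetric]) auto
    also have "h (Suc i) * (g (Suc i) * M i) = (h (Suc i) * g (Suc i)) * M i"
      using c Mi by (intro assoc_mult_mat[symmetric]) auto
    also have "\<dots> = M i" using hi(3)[OF i'(2) i'(2)] Mi by simp
    finally show "h (Suc i) * N i = M i * h i" .
  qed
  then show ?thesis by blast
qed

end

section \<open>Dimension vectors of projective and injective representations\<close>

lemma mat_mult_one_dim_le:
  fixes A B :: "'a::field mat"
  assumes A: "A \<in> carrier_mat p q" and B: "B \<in> carrier_mat q p" and AB: "A * B = 1\<^sub>m p"
  shows "p \<le> q"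
proof (rule ccontr)
  assume "\<not> p \<le> q"
  then have qp: "q < p" by simp
  \<comment> \<open>Padding to square matrices by zeros keeps the product, but makes the reverse product singular.\<close>
  let ?A = "mat p p (\<lambda>(r, c). if c < q then A $$ (r, c) else 0)"
  let ?B = "mat p p (\<lambda>(r, c). if r < q then B $$ (r, c) else 0)"
  have c: "?A \<in> carrier_mat p p" "?B \<in> carrier_mat p p" by simp_all
  have "?A * ?B = 1\<^sub>m p"
  proof (rule eq_matI)
    fix r s assume "r < dim_row (1\<^sub>m p)" "s < dim_col (1\<^sub>m p)"
    then have rs: "r < p" "s < p" by simp_all
    have "(?A * ?B) $$ (r, s) = (\<Sum>k\<in>{0..<p}. if k < q then A $$ (r, k) * B $$ (k, s) else 0)"
      using rs by (auto simp: scalar_prod_def intro!: sum.cong)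
    also have "\<dots> = (\<Sum>k\<in>{0..<q}. A $$ (r, k) * B $$ (k, s))"
      using qp by (intro sum.mono_neutral_cong_right) auto
    also have "\<dots> = (A * B) $$ (r, s)"
      using rs A B by (auto simp: scalar_prod_def intro!: sum.cong)
    finally show "(?A * ?B) $$ (r, s) = 1\<^sub>m p $$ (r, s)" using AB by simp
  qed simp_all
  from mat_mult_left_right_inverse[OF c this] have "(?B * ?A) $$ (q, q) = 1" using qp by simp
  moreover have "(?B * ?A) $$ (q, q) = 0" using qp by (simp add: scalar_prod_def)
  ultimately show False by simp
qed

lemma empty_mat_eq:
  assumes "A \<in> carrier_mat p q" "B \<in> carrier_mat p q" "p = 0 \<or> q = 0"
  shows "A = B"
  by (rule eq_matI) (use assms in auto)

text \<open>Let \<open>Y\<close> be the quotient of \<open>P\<close> that lives on the vertices up to \<open>i\<close>, and let \<open>X\<close> prolong it by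
  identity maps of the space at \<open>i\<close>. Lifting the projection of \<open>P\<close> to \<open>Y\<close> through \<open>X\<close> gives a left inverse of
  the map \<open>P i\<close>.\<close>

lemma projective_dim_mono:
  assumes P: "projective_rep (equioriented_A n) dP P" and i: "i \<in> {1..<n}"
  shows "dP i \<le> dP (Suc i)"
proof -
  let ?Q = "equioriented_A n"
  have Pc: "P a \<in> carrier_mat (dP (Suc a)) (dP a)" if "a \<in> {1..<n}" for a
    using P that by (auto simp: projective_rep_def rep_space_def)
  define dX where "dX k = (if k \<le> i then dP k else dP i)" for k
  define X where "X = (\<lambda>a\<in>{1..<n}. if a < i then P a else 1\<^sub>m (dP i))"
  define dY where "dY k = (if k \<le> i then dP k else 0)" for k
  define Y where "Y = (\<lambda>a\<in>{1..<n}. if a < i then P a else 0\<^sub>m (dY (Suc a)) (dY a))"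
  define g where "g = (\<lambda>k\<in>{1..n}. if k \<le> i then 1\<^sub>m (dP k) else 0\<^sub>m 0 (dP i) :: complex mat)"
  define f where "f = (\<lambda>k\<in>{1..n}. if k \<le> i then 1\<^sub>m (dP k) else 0\<^sub>m 0 (dP k) :: complex mat)"
  have X: "X \<in> rep_space ?Q dX" using Pc by (auto simp: rep_space_def X_def dX_def)
  have Y: "Y \<in> rep_space ?Q dY" using Pc by (auto simp: rep_space_def Y_def dY_def)
  have g: "g \<in> rep_hom ?Q dX X dY Y"
    unfolding rep_hom_def
  proof (intro CollectI conjI ballI)
    show gP: "g \<in> (\<Pi>\<^sub>E k\<in>verts ?Q. carrier_mat (dY k) (dX k))" by (auto simp: g_def dX_def dY_def)
    fix a assume "a \<in> arcs ?Q"
    then have a: "a \<in> {1..<n}" by simp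
    have "g (Suc a) * X a \<in> carrier_mat (dY (Suc a)) (dX a)"
      by (rule mult_carrier_mat[of _ _ "dX (Suc a)"]) (use gP X a in \<open>auto simp: rep_space_def PiE_def Pi_def\<close>)
    moreover have "Y a * g a \<in> carrier_mat (dY (Suc a)) (dX a)"
      by (rule mult_carrier_mat[of _ _ "dY a"]) (use gP Y a in \<open>auto simp: rep_space_def PiE_def Pi_def\<close>)
    ultimately have empty: "g (Suc a) * X a = Y a * g a" if "dY (Suc a) = 0 \<or> dX a = 0"
      using that by (rule empty_mat_eq)
    show "g (head ?Q a) * X a = Y a * g (tail ?Q a)"
    proof (cases "a < i")
      case True
      then show ?thesis using a Pc[OF a] by (simp add: g_def X_def Y_def)
    next
      case False
      then show ?thesis using empty by (simp add: dY_def)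
    qed
  qed
  have surj: "rep_surj ?Q dX dY g"
    unfolding rep_surj_def
  proof
    fix k assume "k \<in> verts ?Q"
    then have k: "k \<in> {1..n}" by simp
    show "(\<lambda>x. g k *\<^sub>v x) ` carrier_vec (dX k) = carrier_vec (dY k)"
    proof (cases "k \<le> i")
      case True
      then show ?thesis using k by (auto simp: g_def dX_def dY_def)
    next
      case False
      then have "dim_vec (g k *\<^sub>v x) = 0" for x using k by (simp add: g_def)
      then have gx: "g k *\<^sub>v x = 0\<^sub>v 0" for x by (intro eq_vecI) auto
      have zero: "(0\<^sub>v (dX k) :: complex vec) \<in> carrier_vec (dX k)" by simp
      have "(\<lambda>x. g k *\<^sub>v x) ` carrier_vec (dX k) = {0\<^sub>v 0}"
        using imageI[OF zero, of "\<lambda>x. g k *\<^sub>v x"] unfolding gx by fast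
      also have "\<dots> = carrier_vec 0" by auto
      finally show ?thesis using False by (simp add: dY_def)
    qed
  qed
  have f: "f \<in> rep_hom ?Q dP P dY Y"
    unfolding rep_hom_def
  proof (intro CollectI conjI ballI)
    show fP: "f \<in> (\<Pi>\<^sub>E k\<in>verts ?Q. carrier_mat (dY k) (dP k))" by (auto simp: f_def dY_def)
    fix a assume "a \<in> arcs ?Q"
    then have a: "a \<in> {1..<n}" by simp
    have "f (Suc a) * P a \<in> carrier_mat (dY (Suc a)) (dP a)"
      by (rule mult_carrier_mat[OF _ Pc[OF a]]) (use fP a in \<open>auto simp: PiE_def Pi_def\<close>)
    moreover have "Y a * f a \<in> carrier_mat (dY (Suc a)) (dP a)"
      by (rule mult_carrier_mat[of _ _ "dY a"]) (use fP Y a in \<open>auto simp: rep_space_def PiE_def Pi_def\<close>)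
    ultimately have empty: "f (Suc a) * P a = Y a * f a" if "dY (Suc a) = 0 \<or> dP a = 0"
      using that by (rule empty_mat_eq)
    show "f (head ?Q a) * P a = Y a * f (tail ?Q a)"
    proof (cases "a < i")
      case True
      then show ?thesis using a Pc[OF a] by (simp add: f_def Y_def)
    next
      case False
      then show ?thesis using empty by (simp add: dY_def)
    qed
  qed
  obtain h where h: "h \<in> rep_hom ?Q dP P dX X" "\<forall>k\<in>verts ?Q. g k * h k = f k"
    using P X Y g surj f unfolding projective_rep_def by blast
  have hc: "h i \<in> carrier_mat (dP i) (dP i)" "h (Suc i) \<in> carrier_mat (dP i) (dP (Suc i))"
    using h(1) i PiE_mem[of h "{1..n}" "\<lambda>k. carrier_mat (dX k) (dP k)" i]
      PiE_mem[of h "{1..n}" "\<lambda>k. carrier_mat (dX k) (dP k)" "Suc i"] by (auto simp: rep_hom_def dX_def)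
  have "h (Suc i) * P i = X i * h i" using h(1) i by (auto simp: rep_hom_def)
  also have "\<dots> = h i" using hc i by (simp add: X_def)
  also have "\<dots> = g i * h i" using hc i by (simp add: g_def)
  also have "\<dots> = 1\<^sub>m (dP i)" using h(2) i by (simp add: f_def)
  finally show ?thesis using mat_mult_one_dim_le[OF hc(2) Pc[OF i]] by simp
qed

text \<open>Dually, let \<open>X\<close> be the subrepresentation of \<open>I\<close> that lives on the vertices after \<open>i\<close>, and let \<open>Y\<close>
  prolong it to the left by identity maps of the space at \<open>i + 1\<close>. Extending the inclusion of \<open>X\<close> in \<open>I\<close>
  to \<open>Y\<close> gives a right inverse of the map \<open>I i\<close>.\<close>

lemma injective_dim_antimono:
  assumes I: "injective_rep (equioriented_A n) dI I" and i: "i \<in> {1..<n}"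
  shows "dI (Suc i) \<le> dI i"
proof -
  let ?Q = "equioriented_A n"
  have Ic: "I a \<in> carrier_mat (dI (Suc a)) (dI a)" if "a \<in> {1..<n}" for a
    using I that by (auto simp: injective_rep_def rep_space_def)
  define dX where "dX k = (if k \<le> i then 0 else dI k)" for k
  define X where "X = (\<lambda>a\<in>{1..<n}. if a \<le> i then 0\<^sub>m (dX (Suc a)) 0 else I a)"
  define dY where "dY k = (if k \<le> i then dI (Suc i) else dI k)" for k
  define Y where "Y = (\<lambda>a\<in>{1..<n}. if a \<le> i then 1\<^sub>m (dI (Suc i)) else I a)"
  define g where "g = (\<lambda>k\<in>{1..n}. if k \<le> i then 0\<^sub>m (dI (Suc i)) 0 else 1\<^sub>m (dI k) :: complex mat)"
  define f where "f = (\<lambda>k\<in>{1..n}. if k \<le> i then 0\<^sub>m (dI k) 0 else 1\<^sub>m (dI k) :: complex mat)"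
  have X: "X \<in> rep_space ?Q dX" using Ic by (auto simp: rep_space_def X_def dX_def)
  have "Y a \<in> carrier_mat (dY (Suc a)) (dY a)" if "a \<in> {1..<n}" for a
    using Ic[OF that] that by (cases "a = i") (auto simp: Y_def dY_def)
  then have Y: "Y \<in> rep_space ?Q dY" by (auto simp: rep_space_def Y_def)
  have g: "g \<in> rep_hom ?Q dX X dY Y"
    unfolding rep_hom_def
  proof (intro CollectI conjI ballI)
    show gP: "g \<in> (\<Pi>\<^sub>E k\<in>verts ?Q. carrier_mat (dY k) (dX k))" by (auto simp: g_def dX_def dY_def)
    fix a assume "a \<in> arcs ?Q"
    then have a: "a \<in> {1..<n}" by simp
    have "g (Suc a) * X a \<in> carrier_mat (dY (Suc a)) (dX a)"
      by (rule mult_carrier_mat[of _ _ "dX (Suc a)"]) (use gP X a in \<open>auto simp: rep_space_def PiE_def Pi_def\<close>)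
    moreover have "Y a * g a \<in> carrier_mat (dY (Suc a)) (dX a)"
      by (rule mult_carrier_mat[of _ _ "dY a"]) (use gP Y a in \<open>auto simp: rep_space_def PiE_def Pi_def\<close>)
    ultimately have empty: "g (Suc a) * X a = Y a * g a" if "dY (Suc a) = 0 \<or> dX a = 0"
      using that by (rule empty_mat_eq)
    show "g (head ?Q a) * X a = Y a * g (tail ?Q a)"
    proof (cases "a \<le> i")
      case True
      then show ?thesis using empty by (simp add: dX_def)
    next
      case False
      then show ?thesis using a Ic[OF a] by (simp add: g_def X_def Y_def)
    qed
  qed
  have inj: "rep_inj ?Q dX g"
    unfolding rep_inj_def
  proof
    fix k assume "k \<in> verts ?Q"
    then have k: "k \<in> {1..n}" by simp
    show "inj_on (\<lambda>x. g k *\<^sub>v x) (carrier_vec (dX k))"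
      using k by (cases "k \<le> i") (auto simp: g_def dX_def inj_on_def)
  qed
  have f: "f \<in> rep_hom ?Q dX X dI I"
    unfolding rep_hom_def
  proof (intro CollectI conjI ballI)
    show fP: "f \<in> (\<Pi>\<^sub>E k\<in>verts ?Q. carrier_mat (dI k) (dX k))" by (auto simp: f_def dX_def)
    fix a assume "a \<in> arcs ?Q"
    then have a: "a \<in> {1..<n}" by simp
    have "f (Suc a) * X a \<in> carrier_mat (dI (Suc a)) (dX a)"
      by (rule mult_carrier_mat[of _ _ "dX (Suc a)"]) (use fP X a in \<open>auto simp: rep_space_def PiE_def Pi_def\<close>)
    moreover have "I a * f a \<in> carrier_mat (dI (Suc a)) (dX a)"
      by (rule mult_carrier_mat[OF Ic[OF a]]) (use fP a in \<open>auto simp: PiE_def Pi_def\<close>)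
    ultimately have empty: "f (Suc a) * X a = I a * f a" if "dI (Suc a) = 0 \<or> dX a = 0"
      using that by (rule empty_mat_eq)
    show "f (head ?Q a) * X a = I a * f (tail ?Q a)"
    proof (cases "a \<le> i")
      case True
      then show ?thesis using empty by (simp add: dX_def)
    next
      case False
      then show ?thesis using a Ic[OF a] by (simp add: f_def X_def)
    qed
  qed
  obtain h where h: "h \<in> rep_hom ?Q dY Y dI I" "\<forall>k\<in>verts ?Q. h k * g k = f k"
    using I X Y g inj f unfolding injective_rep_def by blast
  have hc: "h i \<in> carrier_mat (dI i) (dI (Suc i))" "h (Suc i) \<in> carrier_mat (dI (Suc i)) (dI (Suc i))"
    using h(1) i PiE_mem[of h "{1..n}" "\<lambda>k. carrier_mat (dI k) (dY k)" i]
      PiE_mem[of h "{1..n}" "\<lambda>k. carrier_mat (dI k) (dY k)" "Suc i"] by (auto simp: rep_hom_def dY_def)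
  have "I i * h i = h (Suc i) * Y i" using h(1) i by (auto simp: rep_hom_def)
  also have "\<dots> = h (Suc i) * g (Suc i)" using i by (simp add: Y_def g_def)
  also have "\<dots> = 1\<^sub>m (dI (Suc i))" using h(2) i by (simp add: f_def)
  finally show ?thesis using mat_mult_one_dim_le[OF Ic[OF i] hc(1)] by simp
qed

section \<open>The open orbit\<close>

theorem theorem3:
  fixes n :: nat
    and dP dI :: "nat \<Rightarrow> nat"
    and P I M :: "nat \<Rightarrow> complex mat"
  assumes "n \<ge> 1"
    and "projective_rep (equioriented_A n) dP P"
    and "injective_rep (equioriented_A n) dI I"
    and "generic_rep (equioriented_A n) (\<lambda>i. dP i + dI i) M"
  shows "\<exists>U \<in> quiver_Grassmannian (equioriented_A n) dP (\<lambda>i. dP i + dI i) M.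
           openin (quiver_Grassmannian_topology (equioriented_A n) dP (\<lambda>i. dP i + dI i) M)
             (aut_orbit (equioriented_A n) (\<lambda>i. dP i + dI i) M U)"
proof -
  let ?d = "\<lambda>i. dP i + dI i"
  have M: "M \<in> rep_space (equioriented_A n) ?d" using assms(4) by (simp add: generic_rep_def)
  obtain U where U: "U \<in> inj_surj_locus n dP ?d M"
    using generic_inj_surj_locus_nonempty[OF projective_dim_mono[OF assms(2)] injective_dim_antimono[OF assms(3)] assms(1,4)]
    by blast
  have "openin (quiver_Grassmannian_topology (equioriented_A n) dP ?d M) (aut_orbit (equioriented_A n) ?d M U)"
    unfolding aut_orbit_eq_inj_surj_locus[OF assms(1) M U] by (rule openin_inj_surj_locus[OF M])
  moreover have "U \<in> quiver_Grassmannian (equioriented_A n) dP ?d M" using U by (simp add: inj_surj_locus_def)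
  ultimately show ?thesis by blast
qed

end
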